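(* Let $G=(V,E)$ be a finite simple graph with a fixed total order on $V$, and $\lambda$ a partition. The coefficient of $\overline{p}'_\lambda$ in the $\overline{p}'$-expansion of $\omega(\overline{X}_G)$ equals the number of sets $\{L_1,\dots,L_{\ell(\lambda)}\}$ of $\ell(\lambda)$ pairwise distinct Lyndon heaps on $G$ with $|L_i|=\lambda_i$ (i.e. for each $k$, exactly $i_k(\lambda)$ of them have size $k$) such that every vertex of $G$ is used by at least one $L_i$. Equivalently, it equals $\sum_{W\subseteq V}(-1)^{|V\setminus W|}\prod_{k\ge1}\binom{|\mathcal{L}_{G|_W}(k)|}{i_k(\lambda)}$. In particular $\omega(\overline{X}_G)$ is $\overline{p}'$-positive.
   Context: Graphs finite simple; $G|_W$ induced subgraph; $i_k(\lambda)$ multiplicity of $k$ in $\lambda$. $\overline{X}_G=\sum_\kappa\prod_v\prod_{i\in\kappa(v)}x_i$ over proper set colorings $\kappa$ (nonempty color sets, disjoint on adjacent vertices). $1+\overline{p}'_k=\prod_{i\ge1}\frac1{1-x_i^k}$, $\overline{p}'_\lambda=\prod_i\overline{p}'_{\lambda_i}$. $\omega$ is the standard involution on symmetric functions ($\omega(p_\lambda)=(-1)^{|\lambda|-\ell(\lambda)}p_\lambda$), extended degree-wise to symmetric power series. Heaps: fix a total order on $V$. A heap on $G$ is an equivalence class of finite words over $V$ under swapping adjacent letters $u\neq v$ nonadjacent in $G$; size = length; a vertex is used if it occurs; composition = concatenation. Pieces are partially ordered by the transitive closure of: piece $i\prec$ piece $j$ if $i<j$ and the letters are equal or adjacent. A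 pyramid has a unique minimal piece. Periodic: $H=K^{\circ m}$, $m>1$. Rotation: for a piece $p$ with $V_p$ the heap of pieces $\succeq p$ and $H=U\circ V_p$, $A_p(H)=V_p\circ U$; iterates stabilize at a pyramid $A_p^\infty(H)$ with minimal piece $p$; this defines rotation-equivalence of pyramids; each class is entirely periodic or aperiodic. Standard word = lexicographically maximal representative. A Lyndon heap is an aperiodic pyramid with lexicographically minimal standard word in its rotation class. $\mathcal{L}_G(k)$ = Lyndon heaps of size $k$. *)

theory Defs
  imports Complex_Main "HOL-Library.Poly_Mapping"
begin

type_synonym mon = "nat \<Rightarrow>\<^sub>0 nat"
type_synonym sps = "mon \<Rightarrow> rat"

definition deg :: "mon \<Rightarrow> nat" where
  "deg m = (\<Sum>i\<in>Poly_Mapping.keys m. Poly_Mapping.lookup m i)"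

definition sps_one :: sps where
  "sps_one m = (if m = 0 then 1 else 0)"

definition sps_times :: "sps \<Rightarrow> sps \<Rightarrow> sps" where
  "sps_times f g m = (\<Sum>a\<in>{a. \<forall>i. Poly_Mapping.lookup a i \<le> Poly_Mapping.lookup m i}. f a * g (m - a))"

definition sps_prod :: "sps list \<Rightarrow> sps" where
  "sps_prod fs = foldr sps_times fs sps_one"

definition is_partition :: "nat list \<Rightarrow> bool" where
  "is_partition la \<longleftrightarrow> sorted_wrt (\<ge>) la \<and> (\<forall>k\<in>set la. 0 < k)"

definition partitions :: "nat \<Rightarrow> nat list set" where
  "partitions n = {la. is_partition la \<and> sum_list la = n}"

definition psum :: "nat \<Rightarrow> sps" where
  "psum k m = (if \<exists>i. m = Poly_Mapping.single i k then 1 else 0)"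

definition pl :: "nat list \<Rightarrow> sps" where
  "pl la = sps_prod (map psum la)"

text \<open>pbar'_k, defined by 1 + pbar'_k = prod_i 1/(1 - x_i^k); its coefficients
  are written out: the coefficient of a monomial m is 1 iff m is nonconstant and
  every exponent is divisible by k.\<close>
definition pbar :: "nat \<Rightarrow> sps" where
  "pbar k m = (if m \<noteq> 0 \<and> (\<forall>i. k dvd Poly_Mapping.lookup m i) then 1 else 0)"

definition pbarl :: "nat list \<Rightarrow> sps" where
  "pbarl la = sps_prod (map pbar la)"

definition hom :: "nat \<Rightarrow> sps \<Rightarrow> sps" where
  "hom n f m = (if deg m = n then f m else 0)"

definition pcoeff :: "sps \<Rightarrow> nat \<Rightarrow> nat list \<Rightarrow> rat" where
  "pcoeff f n = (THE c. (\<forall>la. la \<notin> partitions n \<longrightarrow> c la = 0) \<and>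
       hom n f = (\<lambda>m. \<Sum>la\<in>partitions n. c la * pl la m))"

definition omega :: "sps \<Rightarrow> sps" where
  "omega f m = (\<Sum>la\<in>partitions (deg m).
      (-1) ^ (deg m - length la) * pcoeff f (deg m) la * pl la m)"

definition simple_graph :: "'a set \<Rightarrow> ('a \<Rightarrow> 'a \<Rightarrow> bool) \<Rightarrow> bool" where
  "simple_graph V E \<longleftrightarrow> finite V \<and> (\<forall>u v. E u v \<longrightarrow> E v u) \<and> (\<forall>v. \<not> E v v)
     \<and> (\<forall>u v. E u v \<longrightarrow> u \<in> V \<and> v \<in> V)"

definition induced :: "('a \<Rightarrow> 'a \<Rightarrow> bool) \<Rightarrow> 'a set \<Rightarrow> 'a \<Rightarrow> 'a \<Rightarrow> bool" where
  "induced E W u v \<longleftrightarrow> E u v \<and> u \<in> W \<and> v \<in> W"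

definition set_colorings :: "'a set \<Rightarrow> ('a \<Rightarrow> 'a \<Rightarrow> bool) \<Rightarrow> ('a \<Rightarrow> nat set) set" where
  "set_colorings V E = {\<kappa>. (\<forall>v\<in>V. \<kappa> v \<noteq> {} \<and> finite (\<kappa> v)) \<and> (\<forall>v. v \<notin> V \<longrightarrow> \<kappa> v = {})
     \<and> (\<forall>u v. E u v \<longrightarrow> \<kappa> u \<inter> \<kappa> v = {})}"

text \<open>Coefficient of x^m in XG: number of proper set colorings kappa with
  prod_v prod_{i in kappa v} x_i = x^m.\<close>
definition XG :: "'a set \<Rightarrow> ('a \<Rightarrow> 'a \<Rightarrow> bool) \<Rightarrow> sps" where
  "XG V E m = of_nat (card {\<kappa>\<in>set_colorings V E. \<forall>i. Poly_Mapping.lookup m i = card {v\<in>V. i \<in> \<kappa> v}})"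

definition swap1 :: "('a \<Rightarrow> 'a \<Rightarrow> bool) \<Rightarrow> 'a list \<Rightarrow> 'a list \<Rightarrow> bool" where
  "swap1 E w w' \<longleftrightarrow> (\<exists>xs ys u v. w = xs @ [u, v] @ ys \<and> w' = xs @ [v, u] @ ys \<and> u \<noteq> v \<and> \<not> E u v)"

definition heapcl :: "('a \<Rightarrow> 'a \<Rightarrow> bool) \<Rightarrow> 'a list \<Rightarrow> 'a list set" where
  "heapcl E w = {w'. (w, w') \<in> {(x, y). swap1 E x y}\<^sup>*}"

definition heaps :: "'a set \<Rightarrow> ('a \<Rightarrow> 'a \<Rightarrow> bool) \<Rightarrow> 'a list set set" where
  "heaps V E = {heapcl E w | w. w \<in> lists V}"

definition hsize :: "'a list set \<Rightarrow> nat" where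
  "hsize H = length (SOME w. w \<in> H)"

definition used :: "'a list set \<Rightarrow> 'a set" where
  "used H = set (SOME w. w \<in> H)"

definition prec :: "('a \<Rightarrow> 'a \<Rightarrow> bool) \<Rightarrow> 'a list \<Rightarrow> (nat \<times> nat) set" where
  "prec E w = {(i, j). i < j \<and> j < length w \<and> (w ! i = w ! j \<or> E (w ! i) (w ! j))}"

definition minpos :: "('a \<Rightarrow> 'a \<Rightarrow> bool) \<Rightarrow> 'a list \<Rightarrow> nat set" where
  "minpos E w = {j. j < length w \<and> (\<forall>i. (i, j) \<notin> prec E w)}"

definition pyramid :: "('a \<Rightarrow> 'a \<Rightarrow> bool) \<Rightarrow> 'a list set \<Rightarrow> bool" where
  "pyramid E H \<longleftrightarrow> (\<exists>w\<in>H. card (minpos E w) = 1)"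

definition periodic :: "('a \<Rightarrow> 'a \<Rightarrow> bool) \<Rightarrow> 'a list set \<Rightarrow> bool" where
  "periodic E H \<longleftrightarrow> (\<exists>w m. 1 < m \<and> H = heapcl E (concat (replicate m w)))"

text \<open>Rotation A_p on a representative word: pieces above p (V_p) moved to the front.
  After one rotation, the piece p sits at position 0.\<close>
definition upper :: "('a \<Rightarrow> 'a \<Rightarrow> bool) \<Rightarrow> 'a list \<Rightarrow> nat \<Rightarrow> nat set" where
  "upper E w p = {j. j < length w \<and> (p, j) \<in> (prec E w)\<^sup>*}"

definition rotw :: "('a \<Rightarrow> 'a \<Rightarrow> bool) \<Rightarrow> 'a list \<Rightarrow> nat \<Rightarrow> 'a list" where
  "rotw E w p = nths w (upper E w p) @ nths w (- upper E w p)"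

definition riter :: "('a \<Rightarrow> 'a \<Rightarrow> bool) \<Rightarrow> 'a list \<Rightarrow> nat \<Rightarrow> nat \<Rightarrow> 'a list" where
  "riter E w p k = ((\<lambda>u. rotw E u 0) ^^ k) (rotw E w p)"

definition rotinf :: "('a \<Rightarrow> 'a \<Rightarrow> bool) \<Rightarrow> 'a list \<Rightarrow> nat \<Rightarrow> 'a list set" where
  "rotinf E w p = (THE H. \<exists>N. \<forall>k\<ge>N. heapcl E (riter E w p k) = H)"

definition rclass :: "('a \<Rightarrow> 'a \<Rightarrow> bool) \<Rightarrow> 'a list set \<Rightarrow> 'a list set set" where
  "rclass E P = {rotinf E w q | w q. w \<in> P \<and> q < length w}"

definition lexless :: "'a::linorder list \<Rightarrow> 'a list \<Rightarrow> bool" where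
  "lexless xs ys \<longleftrightarrow> (xs, ys) \<in> lexord {(a, b). a < b}"

definition stdword :: "'a::linorder list set \<Rightarrow> 'a list" where
  "stdword H = (THE w. w \<in> H \<and> (\<forall>v\<in>H. v = w \<or> lexless v w))"

definition lyndon_heap :: "'a::linorder set \<Rightarrow> ('a \<Rightarrow> 'a \<Rightarrow> bool) \<Rightarrow> 'a list set \<Rightarrow> bool" where
  "lyndon_heap V E L \<longleftrightarrow> L \<in> heaps V E \<and> pyramid E L \<and> \<not> periodic E L \<and>
     (\<forall>Q\<in>rclass E L. stdword L = stdword Q \<or> lexless (stdword L) (stdword Q))"

definition lyndon :: "'a::linorder set \<Rightarrow> ('a \<Rightarrow> 'a \<Rightarrow> bool) \<Rightarrow> nat \<Rightarrow> 'a list set set" where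
  "lyndon V E k = {L. lyndon_heap V E L \<and> hsize L = k}"

definition Ncov :: "'a::linorder set \<Rightarrow> ('a \<Rightarrow> 'a \<Rightarrow> bool) \<Rightarrow> nat list \<Rightarrow> nat" where
  "Ncov V E la = card {S. finite S \<and> (\<forall>L\<in>S. lyndon_heap V E L) \<and>
      (\<forall>k. card {L\<in>S. hsize L = k} = count_list la k) \<and> (\<Union>L\<in>S. used L) = V}"

end

theory Submission
  imports Defs "HOL-Library.List_Lexorder" "HOL-Library.Multiset" "HOL-Library.FuncSet"
    "HOL-Library.Sublist" "HOL-Computational_Algebra.Formal_Power_Series"
begin

text \<open>
  Let \<open>s_W(j)\<close> be the number of stable sets of size \<open>j\<close> in \<open>W\<close> and \<open>h_W(j)\<close> the number of heaps of
  size \<open>j\<close> on \<open>W\<close>. By inclusion-exclusion \<open>XG\<close> is the signed sum over \<open>W\<close> of the products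
  \<open>\<Prod>\<^sub>i (\<Sum>\<^sub>j s_W(j) x\<^sub>i^j)\<close>. Two such multiplicative series, built from power series \<open>f\<close> and \<open>g\<close> with
  \<open>f(-x) g(x) = 1\<close>, are exchanged by the involution: both satisfy Newton's recursion with the
  coefficients of a logarithmic derivative, up to exactly the signs by which the involution acts on
  power sums. Cartier-Foata inversion \<open>s_W(-x) h_W(x) = 1\<close> therefore turns \<open>s_W\<close> into \<open>h_W\<close>.

  Heaps are represented by their lexicographically maximal words. A word is such a normal form iff
  all factors of its Lyndon factorization are, so \<open>h_W(x)\<close> is the product of \<open>1 / (1 - x^|l|)\<close> over
  the normal Lyndon words \<open>l\<close>, which gives the expansion in products of \<open>pbar\<close>. Finally, the Lyndon
  heaps are exactly the classes of normal Lyndon words: in a normal form starting with its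
  least letter \<open>a\<close>, every occurrence of \<open>a\<close> lies below everything to its right, so rotating the heap
  at that occurrence is rotating the word.
\<close>

subsection \<open>Words up to commutation\<close>

text \<open>Neither side of the identity is homogeneous or finite: products of \<open>pbar\<close>
  have terms in infinitely many degrees, and there may be infinitely many Lyndon heaps. So
  everything is proved for the coefficient at one monomial \<open>m\<close>, with Lyndon words cut
  off at length \<open>deg m\<close>. Moreover \<open>omega\<close> rests on the description
  operator in \<open>pcoeff\<close>, which says nothing until the power sum products are known to be
  independent and the series to be a combination of them; Newton's recursion builds that combination
  degree by degree. Inclusion-exclusion over \<open>W\<close> appears because the requirement that
  every vertex occurs is the only link between different colors, and between different Lyndon heaps.
  Without it the series factors over the variables, respectively over the Lyndon words. It is
  applied in both directions. Maximal representatives fit Lyndon words through one pattern: a word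
  is not normal iff it has a factor \<open>b u a\<close> with \<open>b < a\<close> in which
  \<open>a\<close> commutes with \<open>b\<close> and with all of \<open>u\<close>. In a decreasing
  product of Lyndon words, such a factor crossing a seam would already show up in the part after the
  seam, because that part begins with a letter below all others involved.\<close>

definition teq :: "('a \<Rightarrow> 'a \<Rightarrow> bool) \<Rightarrow> 'a list \<Rightarrow> 'a list \<Rightarrow> bool" where
  "teq E = (swap1 E)\<^sup>*\<^sup>*"

text \<open>\<open>front E a w\<close>: some minimal piece of the heap of \<open>w\<close> is labelled \<open>a\<close>.\<close>

primrec front :: "('a \<Rightarrow> 'a \<Rightarrow> bool) \<Rightarrow> 'a \<Rightarrow> 'a list \<Rightarrow> bool" where
  "front E a [] \<longleftrightarrow> False"
| "front E a (x # w) \<longleftrightarrow> x = a \<or> \<not> E x a \<and> front E a w"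

definition nf :: "('a::linorder \<Rightarrow> 'a \<Rightarrow> bool) \<Rightarrow> 'a list \<Rightarrow> bool" where
  "nf E w \<longleftrightarrow> (\<forall>v. teq E w v \<longrightarrow> v \<le> w)"

lemma heapcl_teq: "heapcl E w = {w'. teq E w w'}"
  unfolding heapcl_def teq_def by (simp add: rtranclp_rtrancl_eq)

lemma teq_refl [simp]: "teq E w w"
  by (simp add: teq_def)

lemma teq_trans [trans]: "teq E u v \<Longrightarrow> teq E v w \<Longrightarrow> teq E u w"
  unfolding teq_def by (rule rtranclp_trans)

lemma teq_swap: "u \<noteq> v \<Longrightarrow> \<not> E u v \<Longrightarrow> teq E (xs @ u # v # ys) (xs @ v # u # ys)"
  unfolding teq_def by (rule r_into_rtranclp) (force simp: swap1_def)

lemma teq_induct [consumes 1, case_names refl step]: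
  assumes "teq E w w'" "P w"
    "\<And>xs u v ys. teq E w (xs @ u # v # ys) \<Longrightarrow> P (xs @ u # v # ys) \<Longrightarrow> u \<noteq> v \<Longrightarrow> \<not> E u v \<Longrightarrow> P (xs @ v # u # ys)"
  shows "P w'"
  using assms(1)[unfolded teq_def]
proof (induction rule: rtranclp_induct)
  case (step y z)
  then show ?case using assms(3) unfolding teq_def swap1_def by auto
qed (rule assms(2))

lemma teq_mset: "teq E w w' \<Longrightarrow> mset w' = mset w"
  by (induction rule: teq_induct) (simp_all add: add_mset_commute)

lemma teq_length: "teq E w w' \<Longrightarrow> length w' = length w"
  by (metis teq_mset size_mset)

lemma teq_set: "teq E w w' \<Longrightarrow> set w' = set w"
  by (metis teq_mset set_mset_mset)

lemma teq_append:
  assumes "teq E u u'" shows "teq E (x @ u @ y) (x @ u' @ y)"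
  using assms
proof (induction rule: teq_induct)
  case (step xs u v ys)
  then show ?case using teq_trans teq_swap[of u v E "x @ xs" "ys @ y"] by fastforce
qed simp

lemma teq_append2: "teq E u u' \<Longrightarrow> teq E v v' \<Longrightarrow> teq E (u @ v) (u' @ v')"
  using teq_append[of E u u' "[]" v] teq_append[of E v v' u' "[]"] teq_trans by fastforce

lemma teq_Cons: "teq E u u' \<Longrightarrow> teq E (a # u) (a # u')"
  using teq_append2[of E "[a]" "[a]"] by simp

lemma teq_power: "teq E u u' \<Longrightarrow> teq E (concat (replicate m u)) (concat (replicate m u'))"
  by (induction m) (auto intro: teq_append2)

lemma finite_teq: "finite {v. teq E w v}"
proof -
  have "{v. teq E w v} \<subseteq> {v. set v \<subseteq> set w \<and> length v = length w}"
    using teq_set teq_length by blast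
  then show ?thesis by (rule finite_subset) (simp add: finite_lists_length_eq)
qed

text \<open>Commutations of a word only consult edges between its own letters. This later identifies
  normal forms of the induced graph on \<open>W\<close> with normal forms of \<open>E\<close> over
  the alphabet \<open>W\<close>.\<close>

lemma teq_cong_edge:
  assumes "teq E w w'" and "\<And>u v. u \<in> set w \<Longrightarrow> v \<in> set w \<Longrightarrow> E u v = E' u v"
  shows "teq E' w w'"
  using assms(1)
proof (induction rule: teq_induct)
  case (step xs u v ys)
  have "u \<in> set w" "v \<in> set w" using teq_set[OF step.hyps(1)] by auto
  then have "\<not> E' u v" using assms(2) step.hyps(3) by simp
  then have "teq E' (xs @ u # v # ys) (xs @ v # u # ys)" using step.hyps(2) by (intro teq_swap)
  then show ?case using step.IH teq_trans by blast
qed simp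

lemma front_iff: "front E b w \<longleftrightarrow> (\<exists>xs ys. w = xs @ b # ys \<and> (\<forall>x\<in>set xs. x \<noteq> b \<and> \<not> E x b))"
proof (induction w)
  case (Cons x w)
  show ?case
  proof (rule iffI)
    assume "front E b (x # w)"
    then consider "x = b" | "x \<noteq> b" "\<not> E x b" "front E b w" by auto
    then show "\<exists>xs ys. x # w = xs @ b # ys \<and> (\<forall>x\<in>set xs. x \<noteq> b \<and> \<not> E x b)"
    proof cases
      case 1
      then have "x # w = [] @ b # w \<and> (\<forall>x\<in>set []. x \<noteq> b \<and> \<not> E x b)" by simp
      then show ?thesis by blast
    next
      case 2
      then obtain xs ys where "w = xs @ b # ys" "\<forall>x\<in>set xs. x \<noteq> b \<and> \<not> E x b" using Cons by blast
      then have "x # w = (x # xs) @ b # ys" "\<forall>y\<in>set (x # xs). y \<noteq> b \<and> \<not> E y b"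
        using 2(1,2) by simp_all
      then show ?thesis by blast
    qed
  next
    assume "\<exists>xs ys. x # w = xs @ b # ys \<and> (\<forall>x\<in>set xs. x \<noteq> b \<and> \<not> E x b)"
    then obtain xs ys where e: "x # w = xs @ b # ys" "\<forall>x\<in>set xs. x \<noteq> b \<and> \<not> E x b" by blast
    then show "front E b (x # w)" using Cons by (cases xs) auto
  qed
qed simp

lemma front_in_set: "front E b w \<Longrightarrow> b \<in> set w"
  by (auto simp: front_iff)

text \<open>No vertex set is fixed: alphabets occur as sets \<open>W\<close> in the lemmas, so one
  interpretation serves all subsets in the inclusion-exclusion.\<close>

locale loopless_graph =
  fixes E :: "'a \<Rightarrow> 'a \<Rightarrow> bool"
  assumes E_sym: "E u v \<Longrightarrow> E v u" and E_irrefl: "\<not> E v v"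
begin

lemma teq_sym:
  assumes "teq E u v" shows "teq E v u"
  using assms
proof (induction rule: teq_induct)
  case (step xs u v ys)
  then show ?case using teq_swap[of v u E xs ys] E_sym teq_trans by blast
qed simp

lemma heapcl_eq_iff: "heapcl E u = heapcl E v \<longleftrightarrow> teq E u v"
  unfolding heapcl_teq using teq_sym teq_trans teq_refl by blast

lemma front_swap: "u \<noteq> v \<Longrightarrow> \<not> E u v \<Longrightarrow> front E a (xs @ u # v # ys) \<longleftrightarrow> front E a (xs @ v # u # ys)"
  by (induction xs) (auto dest: E_sym)

lemma front_teq: "teq E w w' \<Longrightarrow> front E a w \<longleftrightarrow> front E a w'"
proof (induction rule: teq_induct)
  case (step xs u v ys)
  then show ?case using front_swap by blast
qed simp

text \<open>Equal letters are never exchanged, so the first occurrence of \<open>a\<close> is the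
  same piece in every word of the heap. Left cancellation follows.\<close>

lemma remove1_teq:
  assumes "teq E w w'" shows "teq E (remove1 a w) (remove1 a w')"
  using assms
proof (induction rule: teq_induct)
  case (step xs u v ys)
  have "teq E (remove1 a (xs @ u # v # ys)) (remove1 a (xs @ v # u # ys))"
    using step.hyps by (auto simp: remove1_append intro: teq_swap)
  then show ?case using step.IH teq_trans by blast
qed simp

lemma teq_Cons_cancel: "teq E (a # u) (a # v) \<Longrightarrow> teq E u v"
  using remove1_teq[of "a # u" "a # v" a] by simp

lemma teq_append_cancel: "teq E (x @ u) (x @ v) \<Longrightarrow> teq E u v"
  by (induction x) (auto dest: teq_Cons_cancel)

lemma front_pull: "front E a w \<Longrightarrow> teq E w (a # remove1 a w)"
proof (induction w)
  case (Cons x w)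
  show ?case
  proof (cases "x = a")
    case False
    then have "teq E (x # w) (x # a # remove1 a w)" using Cons by (auto intro: teq_Cons)
    also have "teq E \<dots> (a # x # remove1 a w)" using teq_swap[of x a E "[]"] Cons.prems False by auto
    finally show ?thesis using False by simp
  qed simp
qed simp

lemma teq_ConsD: "teq E (a # w) v \<Longrightarrow> front E a v"
  using front_teq[of "a # w" v a] by simp

lemma front_stable: "front E a w \<Longrightarrow> front E b w \<Longrightarrow> a \<noteq> b \<Longrightarrow> \<not> E a b"
  by (induction w) (auto dest: E_sym)

lemma front_remove1: "front E a w \<Longrightarrow> a \<noteq> b \<Longrightarrow> front E a (remove1 b w)"
  by (induction w) auto

lemma front_pull_list:
  "distinct s \<Longrightarrow> (\<forall>a\<in>set s. front E a w) \<Longrightarrow> \<exists>v. teq E w (s @ v)"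
proof (induction s arbitrary: w)
  case (Cons a s)
  have "\<forall>b\<in>set s. front E b (remove1 a w)" using Cons.prems by (auto intro!: front_remove1)
  then obtain v where "teq E (remove1 a w) (s @ v)" using Cons.IH Cons.prems(1) by fastforce
  then have "teq E (a # remove1 a w) (a # s @ v)" by (rule teq_Cons)
  moreover have "teq E w (a # remove1 a w)" using Cons.prems by (intro front_pull) simp
  ultimately have "teq E w ((a # s) @ v)" using teq_trans by fastforce
  then show ?case by blast
next
  case Nil
  have "teq E w ([] @ w)" by simp
  then show ?case by blast
qed

lemma front_append_stable:
  "(\<forall>x\<in>set s. \<forall>y\<in>set s. \<not> E x y) \<Longrightarrow> a \<in> set s \<Longrightarrow> front E a (s @ v)"
  by (induction s) auto

end

locale ordered_loopless_graph = loopless_graph E for E :: "'a::linorder \<Rightarrow> 'a \<Rightarrow> bool"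
begin

lemma nf_exists: "\<exists>v. teq E w v \<and> nf E v"
proof -
  let ?v = "Max {v. teq E w v}"
  have "?v \<in> {v. teq E w v}" using finite_teq[of E w] by (intro Max_in) (auto intro: exI[of _ w])
  moreover have "v \<le> ?v" if "teq E ?v v" for v
    using that calculation finite_teq[of E w] teq_trans by (intro Max_ge) auto
  ultimately show ?thesis unfolding nf_def by blast
qed

lemma nf_unique: "nf E u \<Longrightarrow> nf E v \<Longrightarrow> teq E u v \<Longrightarrow> u = v"
  unfolding nf_def using teq_sym by (metis order_antisym)

lemma stdword_heapcl: assumes "nf E w" shows "stdword (heapcl E w) = w"
  unfolding stdword_def
proof (rule the_equality)
  show "w \<in> heapcl E w \<and> (\<forall>v\<in>heapcl E w. v = w \<or> lexless v w)"
    using assms by (auto simp: heapcl_teq nf_def lexless_def list_le_def list_less_def)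
next
  fix u assume "u \<in> heapcl E w \<and> (\<forall>v\<in>heapcl E w. v = u \<or> lexless v u)"
  then have "teq E w u" "w = u \<or> w < u" by (auto simp: heapcl_teq lexless_def list_less_def)
  then show "u = w" using assms unfolding nf_def by fastforce
qed

end

section \<open>Lexicographic comparison of concatenations\<close>

lemma append_less_append [simp]: "x @ u < x @ v \<longleftrightarrow> u < (v::'a::linorder list)"
  by (induction x) auto

lemma append_le_append [simp]: "x @ u \<le> x @ v \<longleftrightarrow> u \<le> (v::'a::linorder list)"
  by (induction x) auto

lemma prefix_le: "x \<le> x @ (v::'a::linorder list)"
  by (induction x) auto

text \<open>Either \<open>u\<close> runs out first, or the words differ at a position inside both,
  and then no continuation can change the outcome.\<close>

lemma list_less_append_cases:
  "u < (v::'a::linorder list) \<Longrightarrow> (\<exists>z. v = u @ z) \<or> (\<forall>x y. u @ x < v @ y)"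
proof (induction u arbitrary: v)
  case (Cons a u)
  then show ?case by (cases v) auto
qed auto

lemma less_append_same_length:
  "length u = length v \<Longrightarrow> u < v \<Longrightarrow> u @ x < v @ (y::'a::linorder list)"
  using list_less_append_cases[of u v] by auto

lemma list_le_append_same_length:
  "length u = length v \<Longrightarrow> u @ x \<le> v @ y \<Longrightarrow> u \<le> (v::'a::linorder list)"
  using less_append_same_length[of v u y x] by (metis leI leD)

lemma list_less_first_difference:
  assumes "w < (v::'a::linorder list)" "length w = length v"
  shows "\<exists>x d w' c v'. w = x @ d # w' \<and> v = x @ c # v' \<and> d < c"
  using assms
proof (induction w arbitrary: v)
  case (Cons a w)
  then obtain b v0 where v: "v = b # v0" by (cases v) auto
  show ?case
  proof (cases "a = b")
    case True
    then have "w < v0" "length w = length v0" using Cons v by auto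
    then obtain x d w' c v' where "w = x @ d # w'" "v0 = x @ c # v'" "d < c" using Cons.IH by blast
    then show ?thesis using v True by (metis append_Cons)
  next
    case False
    then have "a < b" using Cons v by auto
    then show ?thesis using v by (metis append_Nil)
  qed
qed simp

section \<open>Normal forms as words avoiding a pattern\<close>

context ordered_loopless_graph
begin

text \<open>Rearranging a factor rearranges the whole word, and because lengths are preserved a gain
  inside the factor is a gain for the whole word.\<close>

lemma nf_factor: "nf E (x @ y @ z) \<Longrightarrow> nf E y"
  unfolding nf_def
proof (intro allI impI)
  fix v assume h: "\<forall>v. teq E (x @ y @ z) v \<longrightarrow> v \<le> x @ y @ z" and t: "teq E y v"
  then have "x @ v @ z \<le> x @ y @ z" using teq_append by blast
  then show "v \<le> y" using teq_length[OF t] list_le_append_same_length[of v y z z] by simp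
qed

text \<open>Otherwise \<open>a\<close> commutes with all of \<open>b # u\<close>, can be pulled to
  the front of this factor, and makes it larger.\<close>

lemma nfD:
  assumes "nf E (x @ b # u @ a # y)" "b < a"
  shows "\<exists>c\<in>set (b # u). c = a \<or> E c a"
proof (rule ccontr)
  assume n: "\<not> ?thesis"
  then have "front E a ((b # u) @ [a])" unfolding front_iff by blast
  then have "teq E ((b # u) @ [a]) (a # remove1 a ((b # u) @ [a]))" by (rule front_pull)
  moreover have "nf E ((b # u) @ [a])" using nf_factor[of x "(b # u) @ [a]" y] assms by simp
  ultimately have "a # remove1 a ((b # u) @ [a]) \<le> (b # u) @ [a]" unfolding nf_def by blast
  then show False using assms(2) by (auto split: if_splits)
qed

text \<open>Converse of \<open>nfD\<close>. A larger word of the class first differs from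
  \<open>w\<close> by having some \<open>c\<close> where \<open>w\<close> has \<open>d < c\<close>.
  Cancelling the common prefix shows that \<open>c\<close> is the label of a minimal piece of the
  rest, so the stretch of \<open>w\<close> from \<open>d\<close> to the first such \<open>c\<close>
  is the excluded pattern.\<close>

lemma nfI:
  assumes "\<And>x b u a y. w = x @ b # u @ a # y \<Longrightarrow> b < a \<Longrightarrow> \<exists>c\<in>set (b # u). c = a \<or> E c a"
  shows "nf E w"
  unfolding nf_def
proof (intro allI impI)
  fix v assume t: "teq E w v"
  show "v \<le> w"
  proof (rule ccontr)
    assume "\<not> v \<le> w"
    then obtain x d w' c v' where e: "w = x @ d # w'" "v = x @ c # v'" "d < c"
      using list_less_first_difference[of w v] teq_length[OF t] not_le by metis
    then have "teq E (d # w') (c # v')" using t teq_append_cancel by blast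
    then have "front E c (d # w')" using teq_ConsD teq_sym by blast
    then obtain xs ys where b: "d # w' = xs @ c # ys" "\<forall>x\<in>set xs. x \<noteq> c \<and> \<not> E x c"
      unfolding front_iff by blast
    then obtain u where "xs = d # u" using e(3) by (cases xs) auto
    then show False using assms[of x d u c ys] e b by auto
  qed
qed

text \<open>A pattern that starts at \<open>b\<close> in \<open>x\<close> and ends at
  \<open>c\<close> in \<open>a # y\<close> contains the stretch from \<open>a\<close> to
  \<open>c\<close>. Since \<open>a\<close> is least, \<open>a <= b < c\<close>, so
  \<open>a # y\<close> already provides a letter in this stretch that blocks
  \<open>c\<close>.\<close>

lemma nf_append:
  assumes "nf E x" "nf E (a # y)" "\<And>b. b \<in> set x \<union> set y \<Longrightarrow> a \<le> b"
  shows "nf E (x @ a # y)"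
proof (rule nfI)
  fix p b u c q assume e: "x @ a # y = p @ b # u @ c # q" and bc: "b < c"
  have "b \<in> set (x @ a # y)" unfolding e by simp
  then have ab: "a \<le> b" using assms(3) by auto
  from e have "x @ a # y = (p @ b # u) @ c # q" by simp
  then obtain us where us: "x = (p @ b # u) @ us \<and> us @ a # y = c # q \<or> x @ us = p @ b # u \<and> a # y = us @ c # q"
    by (subst (asm) append_eq_append_conv2) blast
  then consider us where "x = (p @ b # u) @ c # us" 
    | us where "p @ b # u = x @ us" "us @ c # q = a # y"
  proof (cases us)
    case Nil
    with us have "p @ b # u = x @ []" "[] @ c # q = a # y" by auto
    then show ?thesis using that(2) by blast
  next
    case (Cons d us')
    with us that show ?thesis by auto
  qed
  then show "\<exists>d\<in>set (b # u). d = c \<or> E d c"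
  proof cases
    case 1
    then show ?thesis using nfD[of p b u c us] assms(1) bc by simp
  next
    case 2
    \<comment> \<open>\<open>us\<close> is the part of \<open>a # y\<close> before \<open>c\<close>;
      it is nonempty because \<open>a <= b < c\<close> excludes \<open>c = a\<close>.\<close>
    then have us: "us \<noteq> []" using ab bc by (cases us) auto
    then obtain us' where us': "us = a # us'" using 2 by (cases us) auto
    have ac: "a < c" using ab bc by simp
    have dc: "\<exists>d\<in>set us. d = c \<or> E d c"
    proof -
      have "[] @ a # us' @ c # q = a # y" using 2(2) us' by simp
      then have "nf E ([] @ a # us' @ c # q)" using assms(2) by (simp only:)
      from nfD[OF this ac] show ?thesis unfolding us' .
    qed
    from 2(1) obtain z where "p = x @ z \<and> z @ b # u = us \<or> p @ z = x \<and> b # u = z @ us"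
      by (subst (asm) append_eq_append_conv2) blast
    then have "p = x @ z \<and> us = z @ b # u \<or> set us \<subseteq> set (b # u)"
      by (metis Un_upper2 set_append)
    then consider "p = x @ z" "us = z @ b # u" | "set us \<subseteq> set (b # u)"
      by blast
    then show ?thesis
    proof cases
      case 1
      from 1 2(2) have "z @ b # u @ c # q = a # y" by simp
      then have "nf E (z @ b # u @ c # q)" using assms(2) by (simp only:)
      from nfD[OF this bc] show ?thesis .
    next
      case 2 then show ?thesis using dc by blast
    qed
  qed
qed

end

subsection \<open>Cartier-Foata inversion\<close>

lemma sum_Pow_alternating:
  assumes "finite A"
  shows "(\<Sum>S\<in>Pow A. (-1) ^ card S) = (if A = {} then 1 else 0 :: 'b::comm_ring_1)"
proof -
  have "(\<Sum>S\<in>Pow A. (-1) ^ card S) = (\<Prod>x\<in>A. -1 + 1 :: 'b)"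
    by (subst prod_add[OF assms]) simp
  also have "\<dots> = (if A = {} then 1 else 0)"
    using assms by (simp add: card_eq_0_iff power_0_left)
  finally show ?thesis .
qed

definition stable_set :: "('a \<Rightarrow> 'a \<Rightarrow> bool) \<Rightarrow> 'a set \<Rightarrow> bool" where
  "stable_set E S \<longleftrightarrow> (\<forall>x\<in>S. \<forall>y\<in>S. \<not> E x y)"

definition stable_sets :: "('a \<Rightarrow> 'a \<Rightarrow> bool) \<Rightarrow> 'a set \<Rightarrow> nat \<Rightarrow> 'a set set" where
  "stable_sets E W j = {S. S \<subseteq> W \<and> stable_set E S \<and> card S = j}"

definition nfwords :: "('a::linorder \<Rightarrow> 'a \<Rightarrow> bool) \<Rightarrow> 'a set \<Rightarrow> nat \<Rightarrow> 'a list set" where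
  "nfwords E W n = {w. set w \<subseteq> W \<and> nf E w \<and> length w = n}"

lemma finite_nfwords: "finite W \<Longrightarrow> finite (nfwords E W n)"
  unfolding nfwords_def
  by (rule finite_subset[OF _ finite_lists_length_eq[of W n]]) auto

context ordered_loopless_graph
begin

definition nform :: "'a list \<Rightarrow> 'a list" where
  "nform w = (SOME v. teq E w v \<and> nf E v)"

lemma nform: "teq E w (nform w)" "nf E (nform w)"
  unfolding nform_def using someI_ex[OF nf_exists[of w]] by auto

lemma nform_set [simp]: "set (nform w) = set w"
  and nform_length [simp]: "length (nform w) = length w"
  using nform(1) teq_set teq_length by blast+

lemma nform_eq_iff: "nform u = nform v \<longleftrightarrow> teq E u v"
  using nform teq_sym teq_trans nf_unique by metis

lemma nform_nf: "nf E w \<Longrightarrow> nform w = w"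
  using nform nf_unique teq_sym by metis

text \<open>Heaps having all of \<open>S\<close> among their minimal pieces arise by placing
  \<open>S\<close> below an arbitrary heap; left cancellation recovers that heap.\<close>

lemma card_nfwords_front:
  assumes "S \<subseteq> W" "stable_set E S" "finite S" "card S \<le> n"
  shows "card {w \<in> nfwords E W n. \<forall>a\<in>S. front E a w} = card (nfwords E W (n - card S))"
proof -
  define s where "s = sorted_list_of_set S"
  have s: "set s = S" "distinct s" "length s = card S" using assms(3) by (simp_all add: s_def)
  have "bij_betw (\<lambda>w. nform (s @ w)) (nfwords E W (n - card S)) {w \<in> nfwords E W n. \<forall>a\<in>S. front E a w}"
  proof (rule bij_betwI')
    fix x y assume xy: "x \<in> nfwords E W (n - card S)" "y \<in> nfwords E W (n - card S)"
    then have "nf E x" "nf E y" by (simp_all add: nfwords_def)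
    then have "teq E (s @ x) (s @ y) \<longleftrightarrow> x = y"
      using teq_append_cancel[of s x y] nf_unique[of x y] teq_refl[of E "s @ x"] by metis
    then show "nform (s @ x) = nform (s @ y) \<longleftrightarrow> x = y" unfolding nform_eq_iff .
  next
    fix x assume x: "x \<in> nfwords E W (n - card S)"
    have "front E a (nform (s @ x))" if "a \<in> S" for a
    proof -
      have "front E a (s @ x)" using that assms(2) s(1) by (intro front_append_stable) (auto simp: stable_set_def)
      then show ?thesis using front_teq[OF nform(1)] by blast
    qed
    moreover have "set (s @ x) \<subseteq> W" "length (s @ x) = n"
      using x assms(1,4) s by (auto simp: nfwords_def)
    ultimately show "nform (s @ x) \<in> {w \<in> nfwords E W n. \<forall>a\<in>S. front E a w}"
      using nform(2) by (simp add: nfwords_def)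
  next
    fix y assume "y \<in> {w \<in> nfwords E W n. \<forall>a\<in>S. front E a w}"
    then have y: "y \<in> nfwords E W n" "\<forall>a\<in>set s. front E a y" using s by auto
    then obtain v where v: "teq E y (s @ v)" using front_pull_list[OF s(2)] by blast
    have "set v \<subseteq> W" using teq_set[OF v] y(1) by (auto simp: nfwords_def)
    moreover have "length v = n - card S" using teq_length[OF v] y(1) s(3) by (auto simp: nfwords_def)
    ultimately have "nform v \<in> nfwords E W (n - card S)"
      using nform(2) by (simp add: nfwords_def)
    moreover have "y = nform (s @ nform v)"
    proof -
      have "teq E (s @ v) (s @ nform v)" using teq_append2[of E s s v "nform v"] nform by simp
      then have "nform y = nform (s @ nform v)" using v teq_trans by (subst nform_eq_iff) blast
      moreover have "nform y = y" using y(1) by (intro nform_nf) (simp add: nfwords_def)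
      ultimately show ?thesis by simp
    qed
    ultimately show "\<exists>x\<in>nfwords E W (n - card S). y = nform (s @ x)" by blast
  qed
  then show ?thesis by (simp add: bij_betw_same_card)
qed

text \<open>By \<open>card_nfwords_front\<close> the sum is a signed count of pairs of a heap of
  size \<open>n\<close> and a subset \<open>S\<close> of its minimal labels. The minimal labels form
  a stable set, so all of its subsets occur and their signs cancel unless the heap is empty.\<close>

theorem cartier_foata:
  assumes "finite W"
  shows "(\<Sum>j\<le>n. (-1) ^ j * of_nat (card (stable_sets E W j)) * of_nat (card (nfwords E W (n - j))))
    = (if n = 0 then 1 else 0 :: 'b::comm_ring_1)"
proof -
  let ?St = "{S. S \<subseteq> W \<and> stable_set E S}"
  let ?Stn = "{S. S \<subseteq> W \<and> stable_set E S \<and> card S \<le> n}"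
  let ?c = "\<lambda>S. of_nat (card {w \<in> nfwords E W n. \<forall>a\<in>S. front E a w}) :: 'b"
  have finW: "finite S" if "S \<subseteq> W" for S using that assms finite_subset by blast
  have fin: "finite ?St" "finite ?Stn" using assms by simp_all
  have "(\<Sum>j\<le>n. (-1) ^ j * of_nat (card (stable_sets E W j)) * of_nat (card (nfwords E W (n - j))))
      = (\<Sum>j\<le>n. \<Sum>S\<in>{S \<in> ?Stn. card S = j}. (-1) ^ card S * ?c S)"
  proof (rule sum.cong)
    fix j assume j: "j \<in> {..n}"
    have "(\<Sum>S\<in>{S \<in> ?Stn. card S = j}. (-1) ^ card S * ?c S)
        = (\<Sum>S\<in>stable_sets E W j. (-1) ^ j * of_nat (card (nfwords E W (n - j))))"
    proof (rule sum.cong)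
      show "{S \<in> ?Stn. card S = j} = stable_sets E W j" using j by (auto simp: stable_sets_def)
      fix S assume S: "S \<in> stable_sets E W j"
      then have "card {w \<in> nfwords E W n. \<forall>a\<in>S. front E a w} = card (nfwords E W (n - card S))"
        using j finW by (intro card_nfwords_front) (auto simp: stable_sets_def)
      then show "(-1) ^ card S * ?c S = (-1) ^ j * of_nat (card (nfwords E W (n - j)))"
        using S by (simp add: stable_sets_def)
    qed
    then show "(-1) ^ j * of_nat (card (stable_sets E W j)) * of_nat (card (nfwords E W (n - j)))
      = (\<Sum>S\<in>{S \<in> ?Stn. card S = j}. (-1) ^ card S * ?c S)" by simp
  qed simp
  also have "\<dots> = (\<Sum>S\<in>?Stn. (-1) ^ card S * ?c S)"
    using fin by (intro sum.group) auto
  also have "\<dots> = (\<Sum>S\<in>?St. (-1) ^ card S * ?c S)"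
  proof (rule sum.mono_neutral_left)
    show "\<forall>S\<in>?St - ?Stn. (-1) ^ card S * ?c S = 0"
    proof
      fix S assume S: "S \<in> ?St - ?Stn"
      have "\<not> (\<forall>a\<in>S. front E a w)" if "length w = n" for w
      proof
        assume "\<forall>a\<in>S. front E a w"
        then have "S \<subseteq> set w" using front_in_set by fastforce
        then have "card S \<le> length w" using card_mono card_length le_trans by (metis List.finite_set)
        then show False using S that by auto
      qed
      then have "{w \<in> nfwords E W n. \<forall>a\<in>S. front E a w} = {}" by (auto simp: nfwords_def)
      then show "(-1) ^ card S * ?c S = 0" by (simp only: card.empty) simp
    qed
  qed (use fin in auto)
  also have "\<dots> = (\<Sum>S\<in>?St. \<Sum>w\<in>nfwords E W n. if \<forall>a\<in>S. front E a w then (-1) ^ card S else 0)"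
    using finite_nfwords[OF assms] by (intro sum.cong) (simp_all flip: sum.inter_filter)
  also have "\<dots> = (\<Sum>w\<in>nfwords E W n. \<Sum>S\<in>?St. if \<forall>a\<in>S. front E a w then (-1) ^ card S else 0)"
    by (rule sum.swap)
  also have "\<dots> = (\<Sum>w\<in>nfwords E W n. if w = [] then 1 else 0)"
  proof (rule sum.cong)
    fix w assume w: "w \<in> nfwords E W n"
    let ?B = "{a. front E a w}"
    have B: "?B \<subseteq> W" using w front_in_set[of E _ w] by (auto simp: nfwords_def)
    have "stable_set E ?B" unfolding stable_set_def using front_stable[of _ w] E_irrefl by blast
    then have "{S \<in> ?St. \<forall>a\<in>S. front E a w} = Pow ?B"
      using B unfolding stable_set_def by blast
    then have "(\<Sum>S\<in>?St. if \<forall>a\<in>S. front E a w then (-1) ^ card S else 0) = (\<Sum>S\<in>Pow ?B. (-1) ^ card S :: 'b)"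
      using fin by (simp flip: sum.inter_filter)
    also have "\<dots> = (if ?B = {} then 1 else 0)" using finW[OF B] by (rule sum_Pow_alternating)
    also have "?B = {} \<longleftrightarrow> w = []" by (cases w) auto
    finally show "(\<Sum>S\<in>?St. if \<forall>a\<in>S. front E a w then (-1) ^ card S else 0) = (if w = [] then 1 else 0 :: 'b)" .
  qed simp
  also have "\<dots> = (if n = 0 then 1 else 0)"
  proof -
    have "nf E []" unfolding nf_def using teq_length[of E "[]"] by simp
    then have "nfwords E W 0 = {[]}" by (auto simp: nfwords_def)
    then show ?thesis by (auto simp: nfwords_def intro!: sum.neutral)
  qed
  finally show ?thesis .
qed

end

section \<open>Lyndon words and their unique factorization\<close>

definition lyn :: "'a::linorder list \<Rightarrow> bool" where
  "lyn w \<longleftrightarrow> w \<noteq> [] \<and> (\<forall>u v. w = u @ v \<longrightarrow> u \<noteq> [] \<longrightarrow> v \<noteq> [] \<longrightarrow> w < v)"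

lemma lyn_suffix_le: "lyn (u @ v) \<Longrightarrow> v \<noteq> [] \<Longrightarrow> u @ v \<le> v"
  unfolding lyn_def by (cases "u = []") (auto intro: less_imp_le)

lemma lyn_hd_le: "lyn (a # w) \<Longrightarrow> b \<in> set w \<Longrightarrow> a \<le> b"
proof -
  assume l: "lyn (a # w)" and "b \<in> set w"
  then obtain xs ys where "w = xs @ b # ys" by (meson split_list)
  then have "(a # xs) @ b # ys \<le> b # ys" using lyn_suffix_le[of "a # xs" "b # ys"] l by simp
  then show "a \<le> b" by auto
qed

text \<open>Links the suffix definition of \<open>lyn\<close> to the description by rotations.
  Primitivity makes proper rotations strictly larger. A proper suffix \<open>v\<close> below
  \<open>w\<close> must then be a prefix, \<open>w = v @ z\<close> with \<open>z\<close> as long as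
  \<open>u\<close>. Comparing \<open>w\<close> with \<open>v @ u\<close> gives \<open>z < u\<close>,
  comparing it with \<open>z @ v\<close> gives \<open>u <= z\<close>.\<close>

lemma lyn_if_least_rotation:
  assumes "w \<noteq> []" "\<And>m k. 1 < m \<Longrightarrow> w \<noteq> concat (replicate m k)"
    and rot: "\<And>u v. w = u @ v \<Longrightarrow> u \<noteq> [] \<Longrightarrow> v \<noteq> [] \<Longrightarrow> w \<le> v @ u"
  shows "lyn w"
  unfolding lyn_def
proof (intro conjI allI impI)
  fix u v assume w: "w = u @ v" and u: "u \<noteq> []" and v: "v \<noteq> []"
  have "u @ v \<noteq> v @ u"
  proof
    assume "u @ v = v @ u"
    then obtain m n zs where z: "concat (replicate m zs) = u" "concat (replicate n zs) = v"
      using comm_append_are_replicate by blast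
    then have "w = concat (replicate (m + n) zs)" using w by (simp add: replicate_add)
    moreover have "m \<noteq> 0" "n \<noteq> 0" using z u v by auto
    ultimately show False using assms(2)[of "m + n" zs] by simp
  qed
  then have less: "u @ v < v @ u" using rot[OF w u v] w by simp
  show "w < v"
  proof (rule ccontr)
    assume "\<not> w < v"
    then have "v < u @ v" using u w by (auto simp: not_less order_le_less)
    then consider z where "u @ v = v @ z" | "v @ u < (u @ v) @ []"
      using list_less_append_cases by blast
    then show False
    proof cases
      case 1
      then have len: "length u = length z" by (metis add.commute add_left_cancel length_append)
      have "z < u" using less 1 by simp
      have "z \<noteq> []" using len u by auto
      then have "u @ v \<le> z @ v" using rot[of v z] w 1 v by simp
      then have "u \<le> z" using list_le_append_same_length len by blast
      then show False using \<open>z < u\<close> by simp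
    next
      case 2 then show False using less by simp
    qed
  qed
qed (rule assms(1))

lemma lyn_rotation_le: "lyn (u @ v) \<Longrightarrow> u @ v \<le> v @ u"
  using lyn_suffix_le[of u v] prefix_le[of v u] by (cases "v = []") auto

text \<open>A suffix begins inside some factor \<open>l\<close>, and what remains of
  \<open>l\<close> is at least \<open>l\<close>, hence at least the last factor. So the last factor
  is the least nonempty suffix and is determined by the word alone.\<close>

lemma last_le_suffix:
  assumes "sorted_wrt (\<ge>) ls" "\<And>l. l \<in> set ls \<Longrightarrow> lyn l" "concat ls = u @ v" "v \<noteq> []"
  shows "last ls \<le> v"
  using assms
proof (induction ls arbitrary: u)
  case (Cons l ls)
  then obtain z where "l = u @ z \<and> z @ concat ls = v \<or> l @ z = u \<and> concat ls = z @ v"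
    by (auto simp: append_eq_append_conv2)
  then show ?case
  proof
    assume z: "l = u @ z \<and> z @ concat ls = v"
    show ?case
    proof (cases "z = []")
      case True
      then have e: "concat ls = [] @ v" using z by simp
      then have "ls \<noteq> []" using Cons.prems by auto
      moreover have "last ls \<le> v" using Cons.IH[OF _ _ e] Cons.prems by simp
      ultimately show ?thesis by simp
    next
      case False
      have "last (l # ls) \<le> l"
        using Cons.prems(1) by (cases ls) auto
      also have "l \<le> z" using z False Cons.prems(2)[of l] lyn_suffix_le by auto
      also have "z \<le> v" using z prefix_le[of z "concat ls"] by simp
      finally show ?thesis .
    qed
  next
    assume z: "l @ z = u \<and> concat ls = z @ v"
    then have "ls \<noteq> []" using Cons.prems by auto
    moreover have "last ls \<le> v" using Cons.IH[of z] z Cons.prems by simp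
    ultimately show ?thesis by simp
  qed
qed simp

lemma lyndon_factorization_unique:
  assumes "sorted_wrt (\<ge>) ls" "\<And>l. l \<in> set ls \<Longrightarrow> lyn l"
    "sorted_wrt (\<ge>) ms" "\<And>l. l \<in> set ms \<Longrightarrow> lyn l" "concat ls = concat ms"
  shows "ls = ms"
  using assms
proof (induction ls arbitrary: ms rule: rev_induct)
  case Nil
  then show ?case by (cases ms) (auto simp: lyn_def)
next
  case (snoc l ls)
  have "l \<noteq> []" using snoc.prems(2)[of l] by (simp add: lyn_def)
  then have "ms \<noteq> []" using snoc.prems(5) by auto
  then obtain ms' m where ms: "ms = ms' @ [m]" by (metis append_butlast_last_id)
  have "m \<noteq> []" using snoc.prems(4)[of m] ms by (simp add: lyn_def)
  have "last (ls @ [l]) \<le> m"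
    using last_le_suffix[OF snoc.prems(1,2), of "concat ms'" m] snoc.prems(5) ms \<open>m \<noteq> []\<close> by simp
  moreover have "last (ms' @ [m]) \<le> l"
    using last_le_suffix[OF snoc.prems(3,4), of "concat ls" l] snoc.prems(5) ms \<open>l \<noteq> []\<close> by simp
  ultimately have lm: "l = m" by simp
  have "ls = ms'"
    using snoc.prems lm ms by (intro snoc.IH) (auto simp: sorted_wrt_append)
  then show ?case using lm ms by simp
qed

text \<open>Split off the least nonempty suffix \<open>s\<close>, which is a Lyndon word, and factor
  the rest by induction. At the seam, suppose the last factor \<open>t\<close> of the rest were
  below \<open>s\<close>. Minimality gives \<open>s <= t @ s\<close>, which forces
  \<open>s = t @ z\<close>; then \<open>z <= s\<close>, while \<open>s <= z\<close> as
  \<open>z\<close> is a suffix, contradicting \<open>t\<close> nonempty.\<close>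

lemma lyndon_factorization_exists:
  "\<exists>ls. sorted_wrt (\<ge>) ls \<and> (\<forall>l\<in>set ls. lyn l) \<and> concat ls = w"
proof (induction "length w" arbitrary: w rule: less_induct)
  case less
  show ?case
  proof (cases "w = []")
    case True then show ?thesis by (intro exI[of _ "[]"]) auto
  next
    case False
    define Suf where "Suf = {v. v \<noteq> [] \<and> (\<exists>u. w = u @ v)}"
    have "Suf \<subseteq> set (suffixes w)" by (auto simp: Suf_def suffix_def)
    then have fin: "finite Suf" using finite_subset by blast
    have "w \<in> Suf" using False by (auto simp: Suf_def)
    define s where "s = Min Suf"
    have "s \<in> Suf" unfolding s_def using fin \<open>w \<in> Suf\<close> by (intro Min_in) auto
    then obtain p where p: "w = p @ s" and s: "s \<noteq> []" by (auto simp: Suf_def)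
    have smin: "s \<le> v" if "v \<noteq> []" "w = u @ v" for u v
      unfolding s_def using fin that by (intro Min_le) (auto simp: Suf_def)
    have "lyn s"
      unfolding lyn_def
    proof (intro conjI allI impI)
      fix x y assume xy: "s = x @ y" "x \<noteq> []" "y \<noteq> []"
      then have "s \<le> y" using smin[of y "p @ x"] p by simp
      moreover have "s \<noteq> y" using xy by auto
      ultimately show "s < y" by simp
    qed (rule s)
    obtain ls where ls: "sorted_wrt (\<ge>) ls" "\<forall>l\<in>set ls. lyn l" "concat ls = p"
      using less[of p] p s by auto
    have "s \<le> l" if "l \<in> set ls" for l
    proof -
      have ne: "ls \<noteq> []" using that by auto
      then obtain ls' t where ls': "ls = ls' @ [t]" by (metis append_butlast_last_id)
      have "t \<le> l" using ls(1) that ls' by (auto simp: sorted_wrt_append)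
      moreover have "s \<le> t"
      proof (rule ccontr)
        assume "\<not> s \<le> t"
        then have ts: "t < s" by simp
        have t: "t \<noteq> []" using ls(2) ls' by (auto simp: lyn_def)
        have w: "w = concat ls' @ t @ s" using p ls(3) ls' by simp
        then have sts: "s \<le> t @ s" using smin[of "t @ s" "concat ls'"] s by simp
        from ts consider z where "s = t @ z" | "t @ s < s @ []" using list_less_append_cases by blast
        then show False
        proof cases
          case 1
          then have "z \<noteq> []" using ts by auto
          moreover have "w = (p @ t) @ z" using p 1 by simp
          ultimately have "s \<le> z" by (intro smin)
          moreover have "z \<le> s" using sts 1 by (metis append_le_append)
          ultimately show False using 1 t by auto
        next
          case 2 then show False using sts by simp
        qed
      qed
      ultimately show ?thesis by simp
    qed
    then have "sorted_wrt (\<ge>) (ls @ [s])" using ls(1) by (auto simp: sorted_wrt_append)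
    then show ?thesis using ls p \<open>lyn s\<close> by (intro exI[of _ "ls @ [s]"]) auto
  qed
qed

subsection \<open>Lyndon factorization of normal forms\<close>

definition lynwords :: "('a::linorder \<Rightarrow> 'a \<Rightarrow> bool) \<Rightarrow> 'a set \<Rightarrow> 'a list set" where
  "lynwords E W = {w. set w \<subseteq> W \<and> nf E w \<and> lyn w}"

text \<open>Multisets of words with total length \<open>n\<close>. They are encoded as decreasing
  lists because this is the order of the factors in the Lyndon factorization.\<close>

definition dlists :: "'a::linorder list set \<Rightarrow> nat \<Rightarrow> 'a list list set" where
  "dlists \<Lambda> n = {ls. set ls \<subseteq> \<Lambda> \<and> sorted_wrt (\<ge>) ls \<and> length (concat ls) = n}"

text \<open>The one-variable factor \<open>1 / (1 - x^k)\<close> of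
  \<open>1 + pbar k\<close>.\<close>

definition geom :: "nat \<Rightarrow> rat fps" where
  "geom k = Abs_fps (\<lambda>a. if k dvd a then 1 else 0)"

lemma geom_nth: "fps_nth (geom k) a = (if k dvd a then 1 else 0)"
  by (simp add: geom_def)

lemma geom_inverse:
  assumes "0 < k" shows "geom k * (1 - fps_X ^ k) = 1"
proof (rule fps_ext)
  fix n
  have "fps_nth (geom k * (1 - fps_X ^ k)) n
      = fps_nth (geom k) n - (if n < k then 0 else fps_nth (geom k) (n - k))"
    by (simp add: right_diff_distrib fps_X_power_mult_right_nth)
  also have "\<dots> = fps_nth 1 n"
  proof (cases "n < k")
    case True
    then show ?thesis using assms nat_dvd_not_less[of n k] by (cases "n = 0") (simp_all add: geom_nth)
  next
    case False
    then show ?thesis using assms by (simp add: geom_nth dvd_minus_self)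
  qed
  finally show "fps_nth (geom k * (1 - fps_X ^ k)) n = fps_nth 1 n" .
qed

lemma finite_dlists:
  assumes "finite \<Lambda>" "[] \<notin> \<Lambda>" shows "finite (dlists \<Lambda> n)"
proof (rule finite_subset)
  have "length ls \<le> length (concat ls)" if "set ls \<subseteq> \<Lambda>" for ls
    using that
  proof (induction ls)
    case (Cons l ls)
    then have "l \<noteq> []" using assms by auto
    then have "1 \<le> length l" by (cases l) auto
    then show ?case using Cons by simp
  qed simp
  then show "dlists \<Lambda> n \<subseteq> {ls. set ls \<subseteq> \<Lambda> \<and> length ls \<le> n}" by (auto simp: dlists_def)
qed (rule finite_lists_length_le[OF assms(1)])

text \<open>As \<open>b\<close> exceeds all of \<open>A\<close>, a decreasing list containing
  \<open>b\<close> begins with it.\<close>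

lemma dlists_insert:
  assumes "\<And>a. a \<in> A \<Longrightarrow> a < b"
  shows "dlists (insert b A) n = dlists A n \<union>
    (if length b \<le> n then (#) b ` dlists (insert b A) (n - length b) else {})"
proof (rule set_eqI)
  fix ls
  show "ls \<in> dlists (insert b A) n \<longleftrightarrow> ls \<in> dlists A n \<union>
    (if length b \<le> n then (#) b ` dlists (insert b A) (n - length b) else {})"
  proof (cases ls)
    case Nil then show ?thesis by (auto simp: dlists_def)
  next
    case (Cons l ms)
    show ?thesis
    proof (cases "l = b")
      case True
      have "b \<notin> A" using assms by blast
      moreover have "\<forall>y\<in>insert b A. y \<le> b" using assms by (auto intro: less_imp_le)
      ultimately show ?thesis using Cons True by (auto simp: dlists_def image_iff)
    next
      case False
      have "b \<notin> set ms" if "l \<in> A" "\<forall>y\<in>set ms. y \<le> l"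
        using that assms[of l] leD by blast
      then show ?thesis using Cons False by (auto simp: dlists_def)
    qed
  qed
qed

text \<open>Adjoin the words in increasing order. With \<open>k = length b\<close>, removing a
  leading \<open>b\<close> gives \<open>D' = D + X^k * D'\<close> for the series before and after
  adjoining \<open>b\<close>, and \<open>geom k\<close> inverts \<open>1 - X^k\<close>.\<close>

lemma dlists_gf:
  assumes "finite \<Lambda>" "[] \<notin> \<Lambda>"
  shows "Abs_fps (\<lambda>n. of_nat (card (dlists \<Lambda> n))) = (\<Prod>l\<in>\<Lambda>. geom (length l))"
  using assms
proof (induction \<Lambda> rule: finite_linorder_max_induct)
  case empty
  have "dlists {} n = (if n = 0 then {[]} else {} :: 'a list list set)" for n
    by (auto simp: dlists_def)
  then show ?case by (auto simp: fps_eq_iff)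
next
  case (insert b A)
  let ?D = "\<lambda>\<Lambda>. Abs_fps (\<lambda>n. of_nat (card (dlists \<Lambda> n))) :: rat fps"
  let ?k = "length b"
  have bA: "b \<notin> A" "[] \<notin> A" "0 < ?k" using insert by auto
  have fin: "finite (dlists A n)" "finite (dlists (insert b A) n)" for n
    using insert.hyps(1) bA by (simp_all add: finite_dlists)
  have "fps_nth (?D (insert b A)) n = fps_nth (?D A + fps_X ^ ?k * ?D (insert b A)) n" for n
  proof -
    define Y where "Y = (if ?k \<le> n then (#) b ` dlists (insert b A) (n - ?k) else {})"
    have "b \<in> set ls" if "ls \<in> Y" for ls using that by (auto simp: Y_def split: if_splits)
    moreover have "b \<notin> set ls" if "ls \<in> dlists A n" for ls using that bA(1) by (auto simp: dlists_def)
    ultimately have "dlists A n \<inter> Y = {}" by blast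
    moreover have "finite Y" using fin by (simp add: Y_def)
    moreover have "dlists (insert b A) n = dlists A n \<union> Y"
      unfolding Y_def using insert.hyps by (intro dlists_insert) blast
    ultimately have "card (dlists (insert b A) n) = card (dlists A n) + card Y"
      using fin by (simp only: card_Un_disjoint)
    also have "card Y = (if ?k \<le> n then card (dlists (insert b A) (n - ?k)) else 0)"
      by (simp add: Y_def card_image)
    finally show ?thesis by (simp add: fps_X_power_mult_nth)
  qed
  then have "?D (insert b A) = ?D A + fps_X ^ ?k * ?D (insert b A)" by (rule fps_ext)
  then have "?D (insert b A) * (1 - fps_X ^ ?k) = ?D A" by (simp add: algebra_simps)
  then have "?D (insert b A) * ((1 - fps_X ^ ?k) * geom ?k) = ?D A * geom ?k"
    by (metis mult.assoc)
  then have "?D (insert b A) = ?D A * geom ?k"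
    using geom_inverse[OF bA(3)] by (simp add: mult.commute)
  then show ?case using insert bA by (simp add: mult.commute)
qed

lemma lyn_le_hd:
  assumes "lyn l" "l' \<noteq> []" "l' \<le> l" "b \<in> set l"
  shows "hd l' \<le> b"
proof -
  obtain a w a' w' where l: "l = a # w" "l' = a' # w'"
    using assms by (cases l; cases l') (auto simp: lyn_def)
  then have "a' \<le> a" using assms(3) by auto
  moreover have "a \<le> b" using lyn_hd_le[of a w b] assms l by auto
  ultimately show ?thesis using l by simp
qed

context ordered_loopless_graph
begin

lemma nf_Nil: "nf E []"
  unfolding nf_def using teq_length[of E "[]"] by simp

text \<open>Glue with \<open>nf_append\<close>, adding the least factor last. A Lyndon word begins
  with its least letter and the factors decrease, so the first letter of the new factor is below all
  letters involved.\<close>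

lemma nf_concat:
  assumes "sorted_wrt (\<ge>) ls" "\<And>l. l \<in> set ls \<Longrightarrow> lyn l \<and> nf E l"
  shows "nf E (concat ls)"
  using assms
proof (induction ls rule: rev_induct)
  case (snoc l ls)
  have l: "lyn l" "nf E l" using snoc.prems(2)[of l] by auto
  then obtain a y where ay: "l = a # y" by (cases l) (auto simp: lyn_def)
  have "nf E (concat ls @ a # y)"
  proof (rule nf_append)
    show "nf E (concat ls)" using snoc by (auto simp: sorted_wrt_append)
    show "nf E (a # y)" using l ay by simp
    fix b assume "b \<in> set (concat ls) \<union> set y"
    then consider m where "m \<in> set ls" "b \<in> set m" | "b \<in> set y" by auto
    then show "a \<le> b"
    proof cases
      case 1
      then have "l \<le> m" "lyn m" using snoc.prems by (auto simp: sorted_wrt_append)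
      then show ?thesis using lyn_le_hd[of m l b] 1 ay by simp
    next
      case 2 then show ?thesis using lyn_hd_le l ay by blast
    qed
  qed
  then show ?case using ay by simp
qed (simp add: nf_Nil)

text \<open>Turns periodicity of a heap into periodicity of its normal form.\<close>

lemma nf_power:
  assumes "nf E (a # k)" "\<And>b. b \<in> set k \<Longrightarrow> a \<le> b"
  shows "nf E (concat (replicate m (a # k)))"
proof (induction m)
  case (Suc m)
  show ?case
  proof (cases m)
    case 0 then show ?thesis using assms by simp
  next
    case (Suc m')
    let ?y = "k @ concat (replicate m' (a # k))"
    have "nf E ((a # k) @ a # ?y)"
      using assms Suc.IH Suc by (intro nf_append) (auto split: if_splits)
    then show ?thesis using Suc by simp
  qed
qed (simp add: nf_Nil)

text \<open>The cut-off \<open>N\<close> only serves to keep the set of available Lyndon words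
  finite: factors of a word of length \<open>n\<close> have length at most \<open>n\<close>.\<close>

lemma card_nfwords:
  assumes "n \<le> N"
  shows "card (nfwords E W n) = card (dlists {w \<in> lynwords E W. length w \<le> N} n)"
proof -
  have "bij_betw concat (dlists {w \<in> lynwords E W. length w \<le> N} n) (nfwords E W n)"
  proof (rule bij_betwI')
    fix x y assume "x \<in> dlists {w \<in> lynwords E W. length w \<le> N} n" "y \<in> dlists {w \<in> lynwords E W. length w \<le> N} n"
    then show "concat x = concat y \<longleftrightarrow> x = y"
      using lyndon_factorization_unique[of x y] by (auto simp: dlists_def lynwords_def)
  next
    fix x assume "x \<in> dlists {w \<in> lynwords E W. length w \<le> N} n"
    then show "concat x \<in> nfwords E W n"
      using nf_concat[of x] by (auto simp: dlists_def lynwords_def nfwords_def)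
  next
    fix w assume w: "w \<in> nfwords E W n"
    obtain ls where ls: "sorted_wrt (\<ge>) ls" "\<forall>l\<in>set ls. lyn l" "concat ls = w"
      using lyndon_factorization_exists by blast
    have "l \<in> {w \<in> lynwords E W. length w \<le> N}" if l: "l \<in> set ls" for l
    proof -
      obtain xs ys where "ls = xs @ l # ys" using l by (meson split_list)
      then have e: "w = concat xs @ l @ concat ys" using ls(3) by auto
      have "nf E w" using w by (simp add: nfwords_def)
      then have "nf E l" unfolding e by (rule nf_factor)
      then show ?thesis using e w ls(2) l assms by (auto simp: lynwords_def nfwords_def)
    qed
    then have "ls \<in> dlists {w \<in> lynwords E W. length w \<le> N} n"
      using ls w unfolding dlists_def nfwords_def by blast
    then show "\<exists>x\<in>dlists {w \<in> lynwords E W. length w \<le> N} n. w = concat x" using ls(3) by blast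
  qed
  then show ?thesis by (simp add: bij_betw_same_card)
qed

lemma finite_lynwords: "finite W \<Longrightarrow> finite {w \<in> lynwords E W. length w \<le> N}"
  by (rule finite_subset[OF _ finite_lists_length_le[of W N]]) (auto simp: lynwords_def)

theorem nfwords_gf:
  assumes "finite W" "n \<le> N"
  shows "of_nat (card (nfwords E W n)) =
    fps_nth (\<Prod>l\<in>{w \<in> lynwords E W. length w \<le> N}. geom (length l)) n"
proof -
  have "[] \<notin> {w \<in> lynwords E W. length w \<le> N}" by (simp add: lynwords_def lyn_def)
  from dlists_gf[OF finite_lynwords[OF assms(1)] this] card_nfwords[OF assms(2), of W]
  show ?thesis by (simp add: fps_eq_iff)
qed

end

subsection \<open>Rotation and Lyndon heaps\<close>

text \<open>The pieces of \<open>w\<close> that do (respectively do not) come to lie above a piece with label in \<open>S\<close>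
  when all of \<open>w\<close> is dropped on top of such pieces.\<close>

primrec above_part :: "('a \<Rightarrow> 'a \<Rightarrow> bool) \<Rightarrow> 'a set \<Rightarrow> 'a list \<Rightarrow> 'a list" where
  "above_part E S [] = []"
| "above_part E S (x # w) = (if \<exists>s\<in>S. s = x \<or> E s x then x # above_part E (insert x S) w else above_part E S w)"

primrec beside_part :: "('a \<Rightarrow> 'a \<Rightarrow> bool) \<Rightarrow> 'a set \<Rightarrow> 'a list \<Rightarrow> 'a list" where
  "beside_part E S [] = []"
| "beside_part E S (x # w) = (if \<exists>s\<in>S. s = x \<or> E s x then beside_part E (insert x S) w else x # beside_part E S w)"

lemma above_append: "above_part E S (u @ v) = above_part E S u @ above_part E (S \<union> set (above_part E S u)) v"
  by (induction u arbitrary: S) (auto simp: insert_commute)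

lemma beside_append: "beside_part E S (u @ v) = beside_part E S u @ beside_part E (S \<union> set (above_part E S u)) v"
  by (induction u arbitrary: S) auto

lemma mset_above_beside: "mset (above_part E S w) + mset (beside_part E S w) = mset w"
  by (induction w arbitrary: S) auto

lemma set_above_beside: "set (above_part E S w) \<union> set (beside_part E S w) = set w"
  by (metis mset_above_beside set_mset_mset set_mset_union)

lemma above_eq_self: "beside_part E S w = [] \<Longrightarrow> above_part E S w = w"
  by (induction w arbitrary: S) (auto split: if_splits)

lemma above_above: "above_part E S (above_part E S w) = above_part E S w"
  and beside_above: "beside_part E S (above_part E S w) = []"
  by (induction w arbitrary: S) auto

lemma above_Nil_iff: "above_part E S w = [] \<longleftrightarrow> (\<forall>x\<in>set w. \<forall>s\<in>S. s \<noteq> x \<and> \<not> E s x)"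
  by (induction w arbitrary: S) auto

section \<open>Rotation computed by a left-to-right scan\<close>

lemma nths_cong: "(\<And>i. i < length w \<Longrightarrow> i \<in> A \<longleftrightarrow> i \<in> B) \<Longrightarrow> nths w A = nths w B"
  unfolding nths_def by (intro arg_cong[of _ _ "map fst"] filter_cong) (auto simp: in_set_zip)

lemma prec_snoc:
  "prec E (w @ [x]) = prec E w \<union> {(i, length w) | i. i < length w \<and> (w ! i = x \<or> E (w ! i) x)}"
  unfolding prec_def by (auto simp: nth_append less_Suc_eq split: if_splits)

text \<open>The order only relates a position to later ones, so a new last letter creates no new
  relation among the old positions.\<close>

lemma upper_snoc:
  assumes "p < length w"
  shows "upper E (w @ [x]) p = upper E w p \<union>
    (if \<exists>i\<in>upper E w p. w ! i = x \<or> E (w ! i) x then {length w} else {})"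
proof -
  have lt: "j < length w" if "(i, j) \<in> prec E w" for i j using that by (auto simp: prec_def)
  have "(j < length w \<and> (p, j) \<in> (prec E w)\<^sup>*) \<or>
      (j = length w \<and> (\<exists>i\<in>upper E w p. w ! i = x \<or> E (w ! i) x))"
    if "(p, j) \<in> (prec E (w @ [x]))\<^sup>*" for j
    using that
  proof (induction rule: rtrancl_induct)
    case base then show ?case using assms by simp
  next
    case (step j k)
    from step.hyps(2) consider "(j, k) \<in> prec E w" | "k = length w" "j < length w" "w ! j = x \<or> E (w ! j) x"
      unfolding prec_snoc by auto
    then show ?case
    proof cases
      case 1
      then have "j < length w" by (auto simp: prec_def)
      then show ?thesis using step.IH 1 lt by (auto intro: rtrancl_into_rtrancl)
    next
      case 2
      then show ?thesis using step.IH by (auto simp: upper_def)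
    qed
  qed
  moreover have "(prec E w)\<^sup>* \<subseteq> (prec E (w @ [x]))\<^sup>*"
    unfolding prec_snoc by (intro rtrancl_mono) auto
  moreover have "(p, length w) \<in> (prec E (w @ [x]))\<^sup>*" if "i \<in> upper E w p" "w ! i = x \<or> E (w ! i) x" for i
  proof -
    have "(i, length w) \<in> prec E (w @ [x])" using that unfolding prec_snoc upper_def by auto
    moreover have "(p, i) \<in> (prec E (w @ [x]))\<^sup>*" using that calculation(1) \<open>(prec E w)\<^sup>* \<subseteq> _\<close>
      unfolding upper_def by blast
    ultimately show ?thesis by (rule rtrancl_into_rtrancl[rotated])
  qed
  ultimately show ?thesis unfolding upper_def by (auto simp: less_Suc_eq split: if_splits)
qed

text \<open>Replaces the transitive closure in \<open>upper\<close> by a recursion: scanning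
  \<open>ys\<close>, a letter lies above the marked piece iff it equals or is adjacent to a letter
  collected before.\<close>

lemma nths_upper:
  "nths (xs @ a # ys) (upper E (xs @ a # ys) (length xs)) = a # above_part E {a} ys \<and>
   nths (xs @ a # ys) (- upper E (xs @ a # ys) (length xs)) = xs @ beside_part E {a} ys"
proof (induction ys rule: rev_induct)
  case Nil
  let ?w = "xs @ [a]" let ?p = "length xs"
  have le: "i \<le> j" if "(i, j) \<in> (prec E ?w)\<^sup>*" for i j
    using that by (induction rule: rtrancl_induct) (auto simp: prec_def)
  have up: "upper E ?w ?p = {?p}"
    unfolding upper_def by (auto dest: le)
  have "nths xs {?p} = nths xs {}" by (intro nths_cong) auto
  moreover have "nths xs (- {?p}) = nths xs UNIV" by (intro nths_cong) auto
  ultimately show ?case unfolding up by (simp add: nths_append nths_all)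
next
  case (snoc x ys)
  let ?w = "xs @ a # ys" let ?p = "length xs"
  let ?U = "upper E ?w ?p"
  have w: "xs @ a # ys @ [x] = ?w @ [x]" by simp
  have ulen: "i < length ?w" if "i \<in> ?U" for i using that by (simp add: upper_def)
  have eq: "(\<exists>i\<in>?U. ?w ! i = x \<or> E (?w ! i) x) \<longleftrightarrow> (\<exists>s\<in>{a} \<union> set (above_part E {a} ys). s = x \<or> E s x)"
  proof -
    have "set (nths ?w ?U) = (!) ?w ` ?U" using ulen by (auto simp: set_nths)
    then have "(!) ?w ` ?U = insert a (set (above_part E {a} ys))" using snoc by simp
    then show ?thesis by (metis (no_types, lifting) image_iff insert_is_Un)
  qed
  have up: "upper E (?w @ [x]) ?p = ?U \<union> (if \<exists>s\<in>{a} \<union> set (above_part E {a} ys). s = x \<or> E s x then {length ?w} else {})"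
    by (subst upper_snoc) (simp, simp only: eq)
  have 1: "nths ?w (upper E (?w @ [x]) ?p) = nths ?w ?U"
    unfolding up by (rule nths_cong) (auto split: if_splits)
  have 2: "nths ?w (- upper E (?w @ [x]) ?p) = nths ?w (- ?U)"
    unfolding up by (rule nths_cong) (auto split: if_splits)
  have 3: "length ?w \<in> upper E (?w @ [x]) ?p \<longleftrightarrow> (\<exists>s\<in>{a} \<union> set (above_part E {a} ys). s = x \<or> E s x)"
    unfolding up using ulen by auto
  show ?case
    unfolding w nths_append[of ?w "[x]"] 1 2 using snoc 3
    by (auto simp: above_append beside_append)
qed

lemma rotw_eq: "rotw E (xs @ a # ys) (length xs) = a # above_part E {a} ys @ xs @ beside_part E {a} ys"
  unfolding rotw_def using nths_upper[of xs a ys E] by simp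

lemma rotw_0: "rotw E (a # z) 0 = a # above_part E {a} z @ beside_part E {a} z"
  using rotw_eq[of E "[]" a z] by simp

lemma rotw_fixed: "beside_part E {a} z = [] \<Longrightarrow> rotw E (a # z) 0 = a # z"
  by (simp add: rotw_0 above_eq_self)

lemma funpow_fixed: "f x = x \<Longrightarrow> (f ^^ k) x = x"
  by (induction k) auto

text \<open>Such a word \<open>a # r\<close> is a fixed point of the rotation, so reaching it once
  settles the limit.\<close>

lemma rotinf_eqI:
  assumes "riter E w p N = a # r" "beside_part E {a} r = []"
  shows "rotinf E w p = heapcl E (a # r)"
proof -
  have "riter E w p k = a # r" if "N \<le> k" for k
  proof -
    have "riter E w p k = ((\<lambda>u. rotw E u 0) ^^ (k - N)) (riter E w p N)"
      using that unfolding riter_def by (metis le_add_diff_inverse2 funpow_add comp_apply)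
    then show ?thesis using assms funpow_fixed[of "\<lambda>u. rotw E u 0" "a # r"] rotw_fixed by metis
  qed
  note c = this
  show ?thesis unfolding rotinf_def
  proof (rule the_equality)
    have "\<forall>k\<ge>N. heapcl E (riter E w p k) = heapcl E (a # r)" using c by simp
    then show "\<exists>N. \<forall>k\<ge>N. heapcl E (riter E w p k) = heapcl E (a # r)" by blast
    fix H assume "\<exists>N. \<forall>k\<ge>N. heapcl E (riter E w p k) = H"
    then obtain M where "\<forall>k\<ge>M. heapcl E (riter E w p k) = H" by blast
    then have "heapcl E (riter E w p (max M N)) = H" by simp
    then show "H = heapcl E (a # r)" using c[of "max M N"] by simp
  qed
qed

text \<open>The first letter that the scan leaves over is preceded only by collected letters, and it
  commutes with all of them; hence it is a front letter of \<open>z\<close>.\<close>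

lemma beside_Nil_iff:
  "beside_part E S z = [] \<longleftrightarrow> \<not> (\<exists>b. front E b z \<and> (\<forall>s\<in>S. s \<noteq> b \<and> \<not> E s b))"
proof (induction z arbitrary: S)
  case (Cons x z)
  show ?case
  proof (cases "\<exists>s\<in>S. s = x \<or> E s x")
    case True
    then have "beside_part E S (x # z) = [] \<longleftrightarrow> \<not> (\<exists>b. front E b z \<and> (\<forall>s\<in>insert x S. s \<noteq> b \<and> \<not> E s b))"
      using Cons.IH by simp
    also have "\<dots> \<longleftrightarrow> \<not> (\<exists>b. front E b (x # z) \<and> (\<forall>s\<in>S. s \<noteq> b \<and> \<not> E s b))"
      using True by auto
    finally show ?thesis .
  next
    case False
    then show ?thesis by auto
  qed
qed simp

section \<open>Rotation on heaps, connectedness and pyramids\<close>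

context loopless_graph
begin

text \<open>Two commuting letters are collected independently, neither triggering the other. If they
  land in the same part they are still adjacent there and commute; otherwise both parts stay the
  same.\<close>

lemma above_beside_swap:
  assumes "u \<noteq> v" "\<not> E u v"
  shows "teq E (above_part E S (ps @ u # v # qs)) (above_part E S (ps @ v # u # qs))"
    and "teq E (beside_part E S (ps @ u # v # qs)) (beside_part E S (ps @ v # u # qs))"
proof -
  have nvu: "\<not> E v u" using assms E_sym by blast
  define T where "T = S \<union> set (above_part E S ps)"
  have ins: "(\<exists>s\<in>insert u T. s = v \<or> E s v) \<longleftrightarrow> (\<exists>s\<in>T. s = v \<or> E s v)"
    "(\<exists>s\<in>insert v T. s = u \<or> E s u) \<longleftrightarrow> (\<exists>s\<in>T. s = u \<or> E s u)"
    using assms nvu by auto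
  have sw: "teq E (u # v # t) (v # u # t)" for t using teq_swap[of u v E "[]" t] assms by simp
  have "teq E (above_part E T (u # v # qs)) (above_part E T (v # u # qs)) \<and>
      teq E (beside_part E T (u # v # qs)) (beside_part E T (v # u # qs))"
  proof (cases "\<exists>s\<in>T. s = u \<or> E s u"; cases "\<exists>s\<in>T. s = v \<or> E s v")
    assume *: "\<exists>s\<in>T. s = u \<or> E s u" "\<exists>s\<in>T. s = v \<or> E s v"
    show ?thesis
      unfolding above_part.simps beside_part.simps ins if_P[OF *(1)] if_P[OF *(2)] insert_commute[of u v T]
      using sw by simp
  next
    assume *: "\<exists>s\<in>T. s = u \<or> E s u" "\<not> (\<exists>s\<in>T. s = v \<or> E s v)"
    show ?thesis
      unfolding above_part.simps beside_part.simps ins if_P[OF *(1)] if_not_P[OF *(2)] by simp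
  next
    assume *: "\<not> (\<exists>s\<in>T. s = u \<or> E s u)" "\<exists>s\<in>T. s = v \<or> E s v"
    show ?thesis
      unfolding above_part.simps beside_part.simps ins if_not_P[OF *(1)] if_P[OF *(2)] by simp
  next
    assume *: "\<not> (\<exists>s\<in>T. s = u \<or> E s u)" "\<not> (\<exists>s\<in>T. s = v \<or> E s v)"
    show ?thesis
      unfolding above_part.simps beside_part.simps ins if_not_P[OF *(1)] if_not_P[OF *(2)] using sw by simp
  qed
  then have T: "teq E (above_part E T (u # v # qs)) (above_part E T (v # u # qs))"
    "teq E (beside_part E T (u # v # qs)) (beside_part E T (v # u # qs))" by simp_all
  from T(1) show "teq E (above_part E S (ps @ u # v # qs)) (above_part E S (ps @ v # u # qs))"
    unfolding above_append[of E S ps] T_def[symmetric] by (intro teq_append2) simp_all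
  from T(2) show "teq E (beside_part E S (ps @ u # v # qs)) (beside_part E S (ps @ v # u # qs))"
    unfolding beside_append[of E S ps] T_def[symmetric] by (intro teq_append2) simp_all
qed

text \<open>The swapped pair lies after the marked \<open>a\<close>, begins with it, ends with it,
  or lies before it. In the two middle cases the partner commutes with \<open>a\<close> and is never
  collected by it, so both rotations are the same word.\<close>

lemma rotw_swap:
  assumes uv: "u \<noteq> v" "\<not> E u v" and e: "ps @ u # v # qs = xs @ a # ys"
  shows "\<exists>xs' ys'. ps @ v # u # qs = xs' @ a # ys' \<and> count_list xs' a = count_list xs a \<and>
    teq E (rotw E (xs @ a # ys) (length xs)) (rotw E (xs' @ a # ys') (length xs'))"
proof -
  have nvu: "\<not> E v u" using uv E_sym by blast
  from e obtain us where us: "ps = xs @ us \<and> us @ u # v # qs = a # ys \<or> ps @ us = xs \<and> u # v # qs = us @ a # ys"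
    by (subst (asm) append_eq_append_conv2) blast
  then consider zs where "ps = xs @ a # zs" "ys = zs @ u # v # qs"
    | "ps = xs" "a = u" "ys = v # qs"
    | "xs = ps @ [u]" "a = v" "ys = qs"
    | zs where "xs = ps @ u # v # zs" "qs = zs @ a # ys"
  proof (elim disjE conjE)
    assume "ps = xs @ us" "us @ u # v # qs = a # ys"
    then show ?thesis using that(1,2) by (cases us) auto
  next
    assume *: "ps @ us = xs" "u # v # qs = us @ a # ys"
    show ?thesis
    proof (cases us)
      case Nil then show ?thesis using * that(2) by auto
    next
      case (Cons d vs)
      then show ?thesis using * that(3,4) by (cases vs) auto
    qed
  qed
  then show ?thesis
  proof cases
    case 1
    have "teq E (above_part E {a} ys) (above_part E {a} (zs @ v # u # qs))"
      "teq E (beside_part E {a} ys) (beside_part E {a} (zs @ v # u # qs))"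
      unfolding 1 using above_beside_swap[OF uv] by auto
    then have "teq E (rotw E (xs @ a # ys) (length xs)) (rotw E (xs @ a # (zs @ v # u # qs)) (length xs))"
      unfolding rotw_eq by (intro teq_Cons teq_append2) auto
    moreover have "ps @ v # u # qs = xs @ a # (zs @ v # u # qs)" using 1 by simp
    ultimately show ?thesis by blast
  next
    case 2
    have "rotw E (xs @ a # ys) (length xs) = rotw E ((xs @ [v]) @ a # qs) (length (xs @ [v]))"
      unfolding rotw_eq using 2 uv by simp
    moreover have "ps @ v # u # qs = (xs @ [v]) @ a # qs" using 2 by simp
    moreover have "count_list (xs @ [v]) a = count_list xs a" using 2 uv by simp
    ultimately show ?thesis by (metis teq_refl)
  next
    case 3
    have "rotw E (xs @ a # ys) (length xs) = rotw E (ps @ a # (u # qs)) (length ps)"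
      unfolding rotw_eq using 3 uv nvu by simp
    moreover have "ps @ v # u # qs = ps @ a # (u # qs)" using 3 by simp
    moreover have "count_list ps a = count_list xs a" using 3 uv by simp
    ultimately show ?thesis by (metis teq_refl)
  next
    case 4
    have "teq E xs (ps @ v # u # zs)" unfolding 4 using uv by (intro teq_swap)
    then have "teq E (rotw E (xs @ a # ys) (length xs)) (rotw E ((ps @ v # u # zs) @ a # ys) (length (ps @ v # u # zs)))"
      unfolding rotw_eq by (intro teq_Cons teq_append2) auto
    moreover have "ps @ v # u # qs = (ps @ v # u # zs) @ a # ys" using 4 by simp
    moreover have "count_list (ps @ v # u # zs) a = count_list xs a" using 4 by simp
    ultimately show ?thesis by blast
  qed
qed

text \<open>Counting occurrences of \<open>a\<close> matches the piece to be rotated in two words for the same heap.\<close>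

lemma rotw_teq:
  assumes "teq E (xs @ a # ys) w'"
  shows "\<exists>xs' ys'. w' = xs' @ a # ys' \<and> count_list xs' a = count_list xs a \<and>
    teq E (rotw E (xs @ a # ys) (length xs)) (rotw E (xs' @ a # ys') (length xs'))"
  using assms
proof (induction rule: teq_induct)
  case refl
  then show ?case using teq_refl by blast
next
  case (step ps u v qs)
  then obtain xs1 ys1 where 1: "ps @ u # v # qs = xs1 @ a # ys1" "count_list xs1 a = count_list xs a"
    "teq E (rotw E (xs @ a # ys) (length xs)) (rotw E (xs1 @ a # ys1) (length xs1))" by blast
  from rotw_swap[OF step.hyps(2,3) 1(1)] obtain xs' ys' where
    2: "ps @ v # u # qs = xs' @ a # ys'" "count_list xs' a = count_list xs1 a"
    "teq E (rotw E (xs1 @ a # ys1) (length xs1)) (rotw E (xs' @ a # ys') (length xs'))" by blast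
  have "teq E (rotw E (xs @ a # ys) (length xs)) (rotw E (xs' @ a # ys') (length xs'))"
    using 1(3) 2(3) by (rule teq_trans)
  then show ?case using 1(2) 2(1,2) by (intro exI[of _ xs'] exI[of _ ys']) simp
qed

lemma rotw_0_teq:
  assumes "teq E (a # z) (a # z')"
  shows "teq E (rotw E (a # z) 0) (rotw E (a # z') 0)"
proof -
  obtain xs' ys' where 1: "a # z' = xs' @ a # ys'" "count_list xs' a = 0"
    "teq E (rotw E (a # z) 0) (rotw E (xs' @ a # ys') (length xs'))"
    using rotw_teq[of "[]" a z "a # z'"] assms by auto
  \<comment> \<open>No \<open>a\<close> precedes the marked one, and the word itself starts with
    \<open>a\<close>.\<close>
  then have "xs' = []" by (cases xs') auto
  then show ?thesis using 1 by simp
qed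

text \<open>\<open>rclass\<close> ranges over all words of a heap; this reduces it to the rotations
  of one chosen word, later the normal form.\<close>

lemma rotinf_teq:
  assumes "teq E (xs @ a # ys) w'"
  shows "\<exists>xs' ys'. w' = xs' @ a # ys' \<and> rotinf E (xs @ a # ys) (length xs) = rotinf E w' (length xs')"
proof -
  obtain xs' ys' where 1: "w' = xs' @ a # ys'"
    "teq E (rotw E (xs @ a # ys) (length xs)) (rotw E w' (length xs'))"
    using rotw_teq[OF assms] by blast
  have "\<exists>z z'. riter E (xs @ a # ys) (length xs) k = a # z \<and> riter E w' (length xs') k = a # z' \<and>
      teq E (a # z) (a # z')" for k
  proof (induction k)
    case 0
    then show ?case using 1 by (simp add: riter_def rotw_eq)
  next
    case (Suc k)
    then obtain z z' where z: "riter E (xs @ a # ys) (length xs) k = a # z"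
      "riter E w' (length xs') k = a # z'" "teq E (a # z) (a # z')" by blast
    have "riter E (xs @ a # ys) (length xs) (Suc k) = rotw E (a # z) 0"
      "riter E w' (length xs') (Suc k) = rotw E (a # z') 0"
      using z by (simp_all add: riter_def)
    then show ?case using rotw_0_teq[OF z(3)] by (simp add: rotw_0)
  qed
  then have "heapcl E (riter E (xs @ a # ys) (length xs) k) = heapcl E (riter E w' (length xs') k)" for k
    unfolding heapcl_eq_iff by metis
  then have "rotinf E (xs @ a # ys) (length xs) = rotinf E w' (length xs')"
    unfolding rotinf_def by simp
  then show ?thesis using 1(1) by blast
qed

text \<open>Connectedness of the subgraph induced on \<open>X\<close>, expressed by neighbour-closed
  sets instead of paths, to match the closure that \<open>above_part\<close> computes.\<close>

definition conn :: "'a set \<Rightarrow> bool" where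
  "conn X \<longleftrightarrow> (\<forall>A\<subseteq>X. A \<noteq> {} \<longrightarrow> (\<forall>x\<in>A. \<forall>y\<in>X. E x y \<longrightarrow> y \<in> A) \<longrightarrow> A = X)"

lemma above_subset_closed:
  "S \<subseteq> A \<Longrightarrow> (\<forall>x\<in>A. \<forall>y\<in>X. E x y \<longrightarrow> y \<in> A) \<Longrightarrow> set z \<subseteq> X \<Longrightarrow> set (above_part E S z) \<subseteq> A"
proof (induction z arbitrary: S)
  case (Cons x z)
  show ?case
  proof (cases "\<exists>s\<in>S. s = x \<or> E s x")
    case True
    then have "x \<in> A" using Cons.prems by auto
    then show ?thesis using Cons.IH[of "insert x S"] Cons.prems True by simp
  next
    case False
    then show ?thesis using Cons by auto
  qed
qed simp

text \<open>All of \<open>z\<close> is reached from \<open>a\<close>, so a closed set containing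
  \<open>a\<close> is everything. For a closed set avoiding \<open>a\<close>, the complement is
  closed by symmetry and contains \<open>a\<close>.\<close>

lemma conn_pyramid:
  assumes "beside_part E {a} z = []" shows "conn (set (a # z))"
proof -
  let ?X = "set (a # z)"
  have *: "A = ?X" if "A \<subseteq> ?X" "a \<in> A" "\<forall>x\<in>A. \<forall>y\<in>?X. E x y \<longrightarrow> y \<in> A" for A
    using above_subset_closed[of "{a}" A ?X z] that above_eq_self[OF assms] by auto
  show ?thesis unfolding conn_def
  proof (intro allI impI)
    fix A assume A: "A \<subseteq> ?X" "A \<noteq> {}" "\<forall>x\<in>A. \<forall>y\<in>?X. E x y \<longrightarrow> y \<in> A"
    show "A = ?X"
    proof (cases "a \<in> A")
      case True then show ?thesis using * A by blast
    next
      case False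
      have "\<forall>x\<in>?X - A. \<forall>y\<in>?X. E x y \<longrightarrow> y \<in> ?X - A" using A E_sym by blast
      then have "?X - A = ?X" using *[of "?X - A"] False by auto
      then show ?thesis using A by blast
    qed
  qed
qed

text \<open>A rotation puts the pieces above \<open>a\<close> first, where they stay above \<open>a\<close>; by connectedness one more
  piece must come to lie above them unless nothing is left over.\<close>

lemma rotation_stabilizes:
  "conn (set (a # z)) \<Longrightarrow> \<exists>N r. ((\<lambda>u. rotw E u 0) ^^ N) (a # z) = a # r \<and> beside_part E {a} r = []"
proof (induction "length (beside_part E {a} z)" arbitrary: z rule: less_induct)
  case less
  show ?case
  proof (cases "beside_part E {a} z = []")
    case True
    then show ?thesis by (intro exI[of _ 0] exI[of _ z]) auto
  next
    case False
    let ?V = "above_part E {a} z" let ?U = "beside_part E {a} z" let ?S = "insert a (set ?V)"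
    have X: "set (a # z) = ?S \<union> set ?U" using set_above_beside[of E "{a}" z] by auto
    have "above_part E ?S ?U \<noteq> []"
    proof
      assume *: "above_part E ?S ?U = []"
      then have n: "\<forall>x\<in>set ?U. \<forall>s\<in>?S. s \<noteq> x \<and> \<not> E s x" unfolding above_Nil_iff .
      then have "\<forall>x\<in>?S. \<forall>y\<in>?S \<union> set ?U. E x y \<longrightarrow> y \<in> ?S" by blast
      moreover have "?S \<subseteq> ?S \<union> set ?U" "?S \<noteq> {}" by auto
      ultimately have "?S = ?S \<union> set ?U" using less.prems unfolding X conn_def by blast
      then have "set ?U \<subseteq> ?S" by blast
      then show False using n False by (metis ex_in_conv set_empty subset_iff)
    qed
    moreover have "length (above_part E ?S ?U) + length (beside_part E ?S ?U) = length ?U"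
      by (metis mset_above_beside size_mset size_union)
    ultimately have "length (beside_part E ?S ?U) < length ?U"
      by (metis length_greater_0_conv less_add_same_cancel2)
    moreover have "beside_part E {a} (?V @ ?U) = beside_part E ?S ?U"
      by (simp add: beside_append beside_above above_above)
    ultimately have lt: "length (beside_part E {a} (?V @ ?U)) < length ?U" by simp
    have "conn (set (a # ?V @ ?U))" using less.prems X by simp
    then obtain N r where r: "((\<lambda>u. rotw E u 0) ^^ N) (a # ?V @ ?U) = a # r" "beside_part E {a} r = []"
      using less.hyps[OF lt] by blast
    have "((\<lambda>u. rotw E u 0) ^^ Suc N) (a # z) = a # r"
      using r(1) by (simp add: funpow_Suc_right rotw_0 del: funpow.simps)
    then show ?thesis using r(2) by blast
  qed
qed

lemma rotinf_conn:
  assumes "conn (set (xs @ a # ys))"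
  shows "\<exists>r. rotinf E (xs @ a # ys) (length xs) = heapcl E (a # r) \<and> beside_part E {a} r = []"
proof -
  let ?z = "above_part E {a} ys @ xs @ beside_part E {a} ys"
  have "set (a # ?z) = set (xs @ a # ys)" using set_above_beside[of E "{a}" ys] by auto
  then obtain N r where r: "((\<lambda>u. rotw E u 0) ^^ N) (a # ?z) = a # r" "beside_part E {a} r = []"
    using rotation_stabilizes[of a ?z] assms by metis
  then have "riter E (xs @ a # ys) (length xs) N = a # r" by (simp add: riter_def rotw_eq)
  from rotinf_eqI[OF this r(2)] show ?thesis using r(2) by blast
qed

text \<open>Pieces with equal labels are comparable, so a minimal piece is determined by its label.
  This replaces positions by \<open>front\<close>, which is invariant under commutation.\<close>

lemma minpos_bij: "bij_betw ((!) w) (minpos E w) {b. front E b w}"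
proof (rule bij_betwI')
  fix i j assume ij: "i \<in> minpos E w" "j \<in> minpos E w"
  show "w ! i = w ! j \<longleftrightarrow> i = j"
  proof
    assume e: "w ! i = w ! j"
    show "i = j"
    proof (rule linorder_cases[of i j])
      assume "i < j"
      then have "(i, j) \<in> prec E w" using e ij by (simp add: prec_def minpos_def)
      then show ?thesis using ij by (simp add: minpos_def)
    next
      assume "j < i"
      then have "(j, i) \<in> prec E w" using e ij by (simp add: prec_def minpos_def)
      then show ?thesis using ij by (simp add: minpos_def)
    qed
  qed simp
next
  fix j assume j: "j \<in> minpos E w"
  then have len: "j < length w" by (simp add: minpos_def)
  have "x \<noteq> w ! j \<and> \<not> E x (w ! j)" if x: "x \<in> set (take j w)" for x
  proof -
    obtain i where "i < length (take j w)" "take j w ! i = x"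
      using x unfolding in_set_conv_nth by blast
    then have i: "i < j" "x = w ! i" by auto
    have "(i, j) \<notin> prec E w" using j by (simp add: minpos_def)
    then show ?thesis using i len by (simp add: prec_def)
  qed
  then have "front E (w ! j) w"
    unfolding front_iff using id_take_nth_drop[OF len] by blast
  then show "w ! j \<in> {b. front E b w}" by simp
next
  fix b assume "b \<in> {b. front E b w}"
  then obtain xs ys where w: "w = xs @ b # ys" and n: "\<forall>x\<in>set xs. x \<noteq> b \<and> \<not> E x b"
    by (auto simp: front_iff)
  have "(i, length xs) \<notin> prec E w" for i
    using n unfolding prec_def w by (auto simp: nth_append)
  then have "length xs \<in> minpos E w" unfolding minpos_def w by simp
  moreover have "b = w ! length xs" unfolding w by simp
  ultimately show "\<exists>j\<in>minpos E w. b = w ! j" by blast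
qed

lemma pyramid_iff: "pyramid E (heapcl E w) \<longleftrightarrow> (\<exists>!b. front E b w)"
proof -
  have c: "card (minpos E v) = card {b. front E b v}" for v
    using minpos_bij by (rule bij_betw_same_card)
  have f: "{b. front E b v} = {b. front E b w}" if "teq E w v" for v
    using front_teq[OF that] by simp
  have "pyramid E (heapcl E w) \<longleftrightarrow> card {b. front E b w} = 1"
    unfolding pyramid_def heapcl_teq using c f teq_refl by (metis mem_Collect_eq)
  also have "\<dots> \<longleftrightarrow> (\<exists>!b. front E b w)"
  proof
    assume "card {b. front E b w} = 1"
    then obtain c where "{b. front E b w} = {c}" by (auto simp: card_1_singleton_iff)
    then have "front E b w \<longleftrightarrow> b = c" for b by blast
    then show "\<exists>!b. front E b w" by simp
  next
    assume "\<exists>!b. front E b w"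
    then obtain c where "front E c w" "\<And>b. front E b w \<Longrightarrow> b = c" by blast
    then have "{b. front E b w} = {c}" by blast
    then show "card {b. front E b w} = 1" by simp
  qed
  finally show ?thesis .
qed

lemma unique_front_iff: "(\<exists>!b. front E b (a # z)) \<longleftrightarrow> beside_part E {a} z = []"
  unfolding beside_Nil_iff by auto

end

section \<open>Normal Lyndon words and Lyndon heaps\<close>

context ordered_loopless_graph
begin

lemma stdword_nform: "stdword (heapcl E w) = nform w"
proof -
  have "heapcl E w = heapcl E (nform w)" unfolding heapcl_eq_iff by (rule nform)
  then show ?thesis using stdword_heapcl[OF nform(2)] by simp
qed

text \<open>The first letter of any word labels a minimal piece, and a pyramid has only one.\<close>

lemma nform_pyramid:
  assumes "beside_part E {a} r = []" shows "\<exists>v. nform (a # r) = a # v"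
proof -
  obtain b v where v: "nform (a # r) = b # v" by (cases "nform (a # r)") (use nform_set[of "a # r"] in auto)
  have "front E b (nform (a # r))" unfolding v by simp
  then have "front E b (a # r)" using front_teq[OF nform(1)] by blast
  moreover have "front E a (a # r)" by simp
  ultimately have "b = a" using assms unfolding unique_front_iff[symmetric] by blast
  then show ?thesis using v by simp
qed

text \<open>A piece not above \<open>a\<close> would yield a letter \<open>b > a\<close> commuting
  with \<open>a\<close> and with everything before it, the pattern excluded by
  \<open>nfD\<close>.\<close>

lemma beside_nf:
  assumes "nf E (a # y)" "\<And>b. b \<in> set y \<Longrightarrow> a \<le> b"
  shows "beside_part E {a} y = []"
  unfolding beside_Nil_iff
proof
  assume "\<exists>b. front E b y \<and> (\<forall>s\<in>{a}. s \<noteq> b \<and> \<not> E s b)"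
  then obtain b xs ys where b: "a \<noteq> b" "\<not> E a b" "y = xs @ b # ys" "\<forall>x\<in>set xs. x \<noteq> b \<and> \<not> E x b"
    unfolding front_iff by blast
  then have "a < b" using assms(2)[of b] by simp
  moreover have "nf E ([] @ a # xs @ b # ys)" using assms(1) b(3) by simp
  ultimately have "\<exists>c\<in>set (a # xs). c = b \<or> E c b" using nfD by blast
  then show False using b by auto
qed

text \<open>The square of the word is normal, as the word begins with its least letter, and the
  conjugate \<open>a # y @ x\<close> is a factor of this square. By \<open>beside_nf\<close> nothing
  lies beside the leading \<open>a\<close> of \<open>a # y\<close> or of the conjugate, so a single
  rotation yields the conjugate and is already stable.\<close>

lemma rotinf_rotation:
  assumes nf: "nf E (x @ a # y)" and min: "\<And>b. b \<in> set (x @ a # y) \<Longrightarrow> a \<le> b" and hd: "hd (x @ a # y) = a"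
  shows "rotinf E (x @ a # y) (length x) = heapcl E (a # y @ x)" "nf E (a # y @ x)"
proof -
  let ?w = "x @ a # y"
  obtain w0 where w0: "?w = a # w0" using hd by (cases ?w) auto
  have m0: "a \<le> b" if "b \<in> set ?w \<union> set w0" for b
    using that min[of b] w0 by (metis UnE list.set_intros(2))
  have "nf E (a # w0)" using nf unfolding w0 .
  then have "nf E (?w @ a # w0)" using nf m0 by (intro nf_append[of ?w a w0])
  then have "nf E (x @ (a # y @ x) @ a # y)" using w0[symmetric] by simp
  then show n: "nf E (a # y @ x)" by (rule nf_factor)
  have "nf E (x @ (a # y) @ [])" using nf by simp
  then have "nf E (a # y)" by (rule nf_factor)
  then have b: "beside_part E {a} y = []" using min by (intro beside_nf) auto
  have "beside_part E {a} (y @ x) = []" using n min by (intro beside_nf) auto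
  moreover have "riter E ?w (length x) 0 = a # y @ x"
    by (simp add: riter_def rotw_eq b above_eq_self)
  ultimately show "rotinf E ?w (length x) = heapcl E (a # y @ x)" by (rule rotinf_eqI[rotated])
qed

text \<open>Rotations at the least letter \<open>a\<close> are conjugates of \<open>w\<close>, none
  of which is below a Lyndon word. Rotations at another letter \<open>b\<close> give pyramids whose
  standard word begins with \<open>b > a\<close>.\<close>

lemma lyndon_heap_if_lyn:
  assumes V: "set w \<subseteq> V" and nf: "nf E w" and lyn: "lyn w"
  shows "lyndon_heap V E (heapcl E w)"
proof -
  obtain a z where w: "w = a # z" using lyn by (cases w) (auto simp: lyn_def)
  have min: "a \<le> b" if "b \<in> set w" for b using lyn_hd_le[of a z b] lyn w that by auto
  have bz: "beside_part E {a} z = []" using nf min w by (intro beside_nf) auto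
  have "heapcl E w \<in> heaps V E" using V by (auto simp: heaps_def)
  moreover have "pyramid E (heapcl E w)" unfolding pyramid_iff w unique_front_iff by (rule bz)
  moreover have "\<not> periodic E (heapcl E w)"
  proof
    assume "periodic E (heapcl E w)"
    then obtain k m where m: "1 < m" "teq E w (concat (replicate m k))"
      unfolding periodic_def heapcl_eq_iff by blast
    \<comment> \<open>Passing to \<open>nform k\<close> makes the power itself normal:
      \<open>nform k\<close> starts with \<open>a\<close>, the only front letter of
      \<open>w\<close>, so \<open>nf_power\<close> applies. Then \<open>w\<close> equals the power,
      and \<open>nform k\<close> is both a proper suffix and a prefix of the Lyndon word
      \<open>w\<close>.\<close>
    have t: "teq E w (concat (replicate m (nform k)))"
      using m(2) teq_power[OF nform(1)] teq_trans by blast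
    obtain m' where m': "m = Suc (Suc m')" using less_imp_Suc_add[OF m(1)] by auto
    have "nform k \<noteq> []"
    proof
      assume "nform k = []"
      then have "concat (replicate m (nform k)) = []" by simp
      with teq_length[OF t] have "length w = 0" by (metis list.size(3))
      then show False using w by simp
    qed
    then obtain b k' where k': "nform k = b # k'" by (cases "nform k") auto
    have "front E b (concat (replicate m (nform k)))" using m' k' by simp
    then have "front E b (a # z)" using front_teq[OF t] w by blast
    then have ab: "b = a" using bz unfolding unique_front_iff[symmetric] by auto
    have "set (nform k) \<subseteq> set w" using teq_set[OF t] m' by auto
    then have "nf E (concat (replicate m (nform k)))"
      unfolding k' ab using nform(2)[of k] k' ab min by (intro nf_power) auto
    then have "w = concat (replicate m (nform k))" using nf_unique[OF nf _ t] by blast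
    moreover have "replicate m (nform k) = replicate (Suc m') (nform k) @ [nform k]"
      unfolding m' by (simp add: replicate_append_same)
    ultimately have e: "w = concat (replicate (Suc m') (nform k)) @ nform k" by simp
    moreover have "concat (replicate (Suc m') (nform k)) \<noteq> []" "nform k \<noteq> []" using k' by simp_all
    ultimately have "w < nform k" using lyn unfolding lyn_def by blast
    moreover have "nform k \<le> w" using e prefix_le[of "nform k"] m' by simp
    ultimately show False by simp
  qed
  moreover have "stdword (heapcl E w) = stdword Q \<or> lexless (stdword (heapcl E w)) (stdword Q)"
    if Q: "Q \<in> rclass E (heapcl E w)" for Q
  proof -
    obtain w2 q where q: "Q = rotinf E w2 q" "teq E w w2" "q < length w2"
      using Q unfolding rclass_def heapcl_teq by blast
    define xs b ys where "xs = take q w2" and "b = w2 ! q" and "ys = drop (Suc q) w2"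
    have w2: "w2 = xs @ b # ys" "q = length xs"
      using q(3) by (simp_all add: xs_def b_def ys_def id_take_nth_drop)
    then obtain xs' ys' where w': "w = xs' @ b # ys'" "Q = rotinf E w (length xs')"
      using rotinf_teq[of xs b ys w] teq_sym[OF q(2)] q(1) by blast
    have "w \<le> stdword Q"
    proof (cases "b = a")
      case True
      have "hd (xs' @ a # ys') = a" "nf E (xs' @ a # ys')" "\<And>b. b \<in> set (xs' @ a # ys') \<Longrightarrow> a \<le> b"
        using w'(1) w True nf min by (metis list.sel(1), simp, simp)
      from rotinf_rotation[OF this(2,3,1)] have "stdword Q = a # ys' @ xs'"
        using w' True stdword_heapcl by simp
      moreover have "xs' @ b # ys' \<le> (b # ys') @ xs'" using lyn w' by (intro lyn_rotation_le) simp
      ultimately show ?thesis using w' True by simp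
    next
      case False
      have "conn (set (xs' @ b # ys'))" using conn_pyramid[OF bz] w w' by simp
      then obtain r where r: "Q = heapcl E (b # r)" "beside_part E {b} r = []"
        using rotinf_conn[of xs' b ys'] w' by auto
      obtain v where "stdword Q = b # v" using nform_pyramid[OF r(2)] r(1) stdword_nform by auto
      moreover have "a < b" using False min[of b] w'(1) by simp
      ultimately show ?thesis using w by simp
    qed
    then show ?thesis using stdword_heapcl[OF nf] by (auto simp: lexless_def list_le_def list_less_def)
  qed
  ultimately show ?thesis unfolding lyndon_heap_def by blast
qed

lemma lyn_if_lyndon_heap:
  assumes "lyndon_heap V E L"
  shows "\<exists>w. set w \<subseteq> V \<and> nf E w \<and> lyn w \<and> L = heapcl E w"
proof -
  obtain w0 where w0: "L = heapcl E w0" "set w0 \<subseteq> V"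
    using assms by (auto simp: lyndon_heap_def heaps_def)
  define p where "p = nform w0"
  have L: "L = heapcl E p" unfolding w0 p_def heapcl_eq_iff by (rule nform)
  have p: "nf E p" "set p \<subseteq> V" using w0 by (simp_all add: p_def nform)
  have std: "stdword L = p" unfolding L using p(1) by (rule stdword_heapcl)
  have least: "p \<le> stdword (rotinf E p (length xs))" if "p = xs @ a # ys" for xs a ys
  proof -
    have "rotinf E p (length xs) \<in> rclass E L"
      unfolding rclass_def L heapcl_teq using that by force
    then show ?thesis using assms std by (auto simp: lyndon_heap_def lexless_def list_le_def list_less_def)
  qed
  have pyr: "\<exists>!b. front E b p" using assms unfolding lyndon_heap_def L pyramid_iff by blast
  then have "p \<noteq> []" by auto
  then obtain c z where cz: "p = c # z" by (cases p) auto
  have conn: "conn (set p)" using pyr unfolding cz unique_front_iff by (rule conn_pyramid)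
  \<comment> \<open>The standard word \<open>p\<close> must start with its least letter
    \<open>a\<close>: rotating at an occurrence of \<open>a\<close> gives a standard word that
    starts with \<open>a\<close> and is not below \<open>p\<close>.\<close>
  define a where "a = Min (set p)"
  have min: "a \<le> b" if "b \<in> set p" for b using that by (simp add: a_def)
  have "a \<in> set p" unfolding a_def using \<open>p \<noteq> []\<close> by (intro Min_in) auto
  then obtain xs ys where xy: "p = xs @ a # ys" by (meson split_list)
  obtain r where r: "rotinf E p (length xs) = heapcl E (a # r)" "beside_part E {a} r = []"
    using rotinf_conn[of xs a ys] conn xy by auto
  obtain v where "stdword (rotinf E p (length xs)) = a # v"
    using nform_pyramid[OF r(2)] r(1) stdword_nform by auto
  then have "c # z \<le> a # v" using least[OF xy] cz by simp
  then have ca: "c = a" using min[of c] cz by auto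
  have "lyn p"
  proof (rule lyn_if_least_rotation)
    show "p \<noteq> []" by fact
    show "p \<noteq> concat (replicate m k)" if "1 < m" for m k
      using assms that unfolding lyndon_heap_def L periodic_def by blast
    fix u v assume uv: "p = u @ v" "u \<noteq> []" "v \<noteq> []"
    then obtain b v' where v': "v = b # v'" by (cases v) auto
    show "p \<le> v @ u"
    proof (cases "b = a")
      case True
      have e: "p = u @ a # v'" using uv v' True by simp
      have "hd (u @ a # v') = a" "nf E (u @ a # v')" "\<And>b. b \<in> set (u @ a # v') \<Longrightarrow> a \<le> b"
        using e cz ca p min by (metis list.sel(1), simp, simp)
      from rotinf_rotation[OF this(2,3,1)] have "stdword (rotinf E p (length u)) = a # v' @ u"
        using e stdword_heapcl by simp
      then show ?thesis using least[OF e] v' True by simp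
    next
      case False
      then have "a < b" using min[of b] uv v' by simp
      then show ?thesis using cz ca v' by simp
    qed
  qed
  then show ?thesis using p L by blast
qed

theorem lyndon_heaps_eq: "{L. lyndon_heap V E L} = heapcl E ` lynwords E V"
proof
  show "{L. lyndon_heap V E L} \<subseteq> heapcl E ` lynwords E V"
  proof
    fix L assume "L \<in> {L. lyndon_heap V E L}"
    then obtain w where "set w \<subseteq> V" "nf E w" "lyn w" "L = heapcl E w"
      using lyn_if_lyndon_heap by blast
    then show "L \<in> heapcl E ` lynwords E V" by (simp add: lynwords_def)
  qed
  show "heapcl E ` lynwords E V \<subseteq> {L. lyndon_heap V E L}"
    using lyndon_heap_if_lyn by (auto simp: lynwords_def)
qed

lemma inj_on_heapcl: "inj_on (heapcl E) (lynwords E V)"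
  by (rule inj_on_inverseI[of _ stdword]) (simp add: lynwords_def stdword_heapcl)

end

lemma some_in_heapcl: "teq E w (SOME v. v \<in> heapcl E w)"
  using someI[of "\<lambda>v. v \<in> heapcl E w" w] by (simp add: heapcl_teq)

lemma hsize_heapcl: "hsize (heapcl E w) = length w"
  unfolding hsize_def using teq_length[OF some_in_heapcl] .

lemma used_heapcl: "used (heapcl E w) = set w"
  unfolding used_def using teq_set[OF some_in_heapcl] .

subsection \<open>Power sums and the involution\<close>

text \<open>\<open>sps_times\<close> sums over this set; over an infinite set the sum would default
  to 0.\<close>

lemma finite_divisors: "finite {a. \<forall>i. Poly_Mapping.lookup a i \<le> Poly_Mapping.lookup (m :: mon) i}"
proof -
  let ?K = "Poly_Mapping.keys m"
  have "inj_on (\<lambda>a. restrict (Poly_Mapping.lookup a) ?K) {a. \<forall>i. Poly_Mapping.lookup a i \<le> Poly_Mapping.lookup m i}"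
  proof (rule inj_onI)
    fix a b assume ab: "a \<in> {a. \<forall>i. Poly_Mapping.lookup a i \<le> Poly_Mapping.lookup m i}"
      "b \<in> {a. \<forall>i. Poly_Mapping.lookup a i \<le> Poly_Mapping.lookup m i}"
      and e: "restrict (Poly_Mapping.lookup a) ?K = restrict (Poly_Mapping.lookup b) ?K"
    show "a = b"
    proof (rule poly_mapping_eqI)
      fix i
      show "Poly_Mapping.lookup a i = Poly_Mapping.lookup b i"
      proof (cases "i \<in> ?K")
        case True
        then show ?thesis using fun_cong[OF e, of i] by simp
      next
        case False
        then have "Poly_Mapping.lookup m i = 0" by (simp add: in_keys_iff)
        moreover have "Poly_Mapping.lookup a i \<le> Poly_Mapping.lookup m i"
          "Poly_Mapping.lookup b i \<le> Poly_Mapping.lookup m i" using ab by auto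
        ultimately show ?thesis by simp
      qed
    qed
  qed
  moreover have "(\<lambda>a. restrict (Poly_Mapping.lookup a) ?K) ` {a. \<forall>i. Poly_Mapping.lookup a i \<le> Poly_Mapping.lookup m i}
      \<subseteq> (\<Pi>\<^sub>E i\<in>?K. {..Poly_Mapping.lookup m i})"
    by (auto simp: PiE_iff)
  moreover have "finite (\<Pi>\<^sub>E i\<in>?K. {..Poly_Mapping.lookup m i})"
    by (intro finite_PiE) auto
  ultimately show ?thesis using inj_on_finite by blast
qed

lemma deg_superset: "finite A \<Longrightarrow> Poly_Mapping.keys m \<subseteq> A \<Longrightarrow> deg m = (\<Sum>i\<in>A. Poly_Mapping.lookup m i)"
  unfolding deg_def by (rule sum.mono_neutral_left) (auto simp: in_keys_iff)

lemma deg_add: "deg (a + b) = deg a + deg b"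
proof -
  let ?A = "Poly_Mapping.keys a \<union> Poly_Mapping.keys b"
  have "deg (a + b) = (\<Sum>i\<in>?A. Poly_Mapping.lookup (a + b) i)"
    by (rule deg_superset) (simp_all add: Poly_Mapping.keys_add)
  also have "\<dots> = (\<Sum>i\<in>?A. Poly_Mapping.lookup a i) + (\<Sum>i\<in>?A. Poly_Mapping.lookup b i)"
    by (simp add: lookup_add sum.distrib)
  also have "\<dots> = deg a + deg b" by (simp add: deg_superset[of ?A])
  finally show ?thesis .
qed

lemma deg_single [simp]: "deg (Poly_Mapping.single i k) = k"
  by (simp add: deg_superset[of "{i}"])

lemma deg_eq_0_iff: "deg m = 0 \<longleftrightarrow> m = 0"
  by (auto simp: deg_def in_keys_iff intro!: poly_mapping_eqI)

lemma divisor_add: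
  assumes "\<forall>i. Poly_Mapping.lookup a i \<le> Poly_Mapping.lookup m i"
  shows "a + (m - a) = (m :: mon)"
  using assms by (intro poly_mapping_eqI) (simp add: lookup_add lookup_minus)

lemma deg_minus_single:
  assumes "k \<le> Poly_Mapping.lookup m i"
  shows "deg m = k + deg (m - Poly_Mapping.single i k)"
proof -
  have "Poly_Mapping.single i k + (m - Poly_Mapping.single i k) = m"
    using assms by (intro divisor_add) (simp add: lookup_single when_def)
  then show ?thesis by (metis deg_add deg_single)
qed

text \<open>The only divisors that contribute are the powers \<open>x_i^k\<close>, which for
  positive \<open>k\<close> are distinct for distinct \<open>i\<close>.\<close>

lemma psum_times:
  assumes k: "0 < k"
  shows "sps_times (psum k) F m
    = (\<Sum>i\<in>{i. k \<le> Poly_Mapping.lookup m i}. F (m - Poly_Mapping.single i k))"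
proof -
  let ?D = "{a. \<forall>i. Poly_Mapping.lookup a i \<le> Poly_Mapping.lookup m i}"
  let ?I = "{i. k \<le> Poly_Mapping.lookup m i}"
  have inj: "inj_on (\<lambda>i. Poly_Mapping.single i k) ?I"
    using k by (auto intro!: inj_onI dest!: arg_cong[of _ _ Poly_Mapping.keys])
  have sub: "(\<lambda>i. Poly_Mapping.single i k) ` ?I \<subseteq> ?D" by (auto simp: lookup_single when_def)
  have "sps_times (psum k) F m
      = (\<Sum>a\<in>(\<lambda>i. Poly_Mapping.single i k) ` ?I. psum k a * F (m - a))"
    unfolding sps_times_def
  proof (rule sum.mono_neutral_right)
    show "\<forall>a\<in>?D - (\<lambda>i. Poly_Mapping.single i k) ` ?I. psum k a * F (m - a) = 0"
    proof
      fix a assume a: "a \<in> ?D - (\<lambda>i. Poly_Mapping.single i k) ` ?I"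
      have "\<nexists>i. a = Poly_Mapping.single i k"
      proof
        assume "\<exists>i. a = Poly_Mapping.single i k"
        then obtain i where i: "a = Poly_Mapping.single i k" by blast
        then have "Poly_Mapping.lookup a i \<le> Poly_Mapping.lookup m i" using a by blast
        then show False using a i by auto
      qed
      then show "psum k a * F (m - a) = 0" by (simp add: psum_def)
    qed
  qed (use finite_divisors sub in auto)
  also have "\<dots> = (\<Sum>i\<in>?I. F (m - Poly_Mapping.single i k))"
    by (subst sum.reindex[OF inj]) (auto simp: psum_def intro!: sum.cong)
  finally show ?thesis .
qed

lemma finite_lookup_ge: "0 < k \<Longrightarrow> finite {i. k \<le> Poly_Mapping.lookup (m :: mon) i}"
  by (rule finite_subset[of _ "Poly_Mapping.keys m"]) (auto simp: in_keys_iff)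

lemma pl_Nil: "pl [] m = (if m = 0 then 1 else 0)"
  by (simp add: pl_def sps_prod_def sps_one_def)

lemma pl_Cons: "pl (k # la) = sps_times (psum k) (pl la)"
  by (simp add: pl_def sps_prod_def)

lemma pl_nonneg: "(\<forall>k\<in>set la. 0 < k) \<Longrightarrow> 0 \<le> pl la m"
  by (induction la arbitrary: m) (auto simp: pl_Nil pl_Cons psum_times intro: sum_nonneg)

lemma pl_Cons_nonzero:
  assumes "\<forall>j\<in>set (k # la). 0 < j" "pl (k # la) m \<noteq> 0"
  shows "\<exists>i. k \<le> Poly_Mapping.lookup m i \<and> pl la (m - Poly_Mapping.single i k) \<noteq> 0"
proof (rule ccontr)
  assume "\<not> ?thesis"
  then have "(\<Sum>i\<in>{i. k \<le> Poly_Mapping.lookup m i}. pl la (m - Poly_Mapping.single i k)) = 0"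
    by (intro sum.neutral) blast
  then show False using assms by (simp add: pl_Cons psum_times)
qed

lemma psum_times_commute:
  assumes "0 < a" "0 < b"
  shows "sps_times (psum a) (sps_times (psum b) F) = sps_times (psum b) (sps_times (psum a) F)"
proof
  fix m :: mon
  have *: "sps_times (psum a) (sps_times (psum b) F) m
      = (\<Sum>(i, j)\<in>{(i, j). a \<le> Poly_Mapping.lookup m i \<and> b \<le> Poly_Mapping.lookup (m - Poly_Mapping.single i a) j}.
          F (m - Poly_Mapping.single i a - Poly_Mapping.single j b))"
    if "0 < a" "0 < b" for a b
  proof -
    have "{(i, j). a \<le> Poly_Mapping.lookup m i \<and> b \<le> Poly_Mapping.lookup (m - Poly_Mapping.single i a) j}
      = (SIGMA i:{i. a \<le> Poly_Mapping.lookup m i}. {j. b \<le> Poly_Mapping.lookup (m - Poly_Mapping.single i a) j})"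
      by auto
    then show ?thesis using that by (simp add: psum_times sum.Sigma finite_lookup_ge)
  qed
  show "sps_times (psum a) (sps_times (psum b) F) m = sps_times (psum b) (sps_times (psum a) F) m"
    unfolding *[OF assms] *[OF assms(2,1)]
  proof (rule sum.reindex_bij_witness[of _ prod.swap prod.swap])
    fix x assume x: "x \<in> {(i, j). a \<le> Poly_Mapping.lookup m i \<and> b \<le> Poly_Mapping.lookup (m - Poly_Mapping.single i a) j}"
    then show "prod.swap x \<in> {(i, j). b \<le> Poly_Mapping.lookup m i \<and> a \<le> Poly_Mapping.lookup (m - Poly_Mapping.single i b) j}"
      by (cases x) (auto simp: lookup_minus lookup_single when_def split: if_splits)
    show "(case prod.swap x of (i, j) \<Rightarrow> F (m - Poly_Mapping.single i b - Poly_Mapping.single j a)) =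
      (case x of (i, j) \<Rightarrow> F (m - Poly_Mapping.single i a - Poly_Mapping.single j b))"
      by (cases x) (simp add: diff_diff_add add.commute)
  next
    fix x assume x: "x \<in> {(i, j). b \<le> Poly_Mapping.lookup m i \<and> a \<le> Poly_Mapping.lookup (m - Poly_Mapping.single i b) j}"
    then show "prod.swap x \<in> {(i, j). a \<le> Poly_Mapping.lookup m i \<and> b \<le> Poly_Mapping.lookup (m - Poly_Mapping.single i a) j}"
      by (cases x) (auto simp: lookup_minus lookup_single when_def split: if_splits)
  qed auto
qed

lemma pl_insort: "(\<forall>j\<in>set (k # la). 0 < j) \<Longrightarrow> pl (insort_key f k la) = pl (k # la)"
proof (induction la)
  case (Cons a la)
  have "pl (a # k # la) = pl (k # a # la)"
    unfolding pl_Cons using Cons.prems by (intro psum_times_commute) auto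
  moreover have "pl (a # insort_key f k la) = pl (a # k # la)"
    unfolding pl_Cons[of a] using Cons by simp
  ultimately show ?case by simp
qed simp

lemma pl_sort: "(\<forall>j\<in>set la. 0 < j) \<Longrightarrow> pl (sort_key f la) = pl la"
proof (induction la)
  case (Cons a la)
  have "pl (sort_key f (a # la)) = pl (a # sort_key f la)"
    unfolding sort_key_simps using Cons.prems by (intro pl_insort) simp
  also have "\<dots> = pl (a # la)" using Cons by (simp add: pl_Cons)
  finally show ?case .
qed simp

definition psort :: "nat list \<Rightarrow> nat list" where
  "psort la = sort_key (\<lambda>k. - int k) la"

lemma mset_psort [simp]: "mset (psort la) = mset la"
  by (simp add: psort_def)

lemma set_psort [simp]: "set (psort la) = set la"
  and length_psort [simp]: "length (psort la) = length la"
  and sum_list_psort [simp]: "sum_list (psort la) = sum_list la"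
  by (metis mset_psort set_mset_mset, metis mset_psort size_mset, metis mset_psort sum_mset_sum_list)

lemma sorted_psort: "sorted_wrt (\<ge>) (psort la)"
proof -
  have "sorted (map (\<lambda>k. - int k) (psort la))" unfolding psort_def by (rule sorted_sort_key)
  then show ?thesis by (simp add: sorted_wrt_map)
qed

lemma psort_partition: "\<forall>k\<in>set la. 0 < k \<Longrightarrow> psort la \<in> partitions (sum_list la)"
  by (simp add: partitions_def is_partition_def sorted_psort)

lemma desc_eqI:
  assumes "sorted_wrt (\<ge>) la" "sorted_wrt (\<ge>) mu" "mset la = mset mu"
  shows "la = (mu :: 'b::linorder list)"
proof -
  have "sorted (rev la)" "sorted (rev mu)" using assms by (simp_all add: sorted_wrt_rev)
  moreover have "mset (rev la) = mset (rev mu)" using assms by simp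
  ultimately have "rev la = rev mu" by (metis properties_for_sort)
  then show ?thesis by simp
qed

lemma finite_partitions: "finite (partitions n)"
proof (rule finite_subset)
  have "length la \<le> sum_list la" if "\<forall>k\<in>set la. 0 < k" for la :: "nat list"
    using that by (induction la) auto
  then show "partitions n \<subseteq> {la. set la \<subseteq> {..n} \<and> length la \<le> n}"
    by (auto simp: partitions_def is_partition_def intro: member_le_sum_list)
qed (simp add: finite_lists_length_le)

section \<open>Linear independence of the power sum products\<close>

definition exps :: "mon \<Rightarrow> nat multiset" where
  "exps m = image_mset (Poly_Mapping.lookup m) (mset_set (Poly_Mapping.keys m))"

lemma size_exps: "size (exps m) = card (Poly_Mapping.keys m)"
  by (simp add: exps_def)

lemma exps_add_single:
  assumes "i \<notin> Poly_Mapping.keys m" "0 < k"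
  shows "exps (m + Poly_Mapping.single i k) = add_mset k (exps m)"
proof -
  have keys: "Poly_Mapping.keys (m + Poly_Mapping.single i k) = insert i (Poly_Mapping.keys m)"
    using assms by (auto simp: in_keys_iff lookup_add lookup_single when_def split: if_splits)
  have "image_mset (Poly_Mapping.lookup (m + Poly_Mapping.single i k)) (mset_set (Poly_Mapping.keys m))
      = image_mset (Poly_Mapping.lookup m) (mset_set (Poly_Mapping.keys m))"
    using assms by (intro image_mset_cong) (auto simp: lookup_add lookup_single when_def)
  moreover have "Poly_Mapping.lookup m i = 0" using assms by (simp add: in_keys_iff)
  ultimately show ?thesis unfolding exps_def keys using assms by (simp add: lookup_add)
qed

text \<open>The exponents of a monomial of \<open>pl la\<close> are obtained by merging parts of \<open>la\<close>; this makes the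
  products triangular with respect to the number of parts.\<close>

lemma pl_triangular:
  assumes "\<forall>k\<in>set la. 0 < k" "pl la m \<noteq> 0"
  shows "size (exps m) \<le> length la \<and> (size (exps m) = length la \<longrightarrow> exps m = mset la)"
  using assms
proof (induction la arbitrary: m)
  case Nil
  then show ?case by (simp add: pl_Nil exps_def split: if_splits)
next
  case (Cons k la)
  then obtain i where i: "k \<le> Poly_Mapping.lookup m i" "pl la (m - Poly_Mapping.single i k) \<noteq> 0"
    using pl_Cons_nonzero by blast
  let ?m = "m - Poly_Mapping.single i k"
  have IH: "size (exps ?m) \<le> length la" "size (exps ?m) = length la \<Longrightarrow> exps ?m = mset la"
    using Cons.IH[of ?m] Cons.prems i by auto
  have m: "m = ?m + Poly_Mapping.single i k"
    using i(1) by (intro poly_mapping_eqI) (auto simp: lookup_add lookup_minus lookup_single when_def)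
  show ?case
  proof (cases "i \<in> Poly_Mapping.keys ?m")
    case True
    have "Poly_Mapping.keys m \<subseteq> insert i (Poly_Mapping.keys ?m)"
      by (auto simp: in_keys_iff lookup_minus lookup_single when_def split: if_splits)
    then have "card (Poly_Mapping.keys m) \<le> card (Poly_Mapping.keys ?m)"
      using True by (intro card_mono) auto
    then show ?thesis using IH by (simp add: size_exps)
  next
    case False
    then have "exps m = add_mset k (exps ?m)"
      using exps_add_single[of i ?m k] m Cons.prems by simp
    then show ?thesis using IH by simp
  qed
qed

text \<open>Give every part a variable of its own; all contributions are nonnegative, so this one is
  not cancelled.\<close>

lemma pl_diagonal:
  assumes "\<forall>k\<in>set la. 0 < k" shows "\<exists>m. exps m = mset la \<and> pl la m \<noteq> 0"
  using assms
proof (induction la)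
  case Nil
  show ?case by (intro exI[of _ 0]) (simp add: exps_def pl_Nil)
next
  case (Cons k la)
  then obtain m where m: "exps m = mset la" "pl la m \<noteq> 0" by auto
  obtain i where i: "i \<notin> Poly_Mapping.keys m" using ex_new_if_finite[OF infinite_UNIV_nat finite_keys] by blast
  let ?m = "m + Poly_Mapping.single i k"
  have k: "0 < k" using Cons.prems by simp
  have "pl la m \<le> pl (k # la) ?m"
  proof -
    have "pl la (?m - Poly_Mapping.single i k) \<le> (\<Sum>j\<in>{j. k \<le> Poly_Mapping.lookup ?m j}. pl la (?m - Poly_Mapping.single j k))"
    proof (rule member_le_sum)
      show "i \<in> {j. k \<le> Poly_Mapping.lookup ?m j}" by (simp add: lookup_add)
      show "finite {j. k \<le> Poly_Mapping.lookup ?m j}" using k by (rule finite_lookup_ge)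
    qed (use Cons.prems pl_nonneg in simp)
    then show ?thesis using k by (simp add: pl_Cons psum_times)
  qed
  moreover have "0 < pl la m" using m(2) pl_nonneg[of la m] Cons.prems by simp
  ultimately show ?case using exps_add_single[OF i k] m by (intro exI[of _ ?m]) auto
qed

text \<open>Take \<open>mu\<close> of maximal length among the partitions with nonzero coefficient.
  By triangularity, at a monomial with exponents \<open>mu\<close> no other product with nonzero
  coefficient survives.\<close>

lemma pl_independent:
  assumes "\<And>m. (\<Sum>la\<in>partitions n. c la * pl la m) = 0" "la \<in> partitions n"
  shows "c la = 0"
proof (rule ccontr)
  assume "c la \<noteq> 0"
  let ?S = "{la \<in> partitions n. c la \<noteq> 0}"
  have fin: "finite ?S" using finite_partitions by simp
  moreover have "?S \<noteq> {}" using assms(2) \<open>c la \<noteq> 0\<close> by blast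
  ultimately obtain mu where mu: "mu \<in> ?S" and max: "\<And>la. la \<in> ?S \<Longrightarrow> length la \<le> length mu"
    using finite_imageI[of ?S length] Max_in[of "length ` ?S"] Max_ge[of "length ` ?S"]
    by (smt (verit, ccfv_SIG) image_iff image_is_empty)
  have posp: "\<forall>k\<in>set la. 0 < k" if "la \<in> partitions n" for la using that by (simp add: partitions_def is_partition_def)
  have mun: "mu \<in> partitions n" using mu by simp
  obtain m where m: "exps m = mset mu" "pl mu m \<noteq> 0" using pl_diagonal[OF posp[OF mun]] by blast
  have "c la * pl la m = 0" if "la \<in> partitions n - {mu}" for la
  proof (rule ccontr)
    assume n: "c la * pl la m \<noteq> 0"
    then have "length la \<le> length mu" using max[of la] that by auto
    then have "exps m = mset la"
      using pl_triangular[of la m] posp[of la] that n m(1) by auto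
    then have "la = mu" using desc_eqI[of la mu] that mun m(1) by (simp add: partitions_def is_partition_def)
    then show False using that by simp
  qed
  then have "(\<Sum>la\<in>partitions n - {mu}. c la * pl la m) = 0" by (intro sum.neutral ballI)
  then have "(\<Sum>la\<in>partitions n. c la * pl la m) = c mu * pl mu m"
    using finite_partitions[of n] mun by (simp add: sum.remove[of _ mu])
  then show False using assms(1)[of m] mu m(2) by simp
qed

text \<open>\<open>f\<close> is a combination of power sum products of degree \<open>n\<close>, and
  \<open>g\<close> is its image under the involution. The relation postpones the description in
  \<open>pcoeff\<close> to one evaluation in \<open>omega_eqI\<close>. The lists \<open>la\<close>
  are left unsorted so that a part can be put in front.\<close>

inductive omega_pair :: "nat \<Rightarrow> sps \<Rightarrow> sps \<Rightarrow> bool" where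
  omega_pair_pl: "\<forall>k\<in>set la. 0 < k \<Longrightarrow> sum_list la = n \<Longrightarrow>
    omega_pair n (pl la) (\<lambda>m. (-1) ^ (n - length la) * pl la m)"
| omega_pair_zero: "omega_pair n (\<lambda>_. 0) (\<lambda>_. 0)"
| omega_pair_add: "omega_pair n f g \<Longrightarrow> omega_pair n f' g' \<Longrightarrow> omega_pair n (\<lambda>m. f m + f' m) (\<lambda>m. g m + g' m)"
| omega_pair_scale: "omega_pair n f g \<Longrightarrow> omega_pair n (\<lambda>m. c * f m) (\<lambda>m. c * g m)"

lemma omega_pair_sum:
  "finite A \<Longrightarrow> (\<And>x. x \<in> A \<Longrightarrow> omega_pair n (f x) (g x)) \<Longrightarrow> omega_pair n (\<lambda>m. \<Sum>x\<in>A. f x m) (\<lambda>m. \<Sum>x\<in>A. g x m)"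
  by (induction A rule: finite_induct) (auto intro: omega_pair_zero omega_pair_add)

lemma length_le_sum_list: "\<forall>k\<in>set la. 0 < k \<Longrightarrow> length la \<le> sum_list (la :: nat list)"
  by (induction la) auto

text \<open>A new part \<open>k\<close> raises the degree by \<open>k\<close> and the number of
  parts by one, which changes the sign by \<open>(-1)^(k-1)\<close>.\<close>

lemma omega_pair_psum_times:
  assumes "omega_pair n f g" "0 < k"
  shows "omega_pair (k + n) (sps_times (psum k) f) (\<lambda>m. (-1) ^ (k - 1) * sps_times (psum k) g m)"
  using assms
proof (induction rule: omega_pair.induct)
  case (omega_pair_pl la n)
  have "length la \<le> n" using length_le_sum_list[of la] omega_pair_pl by simp
  then have e: "(k - 1) + (n - length la) = k + n - length (k # la)" using omega_pair_pl by simp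
  have "omega_pair (k + n) (pl (k # la)) (\<lambda>m. (-1) ^ (k + n - length (k # la)) * pl (k # la) m)"
    using omega_pair_pl by (intro omega_pair.omega_pair_pl) auto
  moreover have "(-1) ^ (k - 1) * sps_times (psum k) (\<lambda>m. (-1) ^ (n - length la) * pl la m) m
      = (-1) ^ (k + n - length (k # la)) * pl (k # la) m" for m
    unfolding e[symmetric] power_add pl_Cons using omega_pair_pl
    by (simp add: psum_times sum_distrib_left mult.assoc)
  ultimately show ?case by (simp add: pl_Cons)
next
  case (omega_pair_zero n)
  have "sps_times (psum k) (\<lambda>_. 0) = (\<lambda>_. 0)" by (auto simp: sps_times_def)
  then show ?case using omega_pair.omega_pair_zero[of "k + n"] by simp
next
  case (omega_pair_add n f g f' g')
  then have "omega_pair (k + n) (\<lambda>m. sps_times (psum k) f m + sps_times (psum k) f' m)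
     (\<lambda>m. (-1) ^ (k - 1) * sps_times (psum k) g m + (-1) ^ (k - 1) * sps_times (psum k) g' m)"
    by (intro omega_pair.omega_pair_add) auto
  moreover have "sps_times (psum k) (\<lambda>m. f m + f' m) m = sps_times (psum k) f m + sps_times (psum k) f' m" for f f' m
    by (simp add: sps_times_def algebra_simps sum.distrib)
  ultimately show ?case by (simp add: algebra_simps)
next
  case (omega_pair_scale n f g c)
  then have "omega_pair (k + n) (\<lambda>m. c * sps_times (psum k) f m)
     (\<lambda>m. c * ((-1) ^ (k - 1) * sps_times (psum k) g m))"
    by (intro omega_pair.omega_pair_scale) auto
  moreover have "sps_times (psum k) (\<lambda>m. c * f m) m = c * sps_times (psum k) f m" for f m
    by (simp add: sps_times_def algebra_simps sum_distrib_left)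
  ultimately show ?case by (simp add: mult.left_commute)
qed

lemma omega_pair_expansion:
  assumes "omega_pair n f g"
  shows "\<exists>c. (\<forall>m. f m = (\<Sum>la\<in>partitions n. c la * pl la m)) \<and>
    (\<forall>m. g m = (\<Sum>la\<in>partitions n. (-1) ^ (n - length la) * c la * pl la m))"
  using assms
proof (induction rule: omega_pair.induct)
  case (omega_pair_pl la n)
  let ?c = "\<lambda>mu. if mu = psort la then 1 else 0 :: rat"
  have "psort la \<in> partitions n" using psort_partition[of la] omega_pair_pl by simp
  moreover have "pl (psort la) = pl la" unfolding psort_def using omega_pair_pl by (intro pl_sort)
  ultimately have "pl la m = (\<Sum>mu\<in>partitions n. ?c mu * pl mu m)"
    "(-1) ^ (n - length la) * pl la m = (\<Sum>mu\<in>partitions n. (-1) ^ (n - length mu) * ?c mu * pl mu m)" for m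
    using finite_partitions[of n]
    by (simp_all add: sum.remove[of _ "psort la"])
  then show ?case by (intro exI[of _ ?c]) blast
next
  case (omega_pair_zero n)
  show ?case by (intro exI[of _ "\<lambda>_. 0"]) simp
next
  case (omega_pair_add n f g f' g')
  then obtain c c' where "\<forall>m. f m = (\<Sum>la\<in>partitions n. c la * pl la m)"
    "\<forall>m. g m = (\<Sum>la\<in>partitions n. (-1) ^ (n - length la) * c la * pl la m)"
    "\<forall>m. f' m = (\<Sum>la\<in>partitions n. c' la * pl la m)"
    "\<forall>m. g' m = (\<Sum>la\<in>partitions n. (-1) ^ (n - length la) * c' la * pl la m)" by blast
  then show ?case by (intro exI[of _ "\<lambda>la. c la + c' la"]) (simp add: algebra_simps sum.distrib)
next
  case (omega_pair_scale n f g d)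
  then obtain c where "\<forall>m. f m = (\<Sum>la\<in>partitions n. c la * pl la m)"
    "\<forall>m. g m = (\<Sum>la\<in>partitions n. (-1) ^ (n - length la) * c la * pl la m)" by blast
  then show ?case by (intro exI[of _ "\<lambda>la. d * c la"]) (simp add: algebra_simps sum_distrib_left)
qed

text \<open>Independence fixes the coefficients on \<open>partitions n\<close>, and the value 0
  demanded elsewhere makes the coefficient function unique, so the description returns it.\<close>

lemma omega_eqI:
  assumes "omega_pair (deg m) (hom (deg m) f) g"
  shows "omega f m = g m"
proof -
  let ?n = "deg m"
  obtain c where c: "\<And>m. hom ?n f m = (\<Sum>la\<in>partitions ?n. c la * pl la m)"
    "\<And>m. g m = (\<Sum>la\<in>partitions ?n. (-1) ^ (?n - length la) * c la * pl la m)"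
    using omega_pair_expansion[OF assms] by blast
  have "pcoeff f ?n = (\<lambda>la. if la \<in> partitions ?n then c la else 0)"
    unfolding pcoeff_def
  proof (rule the_equality)
    show "(\<forall>la. la \<notin> partitions ?n \<longrightarrow> (if la \<in> partitions ?n then c la else 0) = 0) \<and>
      hom ?n f = (\<lambda>m. \<Sum>la\<in>partitions ?n. (if la \<in> partitions ?n then c la else 0) * pl la m)"
      using c(1) by (auto intro!: ext sum.cong)
  next
    fix d assume d: "(\<forall>la. la \<notin> partitions ?n \<longrightarrow> d la = 0) \<and>
      hom ?n f = (\<lambda>m. \<Sum>la\<in>partitions ?n. d la * pl la m)"
    have "(\<Sum>la\<in>partitions ?n. (d la - c la) * pl la m) = 0" for m
      using d c(1)[of m] by (simp add: algebra_simps sum_subtractf)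
    then have "d la - c la = 0" if "la \<in> partitions ?n" for la
      using pl_independent[where c = "\<lambda>la. d la - c la"] that by blast
    then show "d = (\<lambda>la. if la \<in> partitions ?n then c la else 0)" using d by auto
  qed
  then show ?thesis unfolding omega_def c(2) by (auto intro!: sum.cong)
qed

subsection \<open>Expansion of the set chromatic series\<close>

text \<open>The product over all variables of the series with coefficients \<open>f\<close>. For
  \<open>f 0 = 1\<close> the variables not in \<open>m\<close> contribute 1, so a product over
  \<open>keys\<close> suffices.\<close>

definition mult_sps :: "(nat \<Rightarrow> rat) \<Rightarrow> sps" where
  "mult_sps f m = (\<Prod>i\<in>Poly_Mapping.keys m. f (Poly_Mapping.lookup m i))"

lemma mult_sps_superset:
  assumes "f 0 = 1" "finite A" "Poly_Mapping.keys m \<subseteq> A"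
  shows "mult_sps f m = (\<Prod>i\<in>A. f (Poly_Mapping.lookup m i))"
  unfolding mult_sps_def using assms by (intro prod.mono_neutral_left) (auto simp: in_keys_iff)

text \<open>Multiplication by \<open>deg m\<close> is Euler's operator, applied one exponent at a
  time. In the variable \<open>x_i\<close>, \<open>rec\<close> trades the exponent for a sum over
  removed powers \<open>x_i^j\<close>; collecting equal \<open>j\<close> over all variables produces
  \<open>psum j\<close>.\<close>

lemma mult_sps_newton:
  assumes f0: "f 0 = 1" and rec: "\<And>n. of_nat n * f n = (\<Sum>j=1..n. c j * f (n - j))"
  shows "of_nat (deg m) * mult_sps f m = (\<Sum>j=1..deg m. c j * sps_times (psum j) (mult_sps f) m)"
proof -
  let ?K = "Poly_Mapping.keys m" let ?l = "Poly_Mapping.lookup m" let ?F = "mult_sps f"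
  have le: "?l i \<le> deg m" for i
    unfolding deg_def by (cases "i \<in> ?K") (auto intro: member_le_sum simp: in_keys_iff)
  have step: "of_nat (?l i) * ?F m = (\<Sum>j\<in>{j \<in> {1..deg m}. j \<le> ?l i}. c j * ?F (m - Poly_Mapping.single i j))"
    if i: "i \<in> ?K" for i
  proof -
    have F: "?F (m - Poly_Mapping.single i j) = f (?l i - j) * (\<Prod>i'\<in>?K - {i}. f (?l i'))" for j
    proof -
      have "?F (m - Poly_Mapping.single i j) = (\<Prod>i'\<in>?K. f (Poly_Mapping.lookup (m - Poly_Mapping.single i j) i'))"
        using f0 by (intro mult_sps_superset) (auto simp: in_keys_iff lookup_minus)
      also have "\<dots> = f (?l i - j) * (\<Prod>i'\<in>?K - {i}. f (Poly_Mapping.lookup (m - Poly_Mapping.single i j) i'))"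
        using i by (simp add: prod.remove[of _ i] lookup_minus)
      also have "(\<Prod>i'\<in>?K - {i}. f (Poly_Mapping.lookup (m - Poly_Mapping.single i j) i')) = (\<Prod>i'\<in>?K - {i}. f (?l i'))"
        by (rule prod.cong) (auto simp: lookup_minus lookup_single)
      finally show ?thesis .
    qed
    have "of_nat (?l i) * ?F m = (of_nat (?l i) * f (?l i)) * (\<Prod>i'\<in>?K - {i}. f (?l i'))"
      unfolding mult_sps_def using i by (simp add: prod.remove[of _ i])
    also have "\<dots> = (\<Sum>j=1..?l i. c j * ?F (m - Poly_Mapping.single i j))"
      unfolding rec F by (simp add: sum_distrib_right mult.assoc)
    also have "{1..?l i} = {j \<in> {1..deg m}. j \<le> ?l i}" using le[of i] by auto
    finally show ?thesis .
  qed
  have "of_nat (deg m) * ?F m = (\<Sum>i\<in>?K. of_nat (?l i) * ?F m)"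
    by (simp add: deg_def sum_distrib_right)
  also have "\<dots> = (\<Sum>i\<in>?K. \<Sum>j\<in>{j \<in> {1..deg m}. j \<le> ?l i}. c j * ?F (m - Poly_Mapping.single i j))"
    by (rule sum.cong) (simp_all only: step)
  also have "\<dots> = (\<Sum>j=1..deg m. \<Sum>i\<in>{i \<in> ?K. j \<le> ?l i}. c j * ?F (m - Poly_Mapping.single i j))"
    by (rule sum.swap_restrict) simp_all
  also have "\<dots> = (\<Sum>j=1..deg m. c j * sps_times (psum j) ?F m)"
  proof (rule sum.cong)
    fix j assume j: "j \<in> {1..deg m}"
    then have "{i \<in> ?K. j \<le> ?l i} = {i. j \<le> ?l i}" by (auto simp: in_keys_iff)
    then show "(\<Sum>i\<in>{i \<in> ?K. j \<le> ?l i}. c j * ?F (m - Poly_Mapping.single i j)) = c j * sps_times (psum j) ?F m"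
      using j by (simp add: psum_times sum_distrib_left)
  qed simp
  finally show ?thesis .
qed

lemma psum_times_hom:
  assumes "0 < j"
  shows "sps_times (psum j) (hom k F) m = (if deg m = j + k then sps_times (psum j) F m else 0)"
  using assms by (auto simp: psum_times hom_def deg_minus_single[of j m] intro!: sum.cong sum.neutral)

text \<open>Newton's recursion writes degree \<open>n\<close> through \<open>psum j\<close> times
  degree \<open>n - j\<close>. The sign \<open>(-1)^(j-1)\<close> that \<open>psum j\<close>
  acquires under the involution cancels the one in the recursion for \<open>f\<close>, leaving the
  recursion for \<open>g\<close>.\<close>

lemma omega_pair_mult_sps:
  assumes f0: "f 0 = 1" and g0: "g 0 = 1"
    and f: "\<And>n. of_nat n * f n = (\<Sum>j=1..n. (-1) ^ (j - 1) * c j * f (n - j))"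
    and g: "\<And>n. of_nat n * g n = (\<Sum>j=1..n. c j * g (n - j))"
  shows "omega_pair n (hom n (mult_sps f)) (hom n (mult_sps g))"
proof (induction n rule: less_induct)
  case (less n)
  show ?case
  proof (cases "n = 0")
    case True
    have "hom 0 (mult_sps h) = pl []" for h
      by (rule ext) (simp add: hom_def deg_eq_0_iff pl_Nil mult_sps_def)
    then show ?thesis using omega_pair_pl[of "[]" 0] True by simp
  next
    case False
    let ?d = "\<lambda>j. (-1) ^ (j - 1) * c j / of_nat n :: rat"
    have newton: "hom n (mult_sps h) m = (\<Sum>j=1..n. e j / of_nat n * sps_times (psum j) (hom (n - j) (mult_sps h)) m)"
      if "h 0 = 1" "\<And>n. of_nat n * h n = (\<Sum>j=1..n. e j * h (n - j))" for h e m
    proof (cases "deg m = n")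
      case True
      have "of_nat n * mult_sps h m = (\<Sum>j=1..n. e j * sps_times (psum j) (mult_sps h) m)"
        using mult_sps_newton[of h e m] that True by simp
      then have "mult_sps h m = (\<Sum>j=1..n. e j * sps_times (psum j) (mult_sps h) m) / of_nat n"
        using False by (simp add: field_simps)
      also have "\<dots> = (\<Sum>j=1..n. e j / of_nat n * sps_times (psum j) (mult_sps h) m)"
        by (simp add: sum_divide_distrib)
      also have "\<dots> = (\<Sum>j=1..n. e j / of_nat n * sps_times (psum j) (hom (n - j) (mult_sps h)) m)"
        using True by (intro sum.cong) (auto simp: psum_times_hom)
      finally show ?thesis using True by (simp add: hom_def)
    next
      case F: False
      then show ?thesis by (auto simp: hom_def psum_times_hom intro!: sum.neutral[symmetric])
    qed
    have "omega_pair n (\<lambda>m. \<Sum>j\<in>{1..n}. ?d j * sps_times (psum j) (hom (n - j) (mult_sps f)) m)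
        (\<lambda>m. \<Sum>j\<in>{1..n}. ?d j * ((-1) ^ (j - 1) * sps_times (psum j) (hom (n - j) (mult_sps g)) m))"
    proof (rule omega_pair_sum)
      fix j assume j: "j \<in> {1..n}"
      then have "omega_pair (j + (n - j)) (sps_times (psum j) (hom (n - j) (mult_sps f)))
          (\<lambda>m. (-1) ^ (j - 1) * sps_times (psum j) (hom (n - j) (mult_sps g)) m)"
        using less[of "n - j"] by (intro omega_pair_psum_times) auto
      then show "omega_pair n (\<lambda>m. ?d j * sps_times (psum j) (hom (n - j) (mult_sps f)) m)
          (\<lambda>m. ?d j * ((-1) ^ (j - 1) * sps_times (psum j) (hom (n - j) (mult_sps g)) m))"
        using j by (intro omega_pair_scale) simp
    qed simp
    moreover have "?d j * ((-1) ^ (j - 1) * x) = c j / of_nat n * x" for j x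
      by (simp add: power_mult_distrib[symmetric] flip: mult.assoc)
    ultimately have "omega_pair n (\<lambda>m. \<Sum>j\<in>{1..n}. ?d j * sps_times (psum j) (hom (n - j) (mult_sps f)) m)
        (\<lambda>m. \<Sum>j\<in>{1..n}. c j / of_nat n * sps_times (psum j) (hom (n - j) (mult_sps g)) m)"
      by (simp only:)
    moreover have "hom n (mult_sps f) = 
      (\<lambda>m. \<Sum>j\<in>{1..n}. ?d j * sps_times (psum j) (hom (n - j) (mult_sps f)) m)"
      using newton[of f "\<lambda>j. (-1) ^ (j - 1) * c j"] f0 f by (intro ext) auto
    moreover have "hom n (mult_sps g) = (\<lambda>m. \<Sum>j\<in>{1..n}. c j / of_nat n * sps_times (psum j) (hom (n - j) (mult_sps g)) m)"
      using newton[of g c] g0 g by (intro ext) auto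
    ultimately show ?thesis by simp
  qed
qed

text \<open>The coefficients are those of the logarithmic derivative of \<open>\<Sum>n. h n x^n\<close>.\<close>

lemma log_derivative_coefficients:
  fixes f h :: "nat \<Rightarrow> rat"
  assumes "\<And>n. (\<Sum>j\<le>n. (-1) ^ j * f j * h (n - j)) = (if n = 0 then 1 else 0)"
  shows "\<exists>c. (\<forall>n. of_nat n * f n = (\<Sum>j=1..n. (-1) ^ (j - 1) * c j * f (n - j))) \<and>
    (\<forall>n. of_nat n * h n = (\<Sum>j=1..n. c j * h (n - j)))"
proof -
  define F where "F = Abs_fps (\<lambda>n. (-1) ^ n * f n)"
  define H where "H = Abs_fps h"
  \<comment> \<open>Since \<open>F = 1 / H\<close>, this is \<open>X * H' / H\<close>. The
    logarithmic derivative of \<open>F\<close> is its negative, and substituting \<open>-x\<close>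
    to return to \<open>f\<close> gives the remaining signs.\<close>
  define C where "C = fps_X * fps_deriv H * F"
  have FH: "F * H = 1"
    using assms by (auto simp: fps_eq_iff fps_mult_nth F_def H_def atLeast0AtMost)
  have "fps_deriv (F * H) = 0" unfolding FH by simp
  then have d: "F * fps_deriv H = - (fps_deriv F * H)" by (simp add: eq_neg_iff_add_eq_0)
  have CH: "C * H = fps_X * fps_deriv H"
    unfolding C_def using FH by (simp add: mult.assoc)
  have "C * F = fps_X * (F * fps_deriv H) * F" unfolding C_def by (simp add: mult_ac)
  also have "\<dots> = - (fps_X * fps_deriv F * (F * H))" unfolding d by (simp add: mult_ac)
  finally have CF: "C * F = - (fps_X * fps_deriv F)" unfolding FH by simp
  have C0: "fps_nth C 0 = 0" by (simp add: C_def)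
  have conv: "fps_nth (C * G) n = (\<Sum>j=1..n. fps_nth C j * fps_nth G (n - j))" for G n
    using C0 by (simp add: fps_mult_nth sum.atLeast_Suc_atMost)
  have deriv: "fps_nth (fps_X * fps_deriv G) n = of_nat n * fps_nth G n" for G :: "rat fps" and n
    by (cases n) auto
  have "of_nat n * h n = (\<Sum>j=1..n. fps_nth C j * h (n - j))" for n
    using conv[of H n] deriv[of H n] unfolding CH by (simp add: H_def)
  moreover have "of_nat n * f n = (\<Sum>j=1..n. (-1) ^ (j - 1) * fps_nth C j * f (n - j))" for n
  proof -
    have "(\<Sum>j=1..n. fps_nth C j * ((-1) ^ (n - j) * f (n - j))) = - (of_nat n * ((-1) ^ n * f n))"
      using conv[of F n] deriv[of F n] unfolding CF by (simp add: F_def)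
    then have "of_nat n * f n = (- ((-1) ^ n)) * (\<Sum>j=1..n. fps_nth C j * ((-1) ^ (n - j) * f (n - j)))"
      by (simp add: mult.left_commute flip: power_add)
    also have "\<dots> = (\<Sum>j=1..n. (-1) ^ (j - 1) * fps_nth C j * f (n - j))"
      unfolding sum_distrib_left
    proof (rule sum.cong)
      fix j assume j: "j \<in> {1..n}"
      have "(- ((-1) ^ n)) * (-1) ^ (n - j) = ((-1) ^ (j - 1) :: rat)"
      proof -
        have "n + 1 + (n - j) = (j - 1) + 2 * (n + 1 - j)" using j by auto
        then have "(-1) ^ (n + 1 + (n - j)) = ((-1) ^ (j - 1) :: rat)"
          by (simp only: power_add power_mult) simp
        then show ?thesis by (simp add: power_add)
      qed
      then show "(- ((-1) ^ n)) * (fps_nth C j * ((-1) ^ (n - j) * f (n - j))) = (-1) ^ (j - 1) * fps_nth C j * f (n - j)"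
        by (metis mult.assoc mult.commute)
    qed simp
    finally show ?thesis .
  qed
  ultimately show ?thesis by blast
qed

text \<open>After exchanging the sums, each \<open>x\<close> carries the alternating sum over the
  sets \<open>W\<close> between \<open>u x\<close> and \<open>V\<close>, that is over the subsets of
  \<open>V - u x\<close>.\<close>

lemma inclusion_exclusion_cover:
  fixes \<phi> :: "'x \<Rightarrow> 'b::comm_ring_1"
  assumes "finite V" "finite X" "\<And>x. x \<in> X \<Longrightarrow> u x \<subseteq> V"
  shows "(\<Sum>x\<in>{x \<in> X. u x = V}. \<phi> x)
    = (\<Sum>W\<in>Pow V. (-1) ^ card (V - W) * (\<Sum>x\<in>{x \<in> X. u x \<subseteq> W}. \<phi> x))"
proof -
  have inner: "(\<Sum>W\<in>{W \<in> Pow V. u x \<subseteq> W}. (-1) ^ card (V - W)) = (if u x = V then 1 else 0 :: 'b)"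
    if x: "x \<in> X" for x
  proof -
    have "(\<Sum>W\<in>{W \<in> Pow V. u x \<subseteq> W}. (-1) ^ card (V - W)) = (\<Sum>S\<in>Pow (V - u x). (-1) ^ card S :: 'b)"
      using assms(3)[OF x]
      by (intro sum.reindex_bij_witness[of _ "\<lambda>S. V - S" "\<lambda>W. V - W"]) (auto simp: double_diff)
    also have "\<dots> = (if V - u x = {} then 1 else 0)"
      using assms(1) by (intro sum_Pow_alternating) simp
    also have "V - u x = {} \<longleftrightarrow> u x = V" using assms(3)[OF x] by blast
    finally show ?thesis .
  qed
  have "(\<Sum>W\<in>Pow V. (-1) ^ card (V - W) * (\<Sum>x\<in>{x \<in> X. u x \<subseteq> W}. \<phi> x))
      = (\<Sum>W\<in>Pow V. \<Sum>x\<in>{x \<in> X. u x \<subseteq> W}. (-1) ^ card (V - W) * \<phi> x)"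
    by (simp add: sum_distrib_left)
  also have "\<dots> = (\<Sum>x\<in>X. \<Sum>W\<in>{W \<in> Pow V. u x \<subseteq> W}. (-1) ^ card (V - W) * \<phi> x)"
    using assms by (intro sum.swap_restrict) simp_all
  also have "\<dots> = (\<Sum>x\<in>X. if u x = V then \<phi> x else 0)"
    unfolding sum_distrib_right[symmetric] by (intro sum.cong) (simp_all only: inner if_distrib[of "\<lambda>y. y * _"] mult_1 mult_zero_left)
  also have "\<dots> = (\<Sum>x\<in>{x \<in> X. u x = V}. \<phi> x)"
    using assms(2) by (simp add: sum.inter_filter)
  finally show ?thesis by simp
qed

text \<open>Read a coloring by colors instead of vertices: the color classes are stable sets whose
  sizes are the exponents of \<open>m\<close>, and nonempty color sets mean that the classes cover
  \<open>V\<close>. Once inclusion-exclusion removes the covering condition, the classes are chosen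
  independently.\<close>

lemma XG_expansion:
  assumes "simple_graph V E"
  shows "XG V E m = (\<Sum>W\<in>Pow V. (-1) ^ card (V - W) *
    mult_sps (\<lambda>j. of_nat (card (stable_sets E W j))) m)"
proof -
  have V: "finite V" and EV: "\<And>u v. E u v \<Longrightarrow> u \<in> V \<and> v \<in> V"
    using assms by (auto simp: simple_graph_def)
  let ?K = "Poly_Mapping.keys m" let ?l = "Poly_Mapping.lookup m"
  let ?X = "\<lambda>W. \<Pi>\<^sub>E i\<in>?K. stable_sets E W (?l i)"
  let ?u = "\<lambda>T :: nat \<Rightarrow> 'a set. \<Union>i\<in>?K. T i"
  have finst: "finite (stable_sets E W j)" if "W \<subseteq> V" for W j
    by (rule finite_subset[of _ "Pow V"]) (use that V in \<open>auto simp: stable_sets_def\<close>)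
  let ?Y = "{\<kappa>\<in>set_colorings V E. \<forall>i. ?l i = card {v\<in>V. i \<in> \<kappa> v}}"
  have "bij_betw (\<lambda>\<kappa>. \<lambda>i\<in>?K. {v \<in> V. i \<in> \<kappa> v}) ?Y {T \<in> ?X V. ?u T = V}"
  proof (rule bij_betwI[where g = "\<lambda>T v. {i \<in> ?K. v \<in> T i}"])
    \<comment> \<open>A color in use has a positive exponent in \<open>m\<close>. Finiteness of
      \<open>V\<close> matters here, since an infinite color class would have cardinality 0.\<close>
    have K: "i \<in> ?K" if "\<kappa> \<in> ?Y" "i \<in> \<kappa> v" "v \<in> V" for \<kappa> i v
    proof -
      have "card {v \<in> V. i \<in> \<kappa> v} \<noteq> 0" using that V by auto
      then show ?thesis using that(1) by (auto simp: in_keys_iff)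
    qed
    show "(\<lambda>\<kappa>. \<lambda>i\<in>?K. {v \<in> V. i \<in> \<kappa> v}) \<in> ?Y \<rightarrow> {T \<in> ?X V. ?u T = V}"
    proof
      fix \<kappa> assume \<kappa>: "\<kappa> \<in> ?Y"
      have "{v \<in> V. i \<in> \<kappa> v} \<in> stable_sets E V (?l i)" for i
        using \<kappa> unfolding stable_sets_def stable_set_def set_colorings_def by auto blast
      moreover have "(\<Union>i\<in>?K. {v \<in> V. i \<in> \<kappa> v}) = V"
      proof
        show "V \<subseteq> (\<Union>i\<in>?K. {v \<in> V. i \<in> \<kappa> v})"
        proof
          fix v assume v: "v \<in> V"
          then have "\<kappa> v \<noteq> {}" using \<kappa> by (simp add: set_colorings_def)
          then obtain i where "i \<in> \<kappa> v" by blast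
          then show "v \<in> (\<Union>i\<in>?K. {v \<in> V. i \<in> \<kappa> v})" using K[OF \<kappa>] v by auto
        qed
      qed auto
      ultimately show "(\<lambda>i\<in>?K. {v \<in> V. i \<in> \<kappa> v}) \<in> {T \<in> ?X V. ?u T = V}" by auto
    qed
    show "(\<lambda>T v. {i \<in> ?K. v \<in> T i}) \<in> {T \<in> ?X V. ?u T = V} \<rightarrow> ?Y"
    proof
      fix T assume T: "T \<in> {T \<in> ?X V. ?u T = V}"
      then have Ti: "T i \<in> stable_sets E V (?l i)" if "i \<in> ?K" for i using that by auto
      have "?l i = card {v \<in> V. i \<in> ?K \<and> v \<in> T i}" for i
      proof (cases "i \<in> ?K")
        case True
        then have "{v \<in> V. i \<in> ?K \<and> v \<in> T i} = T i" using Ti by (auto simp: stable_sets_def)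
        then show ?thesis using Ti[OF True] by (simp add: stable_sets_def)
      qed (simp add: in_keys_iff)
      moreover have "(\<lambda>v. {i \<in> ?K. v \<in> T i}) \<in> set_colorings V E"
      proof -
        have "{i \<in> ?K. v \<in> T i} \<noteq> {}" if "v \<in> V" for v using T that by auto
        moreover have "{i \<in> ?K. v \<in> T i} = {}" if "v \<notin> V" for v
          using Ti that by (auto simp: stable_sets_def)
        moreover have "{i \<in> ?K. v \<in> T i} \<inter> {i \<in> ?K. w \<in> T i} = {}" if "E v w" for v w
          using Ti that by (fastforce simp: stable_sets_def stable_set_def)
        ultimately show ?thesis by (simp add: set_colorings_def)
      qed
      ultimately show "(\<lambda>v. {i \<in> ?K. v \<in> T i}) \<in> ?Y" by simp
    qed
    show "(\<lambda>v. {i \<in> ?K. v \<in> (\<lambda>i\<in>?K. {v \<in> V. i \<in> \<kappa> v}) i}) = \<kappa>" if "\<kappa> \<in> ?Y" for \<kappa>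
    proof
      fix v
      have "\<kappa> v = {}" if "v \<notin> V" using \<open>\<kappa> \<in> ?Y\<close> that by (simp add: set_colorings_def)
      then show "{i \<in> ?K. v \<in> (\<lambda>i\<in>?K. {v \<in> V. i \<in> \<kappa> v}) i} = \<kappa> v"
        using K[OF that] by auto
    qed
    show "(\<lambda>i\<in>?K. {v \<in> V. i \<in> {i \<in> ?K. v \<in> T i}}) = T" if "T \<in> {T \<in> ?X V. ?u T = V}" for T
    proof
      fix i
      show "(\<lambda>i\<in>?K. {v \<in> V. i \<in> {i \<in> ?K. v \<in> T i}}) i = T i"
        using that by (cases "i \<in> ?K") (auto simp: PiE_iff extensional_def stable_sets_def)
    qed
  qed
  then have "XG V E m = of_nat (card {T \<in> ?X V. ?u T = V})"
    unfolding XG_def by (simp add: bij_betw_same_card)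
  also have "\<dots> = (\<Sum>T\<in>{T \<in> ?X V. ?u T = V}. 1)" by simp
  also have "\<dots> = (\<Sum>W\<in>Pow V. (-1) ^ card (V - W) * (\<Sum>T\<in>{T \<in> ?X V. ?u T \<subseteq> W}. 1))"
    using V by (intro inclusion_exclusion_cover) (auto intro!: finite_PiE finst simp: stable_sets_def)
  also have "\<dots> = (\<Sum>W\<in>Pow V. (-1) ^ card (V - W) * mult_sps (\<lambda>j. of_nat (card (stable_sets E W j))) m)"
  proof (rule sum.cong)
    fix W assume W: "W \<in> Pow V"
    have "{T \<in> ?X V. ?u T \<subseteq> W} = ?X W"
    proof
      show "{T \<in> ?X V. ?u T \<subseteq> W} \<subseteq> ?X W"
      proof
        fix T assume T: "T \<in> {T \<in> ?X V. ?u T \<subseteq> W}"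
        then have "T \<in> extensional ?K" "\<forall>i\<in>?K. T i \<in> stable_sets E V (?l i)" "\<forall>i\<in>?K. T i \<subseteq> W"
          unfolding PiE_iff by blast+
        then show "T \<in> ?X W" unfolding PiE_iff stable_sets_def by blast
      qed
      show "?X W \<subseteq> {T \<in> ?X V. ?u T \<subseteq> W}"
      proof
        fix T assume "T \<in> ?X W"
        then have "T \<in> extensional ?K" "\<forall>i\<in>?K. T i \<in> stable_sets E W (?l i)"
          unfolding PiE_iff by blast+
        then show "T \<in> {T \<in> ?X V. ?u T \<subseteq> W}"
          using W unfolding PiE_iff mem_Collect_eq stable_sets_def by blast
      qed
    qed
    then show "(-1) ^ card (V - W) * (\<Sum>T\<in>{T \<in> ?X V. ?u T \<subseteq> W}. 1)
        = (-1) ^ card (V - W) * mult_sps (\<lambda>j. of_nat (card (stable_sets E W j))) m"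
      by (simp add: card_PiE mult_sps_def)
  qed simp
  finally show ?thesis .
qed

subsection \<open>Sets of Lyndon heaps\<close>

lemma bij_betw_divisors_PiE:
  "bij_betw (\<lambda>a. restrict (Poly_Mapping.lookup a) (Poly_Mapping.keys m))
    {a. \<forall>i. Poly_Mapping.lookup a i \<le> Poly_Mapping.lookup (m :: mon) i}
    (\<Pi>\<^sub>E i\<in>Poly_Mapping.keys m. {..Poly_Mapping.lookup m i})"
proof (rule bij_betwI[where g = "\<lambda>t. \<Sum>i\<in>Poly_Mapping.keys m. Poly_Mapping.single i (t i)"])
  let ?K = "Poly_Mapping.keys m" let ?D = "{a. \<forall>i. Poly_Mapping.lookup a i \<le> Poly_Mapping.lookup m i}"
  have lk: "Poly_Mapping.lookup (\<Sum>i\<in>?K. Poly_Mapping.single i (t i)) j = (if j \<in> ?K then t j else 0)" for t :: "nat \<Rightarrow> nat" and j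
    by (simp add: lookup_sum lookup_single when_def sum.delta)
  show "(\<lambda>a. restrict (Poly_Mapping.lookup a) ?K) \<in> ?D \<rightarrow> (\<Pi>\<^sub>E i\<in>?K. {..Poly_Mapping.lookup m i})"
    by auto
  show "(\<lambda>t. \<Sum>i\<in>?K. Poly_Mapping.single i (t i)) \<in> (\<Pi>\<^sub>E i\<in>?K. {..Poly_Mapping.lookup m i}) \<rightarrow> ?D"
    by (auto simp: lk PiE_iff)
  show "(\<Sum>i\<in>?K. Poly_Mapping.single i (restrict (Poly_Mapping.lookup a) ?K i)) = a" if "a \<in> ?D" for a
  proof (rule poly_mapping_eqI)
    fix j
    have "Poly_Mapping.lookup a j = 0" if "j \<notin> ?K"
      using that \<open>a \<in> ?D\<close> by (metis in_keys_iff le_zero_eq mem_Collect_eq)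
    then show "Poly_Mapping.lookup (\<Sum>i\<in>?K. Poly_Mapping.single i (restrict (Poly_Mapping.lookup a) ?K i)) j = Poly_Mapping.lookup a j"
      unfolding lk by simp
  qed
  show "restrict (Poly_Mapping.lookup (\<Sum>i\<in>?K. Poly_Mapping.single i (t i))) ?K = t"
    if "t \<in> (\<Pi>\<^sub>E i\<in>?K. {..Poly_Mapping.lookup m i})" for t
  proof
    fix j
    show "restrict (Poly_Mapping.lookup (\<Sum>i\<in>?K. Poly_Mapping.single i (t i))) ?K j = t j"
      using that by (cases "j \<in> ?K") (simp_all add: lk PiE_iff extensional_def)
  qed
qed

text \<open>\<open>1 + pbar k\<close> is itself the product of \<open>geom k\<close> over all
  variables, so multiplying by it acts on each variable separately.\<close>

lemma mult_sps_geom: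
  assumes f0: "fps_nth f 0 = 1" and k: "0 < k"
  shows "mult_sps (fps_nth f) m + sps_times (pbar k) (mult_sps (fps_nth f)) m
    = mult_sps (fps_nth (geom k * f)) m"
proof -
  let ?K = "Poly_Mapping.keys m" let ?l = "Poly_Mapping.lookup m"
  let ?D = "{a. \<forall>i. Poly_Mapping.lookup a i \<le> ?l i}"
  let ?F = "mult_sps (fps_nth f)"
  let ?g = "\<lambda>i j. if k dvd j then fps_nth f (?l i - j) else 0"
  have summand: "(if \<forall>i. k dvd Poly_Mapping.lookup a i then ?F (m - a) else 0)
      = (\<Prod>i\<in>?K. ?g i (Poly_Mapping.lookup a i))" if a: "a \<in> ?D" for a
  proof -
    have "Poly_Mapping.lookup a i = 0" if "i \<notin> ?K" for i
      using that a by (metis in_keys_iff le_zero_eq mem_Collect_eq)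
    then have "(\<forall>i. k dvd Poly_Mapping.lookup a i) \<longleftrightarrow> (\<forall>i\<in>?K. k dvd Poly_Mapping.lookup a i)"
      by (metis dvd_0_right)
    moreover have "?F (m - a) = (\<Prod>i\<in>?K. fps_nth f (?l i - Poly_Mapping.lookup a i))"
      using f0 by (subst mult_sps_superset[where A = ?K]) (auto simp: in_keys_iff lookup_minus)
    moreover have "(\<Prod>i\<in>?K. ?g i (Poly_Mapping.lookup a i)) = 0" if "\<not> (\<forall>i\<in>?K. k dvd Poly_Mapping.lookup a i)"
      using that by (intro prod_zero) auto
    ultimately show ?thesis by auto
  qed
  have "?F m + sps_times (pbar k) ?F m = (\<Sum>a\<in>?D. if \<forall>i. k dvd Poly_Mapping.lookup a i then ?F (m - a) else 0)"
  proof -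
    have "0 \<in> ?D" by simp
    moreover have "(\<Sum>a\<in>?D - {0}. pbar k a * ?F (m - a))
        = (\<Sum>a\<in>?D - {0}. if \<forall>i. k dvd Poly_Mapping.lookup a i then ?F (m - a) else 0)"
      by (intro sum.cong) (auto simp: pbar_def)
    moreover have "pbar k 0 = 0" by (simp add: pbar_def)
    ultimately show ?thesis
      unfolding sps_times_def using finite_divisors[of m] by (simp add: sum.remove[of ?D 0])
  qed
  also have "\<dots> = (\<Sum>a\<in>?D. \<Prod>i\<in>?K. ?g i (Poly_Mapping.lookup a i))"
    by (rule sum.cong[OF refl summand])
  also have "\<dots> = (\<Sum>a\<in>?D. \<Prod>i\<in>?K. ?g i (restrict (Poly_Mapping.lookup a) ?K i))"
    by (intro sum.cong prod.cong refl) simp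
  also have "\<dots> = (\<Sum>t\<in>(\<Pi>\<^sub>E i\<in>?K. {..?l i}). \<Prod>i\<in>?K. ?g i (t i))"
    by (rule sum.reindex_bij_betw[OF bij_betw_divisors_PiE])
  also have "\<dots> = (\<Prod>i\<in>?K. \<Sum>j\<le>?l i. ?g i j)"
    by (rule prod_sum_PiE[symmetric]) simp_all
  also have "\<dots> = (\<Prod>i\<in>?K. fps_nth (geom k * f) (?l i))"
    by (intro prod.cong) (auto simp: fps_mult_nth geom_nth atLeast0AtMost intro!: sum.cong)
  finally show ?thesis unfolding mult_sps_def .
qed

definition stype :: "'a list set \<Rightarrow> nat list" where
  "stype S = rev (sorted_list_of_multiset (image_mset length (mset_set S)))"

lemma mset_stype: "mset (stype S) = image_mset length (mset_set S)"
  by (simp add: stype_def)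

lemma stype_desc: "sorted_wrt (\<ge>) (stype S)"
  by (simp add: stype_def sorted_wrt_rev)

lemma stype_insert:
  assumes "finite S" "x \<notin> S" "\<And>y. y \<in> S \<Longrightarrow> length y \<le> length x"
  shows "stype (insert x S) = length x # stype S"
proof (rule desc_eqI)
  show "sorted_wrt (\<ge>) (length x # stype S)"
  proof -
    have "set (stype S) = length ` S" using assms(1) by (metis mset_stype set_mset_mset set_image_mset finite_set_mset_mset_set)
    then show ?thesis using stype_desc assms(3) by auto
  qed
  show "mset (stype (insert x S)) = mset (length x # stype S)"
    using assms by (simp add: mset_stype)
qed (rule stype_desc)

lemma pbarl_Nil: "pbarl [] m = (if m = 0 then 1 else 0)"
  by (simp add: pbarl_def sps_prod_def sps_one_def)

lemma pbarl_Cons: "pbarl (k # la) = sps_times (pbar k) (pbarl la)"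
  by (simp add: pbarl_def sps_prod_def)

text \<open>Expanding the product of \<open>1 + pbar (length l)\<close> over the words
  \<open>l\<close> chooses a subset \<open>S\<close>. Words are added by increasing length, so that
  each new factor goes to the head of the decreasing list \<open>stype S\<close> and no product has
  to be reordered.\<close>

lemma sum_pbarl_subsets:
  assumes "finite \<Lambda>" "[] \<notin> \<Lambda>"
  shows "(\<Sum>S\<in>Pow \<Lambda>. pbarl (stype S) m) = mult_sps (fps_nth (\<Prod>l\<in>\<Lambda>. geom (length l))) m"
  using assms
proof (induction \<Lambda> arbitrary: m rule: finite_ranking_induct[where f = length])
  case empty
  have "mult_sps (fps_nth 1) m = (if m = 0 then 1 else 0)"
  proof (cases "m = 0")
    case False
    then obtain i where "i \<in> Poly_Mapping.keys m" using keys_eq_empty by blast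
    then show ?thesis using False unfolding mult_sps_def by (auto simp: in_keys_iff card_gt_0_iff)
  qed (simp add: mult_sps_def)
  then show ?case unfolding prod.empty by (simp only:) (simp add: stype_def pbarl_Nil)
next
  case (insert x \<Lambda>)
  show ?case
  proof (cases "x \<in> \<Lambda>")
    case True then show ?thesis using insert by (simp add: insert_absorb)
  next
    case False
    let ?f = "\<Prod>l\<in>\<Lambda>. geom (length l)"
    have IH: "(\<Sum>S\<in>Pow \<Lambda>. pbarl (stype S) m) = mult_sps (fps_nth ?f) m" for m
      using insert by simp
    have inj: "inj_on (insert x) (Pow \<Lambda>)" using False by (auto intro!: inj_onI)
    have disj: "Pow \<Lambda> \<inter> insert x ` Pow \<Lambda> = {}" using False by auto
    have f0: "fps_nth ?f 0 = 1" by (induction \<Lambda> rule: infinite_finite_induct) (simp_all add: geom_nth)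
    have "(\<Sum>S\<in>Pow (insert x \<Lambda>). pbarl (stype S) m)
        = (\<Sum>S\<in>Pow \<Lambda>. pbarl (stype S) m) + (\<Sum>S\<in>insert x ` Pow \<Lambda>. pbarl (stype S) m)"
      unfolding Pow_insert using insert.hyps(1) disj by (intro sum.union_disjoint) auto
    also have "(\<Sum>S\<in>insert x ` Pow \<Lambda>. pbarl (stype S) m) = (\<Sum>S\<in>Pow \<Lambda>. pbarl (length x # stype S) m)"
    proof (subst sum.reindex[OF inj], rule sum.cong)
      fix S assume S: "S \<in> Pow \<Lambda>"
      then have "stype (insert x S) = length x # stype S"
        using insert.hyps False finite_subset by (intro stype_insert) auto
      then show "((\<lambda>S. pbarl (stype S) m) \<circ> insert x) S = pbarl (length x # stype S) m" by simp
    qed simp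
    also have "\<dots> = sps_times (pbar (length x)) (\<lambda>m. \<Sum>S\<in>Pow \<Lambda>. pbarl (stype S) m) m"
      unfolding sps_times_def pbarl_Cons sum_distrib_left by (rule sum.swap)
    also have "(\<Sum>S\<in>Pow \<Lambda>. pbarl (stype S) m) + \<dots> = mult_sps (fps_nth (geom (length x) * ?f)) m"
      unfolding IH using f0 insert.prems by (intro mult_sps_geom) auto
    finally show ?thesis using insert.hyps(1) False by simp
  qed
qed

text \<open>Each factor \<open>pbar k\<close> has no term of degree below \<open>k\<close>. Hence
  finitely many partitions reach a given \<open>m\<close>, and cutting off words longer than
  \<open>deg m\<close> is harmless.\<close>

lemma pbarl_nonzero_le:
  "(\<forall>k\<in>set la. 0 < k) \<Longrightarrow> pbarl la m \<noteq> 0 \<Longrightarrow> sum_list la \<le> deg m"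
proof (induction la arbitrary: m)
  case (Cons k la)
  then obtain a where a: "\<forall>i. Poly_Mapping.lookup a i \<le> Poly_Mapping.lookup m i"
    "pbar k a \<noteq> 0" "pbarl la (m - a) \<noteq> 0"
    unfolding pbarl_Cons sps_times_def
    by (metis (no_types, lifting) mem_Collect_eq mult_eq_0_iff sum.neutral)
  have "deg m = deg a + deg (m - a)" using divisor_add[OF a(1)] deg_add by metis
  moreover have "sum_list la \<le> deg (m - a)" using Cons a by simp
  moreover have "k \<le> deg a"
  proof -
    have "a \<noteq> 0" "\<forall>i. k dvd Poly_Mapping.lookup a i" using a(2) by (auto simp: pbar_def split: if_splits)
    then obtain i where i: "i \<in> Poly_Mapping.keys a" using keys_eq_empty by blast
    then have "k \<le> Poly_Mapping.lookup a i"
      using \<open>\<forall>i. k dvd Poly_Mapping.lookup a i\<close> by (auto simp: in_keys_iff intro: dvd_imp_le)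
    also have "\<dots> \<le> deg a" unfolding deg_def using i by (intro member_le_sum) auto
    finally show ?thesis .
  qed
  ultimately show ?case by simp
qed simp

lemma count_image_mset_set:
  assumes "finite A" shows "count (image_mset f (mset_set A)) b = card {a \<in> A. f a = b}"
proof -
  have "count (image_mset f (mset_set A)) b = (\<Sum>a\<in>{a \<in> A. f a = b}. count (mset_set A) a)"
    unfolding count_image_mset' using assms by (intro sum.cong) auto
  also have "\<dots> = (\<Sum>a\<in>{a \<in> A. f a = b}. 1)" by (intro sum.cong) (simp_all add: assms)
  finally show ?thesis by simp
qed

lemma stype_eq_iff:
  assumes "finite S" "sorted_wrt (\<ge>) la"
  shows "stype S = la \<longleftrightarrow> (\<forall>k. card {w\<in>S. length w = k} = count_list la k)"
proof -
  have "stype S = la \<longleftrightarrow> image_mset length (mset_set S) = mset la"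
    using desc_eqI[OF stype_desc assms(2)] mset_stype by metis
  also have "\<dots> \<longleftrightarrow> (\<forall>k. card {w\<in>S. length w = k} = count_list la k)"
    using assms(1) by (simp add: multiset_eq_iff count_mset count_image_mset_set)
  finally show ?thesis .
qed

lemma stype_length_le:
  assumes "finite S" "w \<in> S" shows "length w \<le> sum_list (stype S)"
proof -
  have "length w \<in># mset (stype S)" using assms by (simp add: mset_stype)
  then show ?thesis by (intro member_le_sum_list) simp_all
qed

text \<open>The words of each length are chosen independently; a length that is not a part of
  \<open>la\<close> admits only the empty choice.\<close>

lemma card_subsets_stype:
  assumes fin: "finite \<Lambda>" and la: "sorted_wrt (\<ge>) la"
  shows "card {S \<in> Pow \<Lambda>. stype S = la}
    = (\<Prod>k\<in>set la. card {w \<in> \<Lambda>. length w = k} choose count_list la k)"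
proof -
  let ?B = "\<lambda>k. {T. T \<subseteq> {w \<in> \<Lambda>. length w = k} \<and> card T = count_list la k}"
  let ?A = "{S \<in> Pow \<Lambda>. stype S = la}"
  have A: "S \<in> ?A \<longleftrightarrow> S \<subseteq> \<Lambda> \<and> (\<forall>k. card {w\<in>S. length w = k} = count_list la k)" for S
    using stype_eq_iff[OF _ la] finite_subset[OF _ fin] by auto
  have "bij_betw (\<lambda>S. \<lambda>k\<in>set la. {w \<in> S. length w = k}) ?A (Pi\<^sub>E (set la) ?B)"
  proof (rule bij_betwI[where g = "\<lambda>T. \<Union>k\<in>set la. T k"])
    show "(\<lambda>S. \<lambda>k\<in>set la. {w \<in> S. length w = k}) \<in> ?A \<rightarrow> Pi\<^sub>E (set la) ?B"
      unfolding Pi_def A by auto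
    show "(\<lambda>T. \<Union>k\<in>set la. T k) \<in> Pi\<^sub>E (set la) ?B \<rightarrow> ?A"
    proof
      fix T assume T: "T \<in> Pi\<^sub>E (set la) ?B"
      then have Tk: "T k \<subseteq> {w \<in> \<Lambda>. length w = k}" "card (T k) = count_list la k" if "k \<in> set la" for k
        using that by (auto simp: PiE_iff)
      have "{w \<in> (\<Union>k\<in>set la. T k). length w = k} = (if k \<in> set la then T k else {})" for k
        using Tk(1) by auto
      then have "card {w \<in> (\<Union>k\<in>set la. T k). length w = k} = count_list la k" for k
        using Tk(2) by (simp add: count_notin)
      moreover have "(\<Union>k\<in>set la. T k) \<subseteq> \<Lambda>" using Tk(1) by blast
      ultimately show "(\<Union>k\<in>set la. T k) \<in> ?A" unfolding A by blast
    qed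
    show "(\<Union>k\<in>set la. (\<lambda>k\<in>set la. {w \<in> S. length w = k}) k) = S" if "S \<in> ?A" for S
    proof -
      have "length w \<in> set la" if "w \<in> S" for w
      proof -
        have "finite S" using \<open>S \<in> ?A\<close> fin finite_subset by blast
        then have "finite {v \<in> S. length v = length w}" by simp
        then have "card {v \<in> S. length v = length w} \<noteq> 0" using that by auto
        then show ?thesis using \<open>S \<in> ?A\<close> unfolding A by (metis count_notin)
      qed
      then show ?thesis by auto
    qed
    show "(\<lambda>k\<in>set la. {w \<in> (\<Union>k\<in>set la. T k). length w = k}) = T" if "T \<in> Pi\<^sub>E (set la) ?B" for T
    proof
      fix k
      show "(\<lambda>k\<in>set la. {w \<in> (\<Union>k\<in>set la. T k). length w = k}) k = T k"
      proof (cases "k \<in> set la")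
        case True
        have "T j \<subseteq> {w \<in> \<Lambda>. length w = j}" if "j \<in> set la" for j
          using that \<open>T \<in> Pi\<^sub>E (set la) ?B\<close> by (auto simp: PiE_iff)
        then show ?thesis using True by auto
      next
        case False
        then show ?thesis using that by (simp add: PiE_iff extensional_def)
      qed
    qed
  qed
  then have "card ?A = card (Pi\<^sub>E (set la) ?B)" by (rule bij_betw_same_card)
  also have "\<dots> = (\<Prod>k\<in>set la. card {w \<in> \<Lambda>. length w = k} choose count_list la k)"
    using fin by (simp add: card_PiE n_subsets)
  finally show ?thesis .
qed

section \<open>Transfer from heaps to words, and conclusion\<close>

lemma simple_graph_induced:
  "simple_graph V E \<Longrightarrow> W \<subseteq> V \<Longrightarrow> simple_graph W (induced E W)"
  by (auto simp: simple_graph_def induced_def intro: finite_subset)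

lemma ordered_loopless_graph_simple_graph: "simple_graph V E \<Longrightarrow> ordered_loopless_graph E"
  by unfold_locales (auto simp: simple_graph_def)

lemma lynwords_induced: "lynwords (induced E W) W = lynwords E W"
proof -
  have "nf (induced E W) w \<longleftrightarrow> nf E w" if "set w \<subseteq> W" for w
  proof -
    have "induced E W x y = E x y" if "x \<in> set w" "y \<in> set w" for x y
      using that \<open>set w \<subseteq> W\<close> by (auto simp: induced_def)
    then have "teq (induced E W) w v \<longleftrightarrow> teq E w v" for v
      using teq_cong_edge[of "induced E W" w v E] teq_cong_edge[of E w v "induced E W"] by blast
    then show ?thesis by (simp add: nf_def)
  qed
  then show ?thesis by (auto simp: lynwords_def)
qed

lemma card_lyndon_induced:
  assumes "simple_graph V E" "W \<subseteq> V"
  shows "card (lyndon W (induced E W) k) = card {w \<in> lynwords E W. length w = k}"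
proof -
  interpret ordered_loopless_graph "induced E W"
    using ordered_loopless_graph_simple_graph[OF simple_graph_induced[OF assms]] .
  have "lyndon W (induced E W) k = {L \<in> heapcl (induced E W) ` lynwords (induced E W) W. hsize L = k}"
    unfolding lyndon_def lyndon_heaps_eq[symmetric] by simp
  also have "\<dots> = heapcl (induced E W) ` {w \<in> lynwords (induced E W) W. length w = k}"
    by (auto simp: hsize_heapcl)
  also have "card \<dots> = card {w \<in> lynwords (induced E W) W. length w = k}"
    by (intro card_image inj_on_subset[OF inj_on_heapcl]) auto
  finally show ?thesis unfolding lynwords_induced .
qed

text \<open>A word in a set of type \<open>la\<close> is no longer than \<open>sum_list la\<close>,
  so any cut-off from there on gives the same sets. \<open>N\<close> stays free because the two
  claims use different cut-offs, \<open>deg m\<close> and \<open>sum_list la\<close>.\<close>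

lemma Ncov_eq:
  assumes "simple_graph V E" "is_partition la" "sum_list la \<le> N"
  shows "Ncov V E la = card {S \<in> Pow {w \<in> lynwords E V. length w \<le> N}. stype S = la \<and> \<Union> (set ` S) = V}"
    (is "_ = card ?A")
proof -
  interpret ordered_loopless_graph E using ordered_loopless_graph_simple_graph[OF assms(1)] .
  let ?\<Lambda> = "{w \<in> lynwords E V. length w \<le> N}"
  have fin: "finite ?\<Lambda>" using assms(1) by (intro finite_lynwords) (simp add: simple_graph_def)
  have desc: "sorted_wrt (\<ge>) la" using assms(2) by (simp add: is_partition_def)
  have cnt: "card {L \<in> heapcl E ` S. hsize L = k} = card {w \<in> S. length w = k}" if "S \<subseteq> lynwords E V" for S k
  proof -
    have "{L \<in> heapcl E ` S. hsize L = k} = heapcl E ` {w \<in> S. length w = k}" by (auto simp: hsize_heapcl)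
    then show ?thesis using that by (auto intro!: card_image inj_on_subset[OF inj_on_heapcl])
  qed
  let ?B = "{S. finite S \<and> (\<forall>L\<in>S. lyndon_heap V E L) \<and>
      (\<forall>k. card {L\<in>S. hsize L = k} = count_list la k) \<and> (\<Union>L\<in>S. used L) = V}"
  have "?B = image (heapcl E) ` ?A"
  proof
    show "?B \<subseteq> image (heapcl E) ` ?A"
    proof
      fix S assume S: "S \<in> ?B"
      then have "S \<subseteq> heapcl E ` lynwords E V" unfolding lyndon_heaps_eq[symmetric] by blast
      then obtain S' where S': "S' \<subseteq> lynwords E V" "S = heapcl E ` S'" by (meson subset_imageE)
      have finS': "finite S'"
        using S S' finite_imageD[of "heapcl E" S'] inj_on_subset[OF inj_on_heapcl] by auto
      have "\<forall>k. card {w \<in> S'. length w = k} = count_list la k" using S S' cnt by auto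
      then have st: "stype S' = la" using stype_eq_iff[OF finS' desc] by blast
      have "length w \<le> N" if "w \<in> S'" for w
        using stype_length_le[OF finS' that] st assms(3) by simp
      moreover have "\<Union> (set ` S') = V" using S unfolding S'(2) by (simp add: used_heapcl)
      ultimately have "S' \<in> ?A" using S' st by blast
      then show "S \<in> image (heapcl E) ` ?A" using S'(2) by blast
    qed
    show "image (heapcl E) ` ?A \<subseteq> ?B"
    proof
      fix S assume "S \<in> image (heapcl E) ` ?A"
      then obtain S' where S': "S' \<in> ?A" "S = heapcl E ` S'" by blast
      then have sub: "S' \<subseteq> lynwords E V" by blast
      have finS': "finite S'" using S'(1) finite_subset[OF _ fin] by blast
      have "\<forall>k. card {w \<in> S'. length w = k} = count_list la k"
        using stype_eq_iff[OF finS' desc] S'(1) by blast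
      then have "\<forall>k. card {L\<in>S. hsize L = k} = count_list la k" unfolding S'(2) using cnt[OF sub] by simp
      moreover have "\<forall>L\<in>S. lyndon_heap V E L" unfolding S'(2) using sub lyndon_heaps_eq by blast
      moreover have "(\<Union>L\<in>S. used L) = V" unfolding S'(2) using S'(1) by (simp add: used_heapcl)
      ultimately show "S \<in> ?B" using finS' S'(2) by simp
    qed
  qed
  moreover have "inj_on (image (heapcl E)) ?A"
    by (rule inj_on_subset[OF inj_on_image_Pow[OF inj_on_heapcl[of V]]]) auto
  ultimately show ?thesis unfolding Ncov_def by (simp add: card_image)
qed

lemma omega_XG:
  assumes "simple_graph V E"
  shows "omega (XG V E) m = (\<Sum>W\<in>Pow V. (-1) ^ card (V - W) *
    mult_sps (\<lambda>j. of_nat (card (nfwords E W j))) m)"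
proof -
  interpret ordered_loopless_graph E using ordered_loopless_graph_simple_graph[OF assms] .
  have V: "finite V" using assms by (simp add: simple_graph_def)
  let ?n = "deg m"
  let ?s = "\<lambda>W j. of_nat (card (stable_sets E W j)) :: rat" and ?h = "\<lambda>W j. of_nat (card (nfwords E W j)) :: rat"
  have "omega_pair ?n (hom ?n (mult_sps (?s W))) (hom ?n (mult_sps (?h W)))" if W: "W \<in> Pow V" for W
  proof -
    have fin: "finite W" using W V finite_subset by auto
    obtain c where c: "\<forall>n. of_nat n * ?s W n = (\<Sum>j=1..n. (-1) ^ (j - 1) * c j * ?s W (n - j))"
      "\<forall>n. of_nat n * ?h W n = (\<Sum>j=1..n. c j * ?h W (n - j))"
      using log_derivative_coefficients[of "?s W" "?h W"] cartier_foata[OF fin] by auto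
    have "stable_sets E W 0 = {{}}"
      using finite_subset[OF _ fin] by (auto simp: stable_sets_def stable_set_def)
    moreover have "nfwords E W 0 = {[]}" using nf_Nil by (auto simp: nfwords_def)
    ultimately show ?thesis using c by (intro omega_pair_mult_sps[where c = c]) auto
  qed
  then have "omega_pair ?n (\<lambda>m. \<Sum>W\<in>Pow V. (-1) ^ card (V - W) * hom ?n (mult_sps (?s W)) m)
      (\<lambda>m. \<Sum>W\<in>Pow V. (-1) ^ card (V - W) * hom ?n (mult_sps (?h W)) m)"
    using V by (intro omega_pair_sum omega_pair_scale) auto
  moreover have "hom ?n (XG V E) = (\<lambda>m. \<Sum>W\<in>Pow V. (-1) ^ card (V - W) * hom ?n (mult_sps (?s W)) m)"
    by (rule ext) (simp add: hom_def XG_expansion[OF assms])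
  ultimately have "omega_pair ?n (hom ?n (XG V E)) (\<lambda>m. \<Sum>W\<in>Pow V. (-1) ^ card (V - W) * hom ?n (mult_sps (?h W)) m)"
    by simp
  from omega_eqI[OF this] show ?thesis by (simp add: hom_def)
qed

lemma subsets_lynwords:
  "W \<subseteq> V \<Longrightarrow> {S \<in> Pow {w \<in> lynwords E V. length w \<le> N}. \<Union> (set ` S) \<subseteq> W}
    = Pow {w \<in> lynwords E W. length w \<le> N}"
  unfolding lynwords_def by blast

theorem theorem1p5:
  fixes V :: "'a::linorder set" and E :: "'a \<Rightarrow> 'a \<Rightarrow> bool"
  assumes "simple_graph V E"
  shows "(\<forall>m. omega (XG V E) m =
            (\<Sum>la\<in>{la. is_partition la \<and> pbarl la m \<noteq> 0}. of_nat (Ncov V E la) * pbarl la m))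
       \<and> (\<forall>la. is_partition la \<longrightarrow>
            int (Ncov V E la) =
              (\<Sum>W\<in>Pow V. (-1) ^ card (V - W) *
                 (\<Prod>k\<in>set la. int (card (lyndon W (induced E W) k) choose count_list la k))))"
proof (intro conjI allI impI)
  interpret ordered_loopless_graph E using ordered_loopless_graph_simple_graph[OF assms] .
  have V: "finite V" using assms by (simp add: simple_graph_def)
  let ?\<Lambda> = "\<lambda>W N. {w \<in> lynwords E W. length w \<le> N}"
  have fin\<Lambda>: "finite (?\<Lambda> W N)" if "W \<subseteq> V" for W N
    using that V finite_subset by (intro finite_lynwords) blast
  have cover: "\<Union> (set ` S) \<subseteq> V" if "S \<in> Pow (?\<Lambda> V N)" for S N
    using that unfolding lynwords_def by blast
  {
    fix m
    let ?N = "deg m"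
    let ?P = "{la. is_partition la \<and> pbarl la m \<noteq> 0}"
    let ?C = "{S \<in> Pow (?\<Lambda> V ?N). \<Union> (set ` S) = V}"
    have finC: "finite ?C" using fin\<Lambda>[of V] by simp
    have part: "is_partition (stype S)" if "S \<in> ?C" for S
    proof -
      have "finite S" using that finite_subset[OF _ fin\<Lambda>[of V ?N]] by auto
      then have "set (stype S) = length ` S"
        by (metis mset_stype set_mset_mset set_image_mset finite_set_mset_mset_set)
      then show ?thesis using that stype_desc by (auto simp: is_partition_def lynwords_def lyn_def)
    qed
    have finP: "finite ?P"
    proof (rule finite_subset)
      show "?P \<subseteq> (\<Union>n\<le>?N. partitions n)"
        using pbarl_nonzero_le by (auto simp: partitions_def is_partition_def)
    qed (simp add: finite_partitions)
    have "omega (XG V E) m = (\<Sum>W\<in>Pow V. (-1) ^ card (V - W) *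
        mult_sps (\<lambda>j. of_nat (card (nfwords E W j))) m)"
      by (rule omega_XG[OF assms])
    also have "\<dots> = (\<Sum>W\<in>Pow V. (-1) ^ card (V - W) *
        (\<Sum>S\<in>{S \<in> Pow (?\<Lambda> V ?N). \<Union> (set ` S) \<subseteq> W}. pbarl (stype S) m))"
    proof (rule sum.cong)
      fix W assume W: "W \<in> Pow V"
      then have finW: "finite W" using V finite_subset by blast
      \<comment> \<open>Only coefficients up to the largest exponent of \<open>m\<close> enter, so
        Lyndon words longer than \<open>deg m\<close> may be left out of the product.\<close>
      have "Poly_Mapping.lookup m i \<le> ?N" if "i \<in> Poly_Mapping.keys m" for i
        unfolding deg_def using that by (intro member_le_sum) auto
      then have "mult_sps (\<lambda>j. of_nat (card (nfwords E W j))) m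
          = mult_sps (fps_nth (\<Prod>l\<in>?\<Lambda> W ?N. geom (length l))) m"
        unfolding mult_sps_def using nfwords_gf[OF finW] by (intro prod.cong) auto
      also have "\<dots> = (\<Sum>S\<in>Pow (?\<Lambda> W ?N). pbarl (stype S) m)"
        using fin\<Lambda>[of W] W by (intro sum_pbarl_subsets[symmetric]) (auto simp: lynwords_def lyn_def)
      finally show "(-1) ^ card (V - W) * mult_sps (\<lambda>j. of_nat (card (nfwords E W j))) m =
          (-1) ^ card (V - W) * (\<Sum>S\<in>{S \<in> Pow (?\<Lambda> V ?N). \<Union> (set ` S) \<subseteq> W}. pbarl (stype S) m)"
        using subsets_lynwords[of W V E ?N] W by simp
    qed simp
    \<comment> \<open>Inclusion-exclusion backwards: the subsets \<open>W\<close> recombine into the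
      condition that the words of \<open>S\<close> use all of \<open>V\<close>.\<close>
    also have "\<dots> = (\<Sum>S\<in>?C. pbarl (stype S) m)"
      using V fin\<Lambda>[of V] cover by (intro inclusion_exclusion_cover[symmetric]) auto
    \<comment> \<open>Vanishing terms are dropped so that grouping by \<open>stype\<close> stays
      within the index set of the claim.\<close>
    also have "\<dots> = (\<Sum>S\<in>{S \<in> ?C. pbarl (stype S) m \<noteq> 0}. pbarl (stype S) m)"
      using finC by (intro sum.mono_neutral_right) auto
    also have "\<dots> = (\<Sum>la\<in>?P. \<Sum>S\<in>{S \<in> {S \<in> ?C. pbarl (stype S) m \<noteq> 0}. stype S = la}. pbarl (stype S) m)"
    proof (rule sum.group[symmetric])
      show "stype ` {S \<in> ?C. pbarl (stype S) m \<noteq> 0} \<subseteq> ?P" using part by blast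
      show "finite {S \<in> ?C. pbarl (stype S) m \<noteq> 0}" by (rule finite_subset[OF _ finC]) blast
    qed (rule finP)
    also have "\<dots> = (\<Sum>la\<in>?P. of_nat (Ncov V E la) * pbarl la m)"
    proof (rule sum.cong)
      fix la assume la: "la \<in> ?P"
      then have "sum_list la \<le> ?N" using pbarl_nonzero_le by (simp add: is_partition_def)
      then have "Ncov V E la = card {S \<in> Pow (?\<Lambda> V ?N). stype S = la \<and> \<Union> (set ` S) = V}"
        using la by (intro Ncov_eq[OF assms]) auto
      moreover have "{S \<in> {S \<in> ?C. pbarl (stype S) m \<noteq> 0}. stype S = la}
          = {S \<in> Pow (?\<Lambda> V ?N). stype S = la \<and> \<Union> (set ` S) = V}"
        using la by blast
      ultimately show "(\<Sum>S\<in>{S \<in> {S \<in> ?C. pbarl (stype S) m \<noteq> 0}. stype S = la}. pbarl (stype S) m)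
          = of_nat (Ncov V E la) * pbarl la m" by simp
    qed simp
    finally show "omega (XG V E) m = (\<Sum>la\<in>?P. of_nat (Ncov V E la) * pbarl la m)" .
  }
  {
    fix la assume la: "is_partition la"
    let ?N = "sum_list la"
    let ?X = "{S \<in> Pow (?\<Lambda> V ?N). stype S = la}"
    have desc: "sorted_wrt (\<ge>) la" using la by (simp add: is_partition_def)
    have "int (Ncov V E la) = (\<Sum>S\<in>{S \<in> ?X. \<Union> (set ` S) = V}. 1)"
      using Ncov_eq[OF assms la, of ?N] by (simp add: conj_assoc)
    also have "\<dots> = (\<Sum>W\<in>Pow V. (-1) ^ card (V - W) * (\<Sum>S\<in>{S \<in> ?X. \<Union> (set ` S) \<subseteq> W}. 1))"
    proof (rule inclusion_exclusion_cover[OF V])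
      show "finite ?X" using fin\<Lambda>[of V ?N] by simp
      show "\<Union> (set ` S) \<subseteq> V" if "S \<in> ?X" for S using cover[of S ?N] that by blast
    qed
    also have "\<dots> = (\<Sum>W\<in>Pow V. (-1) ^ card (V - W) *
                 (\<Prod>k\<in>set la. int (card (lyndon W (induced E W) k) choose count_list la k)))"
    proof (rule sum.cong)
      fix W assume W: "W \<in> Pow V"
      have "{S \<in> ?X. \<Union> (set ` S) \<subseteq> W} = {S \<in> Pow (?\<Lambda> W ?N). stype S = la}"
        using subsets_lynwords[of W V E ?N] W by blast
      then have "(\<Sum>S\<in>{S \<in> ?X. \<Union> (set ` S) \<subseteq> W}. 1)
          = int (\<Prod>k\<in>set la. card {w \<in> ?\<Lambda> W ?N. length w = k} choose count_list la k)"
        using card_subsets_stype[OF fin\<Lambda> desc, of W ?N] W by simp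
      also have "\<dots> = (\<Prod>k\<in>set la. int (card (lyndon W (induced E W) k) choose count_list la k))"
      proof -
        have "{w \<in> ?\<Lambda> W ?N. length w = k} = {w \<in> lynwords E W. length w = k}" if "k \<in> set la" for k
          using member_le_sum_list[OF that] by auto
        then show ?thesis
          using card_lyndon_induced[OF assms, of W] W by (simp add: of_nat_prod)
      qed
      finally show "(-1) ^ card (V - W) * (\<Sum>S\<in>{S \<in> ?X. \<Union> (set ` S) \<subseteq> W}. 1)
          = (-1) ^ card (V - W) * (\<Prod>k\<in>set la. int (card (lyndon W (induced E W) k) choose count_list la k))"
        by simp
    qed simp
    finally show "int (Ncov V E la) = (\<Sum>W\<in>Pow V. (-1) ^ card (V - W) *
                 (\<Prod>k\<in>set la. int (card (lyndon W (induced E W) k) choose count_list la k)))" .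
  }
qed

end
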